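(* Let $\mathbb{K}\in\{\mathbb{R},\mathbb{C},\mathbb{H}\}$, $\delta=\dim_{\mathbb{R}}\mathbb{K}$, $m\ge 2$, $p\in 2\mathbb{N}$, and set $\alpha=\frac{\delta(m-1)-2}{2}$, $\beta=\frac{\delta-2}{2}$. Let $\xi$ be the largest root of the Jacobi polynomial $P^{(\alpha+1,\beta+1)}_{p/2}(t)$ and $\varepsilon=(1-\xi)/2$. Then the number $n$ of nodes of every projective cubature formula of index $p$ on $S^{\delta m-1}\subset\mathbb{K}^m$ satisfies \[ n\ \ge\ \frac{\Gamma(\alpha+2)\Gamma(\beta+1)}{\Gamma(\alpha+\beta+2)\,F(-\beta,\alpha+1;\alpha+2;\varepsilon)}\left(\frac{1}{\varepsilon}\right)^{\delta(m-1)/2}, \] where $F={}_2F_1$ is the Gauss hypergeometric function.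
   Context: $\mathbb{H}$ denotes the quaternions; $\delta=1,2,4$ for $\mathbb{R},\mathbb{C},\mathbb{H}$. Identify $\mathbb{K}^m\cong\mathbb{R}^{\delta m}$ with standard inner product $(x,y)=\sum_i\bar x_iy_i$; $S=S^{\delta m-1}$ is its unit sphere and $\sigma$ the normalized rotation-invariant surface measure on $S$. $\Phi_{\mathbb{K}}(m,p)$ is the space of complex-valued functions on $S$ which are restrictions of homogeneous polynomials $\psi$ of degree $p$ on $\mathbb{R}^{\delta m}$ (complex coefficients) satisfying $\psi(w\lambda)=\psi(w)$ for all $w\in\mathbb{K}^m$ and $\lambda\in\mathbb{K}$ with $|\lambda|=1$. A projective cubature formula of index $p$ on $S$ with $n$ nodes consists of points $x_1,\dots,x_n\in S$ that are projectively distinct ($x_i\neq x_j\lambda$ for $i\ne j$, $|\lambda|=1$) and weights $\rho_1,\dots,\rho_n>0$ such that $\int_S\phi\,d\sigma=\sum_{i=1}^n\rho_i\phi(x_i)$ for all $\phi\in\Phi_{\mathbb{K}}(m,p)$. Jacobi polynomials $P_k^{(a,b)}$ are orthogonal on $(-1,1)$ with weight $(1-t)^a(1+t)^b$. *)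

theory Defs
  imports "HOL-Analysis.Analysis"
begin

text \<open>Points of K^m = R^(delta m): real functions on the index set
  {0..<m} x {0..<delta}; coordinate (i,j) is the j-th real component of the
  i-th K-coordinate w_i = sum_j w(i,j) e_j with e_0 = 1, e_1 = i, e_2 = j, e_3 = k.\<close>

definition idx :: "nat \<Rightarrow> nat \<Rightarrow> (nat \<times> nat) set" where
  "idx \<delta> m = {0..<m} \<times> {0..<\<delta>}"

definition eucl :: "nat \<Rightarrow> nat \<Rightarrow> (nat \<times> nat \<Rightarrow> real) measure" where
  "eucl \<delta> m = PiM (idx \<delta> m) (\<lambda>_. lborel)"

definition sqnorm :: "nat \<Rightarrow> nat \<Rightarrow> (nat \<times> nat \<Rightarrow> real) \<Rightarrow> real" where
  "sqnorm \<delta> m x = (\<Sum>k\<in>idx \<delta> m. (x k)\<^sup>2)"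

definition sphere_K :: "nat \<Rightarrow> nat \<Rightarrow> (nat \<times> nat \<Rightarrow> real) set" where
  "sphere_K \<delta> m = {x \<in> space (eucl \<delta> m). sqnorm \<delta> m x = 1}"

text \<open>Normalized rotation-invariant surface measure on the unit sphere, realised as the
  cone measure: push-forward of the uniform probability measure on the punctured unit
  ball under radial projection x \<mapsto> x/|x|.\<close>

definition punct_ball :: "nat \<Rightarrow> nat \<Rightarrow> (nat \<times> nat \<Rightarrow> real) set" where
  "punct_ball \<delta> m = {x \<in> space (eucl \<delta> m). 0 < sqnorm \<delta> m x \<and> sqnorm \<delta> m x \<le> 1}"

definition sigma_K :: "nat \<Rightarrow> nat \<Rightarrow> (nat \<times> nat \<Rightarrow> real) measure" where
  "sigma_K \<delta> m =
     distr (uniform_measure (restrict_space (eucl \<delta> m) (punct_ball \<delta> m)) (punct_ball \<delta> m))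
           (restrict_space (eucl \<delta> m) (sphere_K \<delta> m))
           (\<lambda>x. restrict (\<lambda>k. x k / sqrt (sqnorm \<delta> m x)) (idx \<delta> m))"

definition qmul :: "(nat \<Rightarrow> real) \<Rightarrow> (nat \<Rightarrow> real) \<Rightarrow> nat \<Rightarrow> real" where
  "qmul a b j =
     (if j = 0 then a 0 * b 0 - a 1 * b 1 - a 2 * b 2 - a 3 * b 3
      else if j = 1 then a 0 * b 1 + a 1 * b 0 + a 2 * b 3 - a 3 * b 2
      else if j = 2 then a 0 * b 2 - a 1 * b 3 + a 2 * b 0 + a 3 * b 1
      else if j = 3 then a 0 * b 3 + a 1 * b 2 - a 2 * b 1 + a 3 * b 0
      else 0)"

text \<open>Unit scalars of K (K = R, C, H for delta = 1, 2, 4), embedded in H.\<close>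

definition unit_K :: "nat \<Rightarrow> (nat \<Rightarrow> real) \<Rightarrow> bool" where
  "unit_K \<delta> l \<longleftrightarrow> (\<forall>k\<ge>\<delta>. l k = 0) \<and> (\<Sum>k<4. (l k)\<^sup>2) = 1"

definition rmult :: "nat \<Rightarrow> nat \<Rightarrow> (nat \<times> nat \<Rightarrow> real) \<Rightarrow> (nat \<Rightarrow> real) \<Rightarrow> (nat \<times> nat \<Rightarrow> real)" where
  "rmult \<delta> m w l = restrict (\<lambda>(i, j). qmul (\<lambda>k. if k < \<delta> then w (i, k) else 0) l j) (idx \<delta> m)"

definition exps :: "nat \<Rightarrow> nat \<Rightarrow> nat \<Rightarrow> (nat \<times> nat \<Rightarrow> nat) set" where
  "exps \<delta> m p = {a \<in> PiE (idx \<delta> m) (\<lambda>_. {..p}). sum a (idx \<delta> m) = p}"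

definition homog_poly :: "nat \<Rightarrow> nat \<Rightarrow> nat \<Rightarrow> ((nat \<times> nat \<Rightarrow> real) \<Rightarrow> complex) \<Rightarrow> bool" where
  "homog_poly \<delta> m p \<psi> \<longleftrightarrow>
     (\<exists>c :: (nat \<times> nat \<Rightarrow> nat) \<Rightarrow> complex. \<forall>x.
        \<psi> x = (\<Sum>a\<in>exps \<delta> m p. c a * (\<Prod>k\<in>idx \<delta> m. complex_of_real (x k) ^ a k)))"

text \<open>Phi_K(m,p): (polynomial representatives of) the invariant homogeneous polynomials.\<close>

definition Phi_K :: "nat \<Rightarrow> nat \<Rightarrow> nat \<Rightarrow> ((nat \<times> nat \<Rightarrow> real) \<Rightarrow> complex) set" where
  "Phi_K \<delta> m p = {\<psi>. homog_poly \<delta> m p \<psi> \<and>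
      (\<forall>w\<in>space (eucl \<delta> m). \<forall>l. unit_K \<delta> l \<longrightarrow> \<psi> (rmult \<delta> m w l) = \<psi> w)}"

definition proj_cubature ::
  "nat \<Rightarrow> nat \<Rightarrow> nat \<Rightarrow> nat \<Rightarrow> (nat \<Rightarrow> nat \<times> nat \<Rightarrow> real) \<Rightarrow> (nat \<Rightarrow> real) \<Rightarrow> bool" where
  "proj_cubature \<delta> m p n x \<rho> \<longleftrightarrow>
     (\<forall>i<n. x i \<in> sphere_K \<delta> m) \<and>
     (\<forall>i<n. \<forall>j<n. i \<noteq> j \<longrightarrow> (\<forall>l. unit_K \<delta> l \<longrightarrow> x i \<noteq> rmult \<delta> m (x j) l)) \<and>
     (\<forall>i<n. \<rho> i > 0) \<and>
     (\<forall>\<psi>\<in>Phi_K \<delta> m p.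
        (\<integral>y. \<psi> y \<partial>sigma_K \<delta> m) = (\<Sum>i<n. complex_of_real (\<rho> i) * \<psi> (x i)))"

definition jacobiP :: "nat \<Rightarrow> real \<Rightarrow> real \<Rightarrow> real \<Rightarrow> real" where
  "jacobiP k a b t =
     (\<Sum>s=0..k. ((real k + a) gchoose (k - s)) * ((real k + b) gchoose s)
                 * ((t - 1) / 2) ^ s * ((t + 1) / 2) ^ (k - s))"

text \<open>Gauss hypergeometric function 2F1 (power series, for |z| < 1).\<close>

definition hyp2F1 :: "real \<Rightarrow> real \<Rightarrow> real \<Rightarrow> real \<Rightarrow> real" where
  "hyp2F1 a b c z =
     (\<Sum>k. pochhammer a k * pochhammer b k / (pochhammer c k * fact k) * z ^ k)"

end

theory Submission
  imports Defs "HOL-Computational_Algebra.Polynomial" "HOL-Probability.Probability"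
begin

text \<open>
  Put \<open>t(x, z) = |(x, z)|\<^sup>2\<close>, let \<open>L\<close> be the Jacobi operator in the variable \<open>u = t\<close>, symmetric
  for the Beta weight \<open>u\<^sup>\<beta> (1 - u)\<^sup>\<alpha>\<close>, and let \<open>\<lambda>\<close> be its eigenvalue of degree \<open>p/2 + 1\<close>, with
  eigenfunction \<open>Y\<close>. The point \<open>\<tau> = (1 + \<xi>)/2\<close> is the largest critical point of \<open>Y\<close>, so the function
  \<open>g\<close> that equals \<open>Y - Y(\<tau>)\<close> on the cap \<open>u \<ge> \<tau>\<close> and 0 elsewhere is \<open>C\<^sup>1\<close>, nonnegative, and
  satisfies \<open>(L + \<lambda>) g = C \<chi>\<close>, where \<open>\<chi>\<close> is the indicator of the cap and \<open>C = - \<lambda> Y(\<tau>) > 0\<close>.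

  Consider the quadratic form \<open>q(P) = \<Sum>\<^sub>i\<^sub>j \<rho>\<^sub>i \<rho>\<^sub>j \<integral> P(t(x\<^sub>i, z)) ((L + \<lambda>) P)(t(x\<^sub>j, z)) d\<sigma>(z)\<close> on
  polynomials. Eigenpolynomials of different degrees are orthogonal for it; the cubature formula
  annihilates the degrees from 1 to \<open>p/2\<close>, and \<open>L + \<lambda>\<close> is nonpositive on the higher ones. Hence
  \<open>q(P) \<le> \<lambda> A\<^sup>2\<close>, where \<open>A\<close> is the mean of \<open>P\<close>. For polynomials \<open>P\<close> approximating \<open>g\<close> the terms with
  \<open>i \<noteq> j\<close> are nonnegative up to a small error and the diagonal gives about \<open>C A \<Sum> \<rho>\<^sub>i\<^sup>2\<close>, while
  \<open>\<lambda> A\<close> is about \<open>C\<close> times the normalised Beta measure of the cap. So that measure is at least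
  \<open>\<Sum> \<rho>\<^sub>i\<^sup>2 \<ge> 1/n\<close>.

  All integrals over the sphere that occur are integrals of homogeneous polynomials. They are computed
  from Gaussian expectations, where integration by parts gives the symmetry of \<open>L\<close> and the moments of
  \<open>t\<close> without any use of rotations.
\<close>

section \<open>The Jacobi operator\<close>

text \<open>Why the parameters in the theorem are raised: the derivative of an eigenfunction of
  \<open>Lop \<alpha> \<beta>\<close> of degree p/2 + 1 is an eigenfunction of
  \<open>Lop (\<alpha> + 1) (\<beta> + 1)\<close> of degree p/2, so the critical points of Y are the
  roots of the given Jacobi polynomial, and u = (1 + t)/2 sends \<xi> to \<tau>. The eigenvalue of
  degree p/2 + 1 is the largest \<lambda> for which L + \<lambda> is nonpositive on all degrees
  above p/2. As L P has mean zero, (L + \<lambda>) P has mean \<lambda> A; this is how the measure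
  of the cap enters. The obstacle is the jump of g'' at \<tau>: the form is controlled through a
  finite Jacobi expansion, so P must be a polynomial, yet no polynomial brings (L + \<lambda>) P
  uniformly close to the discontinuous C \<chi>. What survives is that P ((L + \<lambda>) P - C) is
  uniformly small, because g is small where the second factor is not. All errors are linear in the
  width \<eta> of a transition zone, and the final division by A needs a positive lower bound on A
  that does not depend on \<eta>.\<close>

definition Lop :: "real \<Rightarrow> real \<Rightarrow> real poly \<Rightarrow> real poly" where
  "Lop a b P = [:0, 1, -1:] * pderiv (pderiv P) + [:b + 1, - (a + b + 2):] * pderiv P"

lemma poly_Lop:
  "poly (Lop a b P) u = u * (1 - u) * poly (pderiv (pderiv P)) u
     + (b + 1 - (a + b + 2) * u) * poly (pderiv P) u"
  by (simp add: Lop_def algebra_simps)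

lemma Lop_add: "Lop a b (P + Q) = Lop a b P + Lop a b Q"
  by (simp only: Lop_def pderiv_add distrib_left add_ac)

lemma Lop_smult: "Lop a b (smult c P) = smult c (Lop a b P)"
  by (simp add: Lop_def pderiv_smult smult_add_right)

lemma Lop_0 [simp]: "Lop a b 0 = 0"
  by (simp add: Lop_def)

lemma Lop_sum: "Lop a b (\<Sum>i\<in>A. f i) = (\<Sum>i\<in>A. Lop a b (f i))"
  by (induction A rule: infinite_finite_induct) (simp_all add: Lop_add)

lemma pderiv_monic_linear_power: "pderiv ([:c, 1::real:] ^ i) = smult (real i) ([:c, 1:] ^ (i - 1))"
  by (cases i) (simp_all add: pderiv_power_Suc pderiv_pCons del: power_Suc)

lemma pderiv_linear_powers:
  "pderiv ([:-1, 1::real:] ^ i * [:0, 1:] ^ j)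
    = smult (real i) ([:-1, 1:] ^ (i - 1) * [:0, 1:] ^ j)
      + smult (real j) ([:-1, 1:] ^ i * [:0, 1:] ^ (j - 1))"
  by (simp add: pderiv_mult pderiv_monic_linear_power mult.commute)

text \<open>For fixed i + j, adding the eigenvalue of degree i + j cancels everything except
  differences between neighbouring products. This shape makes the Jacobi sum telescope.\<close>

lemma poly_Lop_linear_powers:
  fixes i j :: nat and a b u :: real
  shows "poly (Lop a b ([:-1, 1:] ^ i * [:0, 1:] ^ j)) u
         + real (i + j) * (real (i + j) + a + b + 1) * ((u - 1) ^ i * u ^ j)
       = real i * (real i + a) * ((u - 1) ^ i * u ^ j - (u - 1) ^ (i - 1) * u ^ (j + 1))
       + real j * (real j + b) * ((u - 1) ^ i * u ^ j - (u - 1) ^ (i + 1) * u ^ (j - 1))"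
proof -
  define x where "x = u - 1"
  \<comment> \<open>The factors \<open>real i\<close> and \<open>real j\<close> make the truncated
    exponents harmless; multiplying by x or u restores the powers without a case split in the main
    computation.\<close>
  define p1 where "p1 = real i * x ^ (i - 1)"
  define p2 where "p2 = real i * real (i - 1) * x ^ (i - 1 - 1)"
  define q1 where "q1 = real j * u ^ (j - 1)"
  define q2 where "q2 = real j * real (j - 1) * u ^ (j - 1 - 1)"
  have px: "p1 * x = real i * x ^ i" "p2 * x = (real i - 1) * p1"
    unfolding p1_def p2_def by (cases i; cases "i - 1"; simp add: algebra_simps)+
  have qx: "q1 * u = real j * u ^ j" "q2 * u = (real j - 1) * q1"
    unfolding q1_def q2_def by (cases j; cases "j - 1"; simp add: algebra_simps)+
  have d1: "poly (pderiv ([:-1, 1:] ^ i * [:0, 1:] ^ j)) u = p1 * u ^ j + x ^ i * q1"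
    by (simp add: pderiv_linear_powers p1_def q1_def x_def)
  have d2: "poly (pderiv (pderiv ([:-1, 1:] ^ i * [:0, 1:] ^ j))) u
      = p2 * u ^ j + 2 * p1 * q1 + x ^ i * q2"
    by (simp only: pderiv_linear_powers pderiv_add pderiv_smult p1_def q1_def p2_def q2_def x_def
          poly_add poly_smult poly_mult poly_power) (simp add: algebra_simps)
  have co: "u * (1 - u) = - (x * u)" "b + 1 - (a + b + 2) * u = - ((a + 1) * u + (b + 1) * x)"
    by (simp_all add: x_def algebra_simps)
  have "poly (Lop a b ([:-1, 1:] ^ i * [:0, 1:] ^ j)) u
      = - (x * u) * (p2 * u ^ j + 2 * p1 * q1 + x ^ i * q2)
        - ((a + 1) * u + (b + 1) * x) * (p1 * u ^ j + x ^ i * q1)"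
    unfolding poly_Lop d1 d2 co by (simp only: mult_minus_left diff_conv_add_uminus)
  also have "\<dots> = - ((p2 * x) * u * u ^ j + 2 * (p1 * x) * (q1 * u) + x * x ^ i * (q2 * u))
      - ((a + 1) * (u * p1 * u ^ j + x ^ i * (q1 * u)) + (b + 1) * ((p1 * x) * u ^ j + x * x ^ i * q1))"
    by (simp add: algebra_simps)
  also have "\<dots> = - (real i * (real i + a)) * (x ^ (i - 1) * u ^ (j + 1))
      - real j * (real j + b) * (x ^ (i + 1) * u ^ (j - 1))
      - (2 * real i * real j + (a + 1) * real j + (b + 1) * real i) * (x ^ i * u ^ j)"
    unfolding px qx by (simp add: p1_def q1_def algebra_simps)
  finally show ?thesis
    unfolding x_def[symmetric] by (simp add: algebra_simps)
qed

definition jacobi_poly :: "nat \<Rightarrow> real \<Rightarrow> real \<Rightarrow> real poly" where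
  "jacobi_poly k a b = (\<Sum>s=0..k. smult (((real k + a) gchoose (k - s)) * ((real k + b) gchoose s))
      ([:-1, 1:] ^ s * [:0, 1:] ^ (k - s)))"

lemma poly_jacobi_poly: "poly (jacobi_poly k a b) u = jacobiP k a b (2 * u - 1)"
proof -
  have "(2 * u - 1 - 1) / 2 = u - 1" "(2 * u - 1 + 1) / 2 = u" by simp_all
  then show ?thesis
    by (simp only: jacobi_poly_def jacobiP_def poly_sum poly_smult poly_mult poly_power)
       (simp add: mult.assoc add.commute)
qed

lemma gbinomial_Suc_mult: "(x gchoose Suc r) * real (Suc r) = (x gchoose r) * (x - real r)" for x :: real
proof -
  have "(x gchoose Suc r) = (x gchoose r) * (x - real r) / real (Suc r)"
    by (simp add: gbinomial_prod_rev divide_simps)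
  then show ?thesis by simp
qed

text \<open>Jacobi's differential equation by telescoping: the recurrence
  \<open>A (Suc s) = B s\<close> between binomial coefficients says that what one summand passes on
  is what the next one receives.\<close>

lemma Lop_jacobi_poly:
  "Lop a b (jacobi_poly k a b) = smult (- (real k * (real k + a + b + 1))) (jacobi_poly k a b)"
proof (rule poly_eq_poly_eq_iff[THEN iffD1], rule ext)
  fix u :: real
  define c where "c s = ((real k + a) gchoose (k - s)) * ((real k + b) gchoose s)" for s
  define e where "e s = (u - 1) ^ s * u ^ (k - s)" for s
  define A where "A s = c s * (real s * (real s + a))" for s
  define B where "B s = c s * ((real k - real s) * (real k - real s + b))" for s
  \<comment> \<open>\<open>E s\<close> is the exchange between the products s - 1 and s. It vanishes
    at both ends: \<open>A 0 = 0\<close>, and the cutoff above k agrees with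
    \<open>B k = 0\<close>.\<close>
  define E where "E s = (if s \<le> k then A s * (e (s - 1) - e s) else 0)" for s
  have AB: "A (Suc s) = B s" if sk: "s < k" for s
  proof -
    obtain r where r: "k - s = Suc r" "k - Suc s = r" "real k - real s = real (Suc r)"
      using sk by (intro that[of "k - Suc s"]) (auto simp: of_nat_diff)
    have "A (Suc s) = ((real k + a) gchoose r) * (real (Suc s) + a)
        * (((real k + b) gchoose Suc s) * real (Suc s))"
      by (simp add: A_def c_def r algebra_simps)
    also have "\<dots> = (((real k + a) gchoose r) * (real k + a - real r))
        * (((real k + b) gchoose s) * (real k + b - real s))"
      unfolding gbinomial_Suc_mult using r by simp
    also have "\<dots> = B s"
      unfolding gbinomial_Suc_mult[symmetric, of "real k + a"] B_def c_def r(1)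
      using r(3) by (simp add: mult_ac add_ac diff_add_eq)
    finally show ?thesis .
  qed
  have step: "c s * (poly (Lop a b ([:-1, 1:] ^ s * [:0, 1:] ^ (k - s))) u
         + real k * (real k + a + b + 1) * e s) = - E s + E (Suc s)" if "s \<le> k" for s
  proof -
    have "poly (Lop a b ([:-1, 1:] ^ s * [:0, 1:] ^ (k - s))) u
         + real k * (real k + a + b + 1) * e s
       = real s * (real s + a) * (e s - (u - 1) ^ (s - 1) * u ^ (k - s + 1))
       + (real k - real s) * (real k - real s + b) * (e s - (u - 1) ^ (s + 1) * u ^ (k - s - 1))"
      using poly_Lop_linear_powers[of a b s "k - s" u] that
      by (simp only: e_def le_add_diff_inverse of_nat_diff)
    from arg_cong[OF this, of "(*) (c s)"]
    have "c s * (poly (Lop a b ([:-1, 1:] ^ s * [:0, 1:] ^ (k - s))) u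
         + real k * (real k + a + b + 1) * e s)
       = A s * (e s - (u - 1) ^ (s - 1) * u ^ (k - s + 1))
       + B s * (e s - (u - 1) ^ (s + 1) * u ^ (k - s - 1))"
      by (simp only: A_def B_def distrib_left[of "c s"] mult.assoc)
    moreover have "A s * (e s - (u - 1) ^ (s - 1) * u ^ (k - s + 1)) = - E s"
      using that by (cases s) (auto simp: E_def A_def e_def algebra_simps Suc_diff_le[symmetric])
    moreover have "B s * (e s - (u - 1) ^ (s + 1) * u ^ (k - s - 1)) = E (Suc s)"
    proof (cases "s = k")
      case True
      then show ?thesis by (simp add: E_def B_def)
    next
      case False
      then show ?thesis using that AB[of s] by (simp add: E_def e_def)
    qed
    ultimately show ?thesis by simp
  qed
  have "poly (Lop a b (jacobi_poly k a b)) u + real k * (real k + a + b + 1) * poly (jacobi_poly k a b) u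
      = (\<Sum>s=0..k. c s * (poly (Lop a b ([:-1, 1:] ^ s * [:0, 1:] ^ (k - s))) u
         + real k * (real k + a + b + 1) * e s))"
    by (simp add: jacobi_poly_def Lop_sum Lop_smult poly_sum c_def e_def sum_distrib_left sum.distrib
        distrib_left mult_ac)
  also have "\<dots> = (\<Sum>s=0..k. E (Suc s) - E s)"
    by (intro sum.cong refl) (simp add: step)
  also have "\<dots> = E (Suc k) - E 0"
    using sum_Suc_diff[of 0 k E] by simp
  also have "\<dots> = 0"
    by (simp add: E_def A_def)
  finally show "poly (Lop a b (jacobi_poly k a b)) u
    = poly (smult (- (real k * (real k + a + b + 1))) (jacobi_poly k a b)) u"
    by simp
qed

section \<open>Positivity and location of roots and critical points\<close>

lemma gbinomial_pos: "0 < (x gchoose r)" if "r = 0 \<or> real r < x + 1" for x :: real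
  using that by (auto simp: gbinomial_prod_rev intro!: divide_pos_pos prod_pos)

text \<open>To the right of 1 all summands are nonnegative and the one with s = 0 is positive. Hence
  every real root lies below u = 1.\<close>

lemma jacobi_poly_pos:
  assumes "a > 0" "b > 0" "u \<ge> 1"
  shows "0 < poly (jacobi_poly k a b) u"
proof -
  have pos: "0 < ((real k + a) gchoose (k - s)) * ((real k + b) gchoose s)" if "s \<le> k" for s
    using that assms by (intro mult_pos_pos gbinomial_pos) auto
  have "0 < (\<Sum>s=0..k. ((real k + a) gchoose (k - s)) * ((real k + b) gchoose s)
      * ((u - 1) ^ s * u ^ (k - s)))"
  proof (rule sum_pos2[of _ 0])
    show "0 < ((real k + a) gchoose (k - 0)) * ((real k + b) gchoose 0) * ((u - 1) ^ 0 * u ^ (k - 0))"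
      using pos[of 0] assms by simp
    show "0 \<le> ((real k + a) gchoose (k - s)) * ((real k + b) gchoose s) * ((u - 1) ^ s * u ^ (k - s))"
      if "s \<in> {0..k}" for s
      using that pos[of s] assms by (intro mult_nonneg_nonneg zero_le_power less_imp_le[OF pos]) auto
  qed auto
  then show ?thesis
    by (simp add: jacobi_poly_def poly_sum)
qed

text \<open>\<open>Lop a b\<close> is of Sturm--Liouville form with respect to the weight \<open>u\<^sup>b (1 - u)\<^sup>a\<close>.\<close>

lemma weighted_pderiv_has_derivative:
  assumes "0 < u" "u < 1"
  shows "((\<lambda>u. u powr (b + 1) * (1 - u) powr (a + 1) * poly (pderiv P) u)
     has_real_derivative u powr b * (1 - u) powr a * poly (Lop a b P) u) (at u)"
proof -
  have "u powr (b + 1) = u * u powr b" "(1 - u) powr (a + 1) = (1 - u) * (1 - u) powr a"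
    using assms by (simp_all add: powr_add)
  then have "((b + 1) * u powr b * ((1 - u) powr (a + 1)) - u powr (b + 1) * ((a + 1) * (1 - u) powr a))
       * poly (pderiv P) u + u powr (b + 1) * (1 - u) powr (a + 1) * poly (pderiv (pderiv P)) u
     = u powr b * (1 - u) powr a * poly (Lop a b P) u"
    by (simp only: poly_Lop) (simp add: ring_distribs mult_ac)
  then show ?thesis
    using assms
    by (auto intro!: derivative_eq_intros simp: algebra_simps)
qed

lemma continuous_on_weighted_poly:
  assumes "a > -1" "b > -1" "c \<ge> 0" "d \<le> 1"
  shows "continuous_on {c..d} (\<lambda>u. u powr (b + 1) * (1 - u) powr (a + 1) * poly P (u::real))"
  using assms by (intro continuous_intros continuous_on_powr') auto

text \<open>The weight u^(b+1) (1-u)^(a+1) vanishes at 0 and at 1, so the weighted derivative has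
  equal values at c and 1, and Rolle's theorem gives a zero of its derivative, which is a positive
  weight times \<open>Lop a b P\<close>. It is used twice: for a root of the Jacobi polynomial in
  (0, 1), and for a zero of Y beyond \<tau>.\<close>

lemma weighted_pderiv_Rolle:
  assumes "a > -1" "b > -1" "0 \<le> c" "c < 1" "c = 0 \<or> poly (pderiv P) c = 0"
  shows "\<exists>u>c. u < 1 \<and> poly (Lop a b P) u = 0"
proof -
  define H where "H u = u powr (b + 1) * (1 - u) powr (a + 1) * poly (pderiv P) u" for u
  have H: "(H has_real_derivative u powr b * (1 - u) powr a * poly (Lop a b P) u) (at u)"
    if "c < u" "u < 1" for u
    unfolding H_def using that assms by (intro weighted_pderiv_has_derivative) auto
  have "\<exists>u. c < u \<and> u < 1 \<and> (\<lambda>h. u powr b * (1 - u) powr a * poly (Lop a b P) u * h) = (\<lambda>h. 0)"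
  proof (rule Rolle_deriv[of c 1 H])
    show "H c = H 1" using assms by (auto simp: H_def)
    show "continuous_on {c..1} H"
      unfolding H_def using assms by (intro continuous_on_weighted_poly) auto
    show "(H has_derivative (\<lambda>h. u powr b * (1 - u) powr a * poly (Lop a b P) u * h)) (at u)"
      if "c < u" "u < 1" for u
      using H[OF that] by (simp add: has_field_derivative_def)
  qed (use assms in auto)
  then obtain u where u: "c < u" "u < 1" "u powr b * (1 - u) powr a * poly (Lop a b P) u = 0"
    by (metis mult.right_neutral)
  then show ?thesis using assms by auto
qed

text \<open>Y is built from its derivative y, the Jacobi polynomial with raised parameters, so that
  the roots of y are by construction the critical points of Y. The set under \<open>Max\<close> is
  shown to be finite and nonempty on the way.\<close>

lemma jacobi_largest_root:
  fixes a b :: real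
  assumes ab: "a > -1" "b > -1" and d: "d \<ge> 1"
    and \<xi>: "\<xi> = Max {t. jacobiP d (a + 1) (b + 1) t = 0}" and \<tau>: "\<tau> = (1 + \<xi>) / 2"
  obtains Y where "0 < \<tau>" "\<tau> < 1" "poly (pderiv Y) \<tau> = 0"
    "\<And>u. \<tau> < u \<Longrightarrow> poly (pderiv Y) u > 0"
    "Lop a b Y = smult (- (real (d + 1) * (real (d + 1) + a + b + 1))) Y" "poly Y \<tau> < 0"
proof -
  define y where "y = jacobi_poly d (a + 1) (b + 1)"
  define l where "l = real (d + 1) * (real (d + 1) + a + b + 1)"
  define k where "k = real d * (real d + (a + 1) + (b + 1) + 1)"
  have kl: "l = k + (a + b + 2)" by (simp add: l_def k_def algebra_simps)
  have lpos: "l > 0" unfolding l_def using ab d by (intro mult_pos_pos) auto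
  have kpos: "k > 0" unfolding k_def using ab d by (intro mult_pos_pos) auto
  have ode: "Lop (a + 1) (b + 1) y = smult (- k) y"
    unfolding y_def k_def by (rule Lop_jacobi_poly)
  have pos1: "0 < poly y u" if "u \<ge> 1" for u
    unfolding y_def using ab that by (intro jacobi_poly_pos) auto
  have y0: "y \<noteq> 0" using pos1[of 1] by auto
  define Z where "Z = {t. jacobiP d (a + 1) (b + 1) t = 0}"
  have Z: "t \<in> Z \<longleftrightarrow> poly y ((1 + t) / 2) = 0" for t
    using poly_jacobi_poly[of d "a + 1" "b + 1" "(1 + t) / 2"] by (simp add: Z_def y_def field_simps)
  have "Z \<subseteq> (\<lambda>u. 2 * u - 1) ` {u. poly y u = 0}"
  proof
    fix t assume "t \<in> Z"
    then show "t \<in> (\<lambda>u. 2 * u - 1) ` {u. poly y u = 0}"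
      by (intro image_eqI[of _ _ "(1 + t) / 2"]) (auto simp: Z field_simps)
  qed
  then have fin: "finite Z"
    using poly_roots_finite[OF y0] finite_surj by blast
  obtain Y where Y1: "pderiv Y = y" and Y2: "Lop a b Y = smult (- l) Y"
  proof
    \<comment> \<open>The choice is forced: if Y' = y, the bracket is \<open>Lop a b Y\<close>,
      which has to equal -l Y. That its derivative is -l y follows from (L Y)' = L' y - (a + b + 2)
      y, with L' the operator with raised parameters, and from l = k + (a + b + 2).\<close>
    define Y where "Y = smult (- (1 / l)) ([:0, 1, -1:] * pderiv y + [:b + 1, - (a + b + 2):] * y)"
    have "pderiv ([:0, 1, -1:] * pderiv y + [:b + 1, - (a + b + 2):] * y)
        = Lop (a + 1) (b + 1) y - smult (a + b + 2) y"
    proof (rule poly_eq_poly_eq_iff[THEN iffD1], rule ext)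
      fix u
      show "poly (pderiv ([:0, 1, -1:] * pderiv y + [:b + 1, - (a + b + 2):] * y)) u
        = poly (Lop (a + 1) (b + 1) y - smult (a + b + 2) y) u"
        unfolding pderiv_add pderiv_mult poly_add poly_diff poly_mult poly_Lop poly_smult
        by (simp add: pderiv_pCons algebra_simps)
    qed
    also have "\<dots> = smult (- l) y"
      unfolding ode kl by (simp add: smult_diff_left smult_add_left)
    finally show Y: "pderiv Y = y"
      using lpos by (simp only: Y_def pderiv_smult) simp
    show "Lop a b Y = smult (- l) Y"
      unfolding Lop_def Y using lpos by (simp add: Y_def)
  qed
  \<comment> \<open>As L' y = -k y with k > 0, Rolle on (0, 1) yields a root of y there. It makes
    the set of roots nonempty and forces \<tau> > 0.\<close>
  obtain u where u: "0 < u" "u < 1" "poly y u = 0"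
    using weighted_pderiv_Rolle[of "a + 1" "b + 1" 0 y] ab kpos by (auto simp: ode)
  have uZ: "2 * u - 1 \<in> Z" using u by (simp add: Z)
  have \<xi>Z: "\<xi> \<in> Z" using Max_in[OF fin] uZ by (auto simp: \<xi> Z_def)
  have \<xi>_ge: "t \<le> \<xi>" if "t \<in> Z" for t using Max_ge[OF fin that] by (simp add: \<xi> Z_def)
  have y\<tau>: "poly y \<tau> = 0" using \<xi>Z by (simp add: Z \<tau>)
  have "\<tau> > 0" using \<xi>_ge[OF uZ] u by (simp add: \<tau>)
  have "\<tau> < 1" using pos1[of \<tau>] y\<tau> by (cases "\<tau> < 1") auto
  have ypos: "poly y v > 0" if "\<tau> < v" for v
  proof (rule ccontr)
    assume "\<not> 0 < poly y v"
    then have "\<exists>w\<ge>v. w \<le> max v 1 \<and> poly y w = 0"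
      using pos1[of "max v 1"] by (intro IVT') (auto intro!: continuous_intros)
    then obtain w where "w \<ge> v" "poly y w = 0" by blast
    then have "2 * w - 1 \<in> Z" by (simp add: Z)
    from \<xi>_ge[OF this] \<open>w \<ge> v\<close> that show False by (simp add: \<tau>)
  qed
  \<comment> \<open>Y' vanishes at \<tau>, so Rolle on (\<tau>, 1) gives a zero of L Y = -l Y. As Y
    increases beyond \<tau>, its value at \<tau> is negative.\<close>
  obtain c where c: "\<tau> < c" "c < 1" "poly (Lop a b Y) c = 0"
    using weighted_pderiv_Rolle[of a b \<tau> Y] ab \<open>0 < \<tau>\<close> \<open>\<tau> < 1\<close> y\<tau> by (auto simp: Y1)
  then have "poly Y c = 0" using lpos by (simp add: Y2)
  moreover have "poly Y \<tau> < poly Y c"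
  proof (rule DERIV_pos_imp_increasing_open[OF c(1)])
    fix v assume "\<tau> < v"
    then show "\<exists>D. (poly Y has_real_derivative D) (at v) \<and> D > 0"
      using ypos[of v] poly_DERIV[of Y v] by (auto simp: Y1)
  qed (auto intro!: continuous_intros)
  ultimately show thesis
    using \<open>0 < \<tau>\<close> \<open>\<tau> < 1\<close> y\<tau> ypos Y2 by (intro that[of Y]) (auto simp: Y1 l_def)
qed

text \<open>Every product in the sum is monic of degree k, so the leading coefficient is a sum of
  positive numbers.\<close>

lemma degree_jacobi_poly:
  assumes "a > -1" "b > -1"
  shows "degree (jacobi_poly k a b) = k"
proof (rule antisym)
  have deg: "degree ([:-1, 1::real:] ^ s * [:0, 1:] ^ (k - s)) = k" if "s \<le> k" for s
    using that by (simp add: degree_mult_eq degree_power_eq)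
  then show "degree (jacobi_poly k a b) \<le> k"
    unfolding jacobi_poly_def by (intro degree_sum_le) (auto intro: order.trans[OF degree_smult_le])
  have "coeff ([:-1, 1::real:] ^ s * [:0, 1:] ^ (k - s)) k = 1" if "s \<le> k" for s
    using deg[OF that] lead_coeff_mult[of "[:-1, 1::real:] ^ s" "[:0, 1:] ^ (k - s)"]
    by (simp add: lead_coeff_power)
  then have "coeff (jacobi_poly k a b) k
      = (\<Sum>s=0..k. ((real k + a) gchoose (k - s)) * ((real k + b) gchoose s))"
    by (simp add: jacobi_poly_def coeff_sum)
  also have "\<dots> > 0"
    using assms by (intro sum_pos mult_pos_pos gbinomial_pos) auto
  finally show "k \<le> degree (jacobi_poly k a b)"
    by (intro le_degree) auto
qed

lemma jacobi_poly_0 [simp]: "jacobi_poly 0 a b = 1"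
  by (simp add: jacobi_poly_def)

lemma poly_span_of_degrees:
  fixes J :: "nat \<Rightarrow> real poly"
  assumes J: "\<And>k. degree (J k) = k" "J 0 \<noteq> 0" and P: "degree P \<le> N"
  shows "\<exists>c. P = (\<Sum>k\<le>N. smult (c k) (J k))"
  using P
proof (induction N arbitrary: P)
  case 0
  have "J 0 = [:coeff (J 0) 0:]" "P = [:coeff P 0:]"
    using J(1)[of 0] 0 by (auto dest!: degree_eq_zeroE[OF J(1)] elim!: degree_eq_zeroE)
  moreover have "coeff (J 0) 0 \<noteq> 0" using J(2) calculation(1) by auto
  ultimately have "P = smult (coeff P 0 / coeff (J 0) 0) (J 0)"
    by (metis mult_zero_right nonzero_eq_divide_eq smult_pCons smult_0_right)
  then show ?case by (intro exI[of _ "\<lambda>_. coeff P 0 / coeff (J 0) 0"]) simp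
next
  case (Suc N)
  define q where "q = coeff P (Suc N) / coeff (J (Suc N)) (Suc N)"
  have "coeff (J (Suc N)) (Suc N) \<noteq> 0"
    using J(1)[of "Suc N"] by (metis degree_0 leading_coeff_0_iff nat.distinct(1))
  then have "coeff (P - smult q (J (Suc N))) (Suc N) = 0"
    by (simp add: q_def)
  moreover have "degree (P - smult q (J (Suc N))) \<le> Suc N"
    using Suc.prems J(1)[of "Suc N"] by (intro degree_diff_le) (auto intro: order.trans[OF degree_smult_le])
  ultimately have "degree (P - smult q (J (Suc N))) \<le> N"
    by (metis degree_0 le_SucE le0 leading_coeff_0_iff)
  from Suc.IH[OF this] obtain c where c: "P - smult q (J (Suc N)) = (\<Sum>k\<le>N. smult (c k) (J k))" by blast
  have "P = (\<Sum>k\<le>Suc N. smult ((c(Suc N := q)) k) (J k))"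
    using c by (simp add: algebra_simps)
  then show ?case by blast
qed

section \<open>Polynomial approximation of the truncated eigenfunction\<close>

lemma poly_antiderivative:
  fixes R :: "real poly"
  obtains P where "pderiv P = R" "poly P 0 = 0"
proof
  define P where "P = (\<Sum>i\<le>degree R. monom (coeff R i / real (Suc i)) (Suc i))"
  have "pderiv (\<Sum>i\<in>A. f i) = (\<Sum>i\<in>A. pderiv (f i))" for f :: "nat \<Rightarrow> real poly" and A
    by (induction A rule: infinite_finite_induct) (simp_all add: pderiv_add)
  then have "pderiv P = (\<Sum>i\<le>degree R. monom (coeff R i) i)"
    by (simp add: P_def pderiv_monom del: of_nat_Suc)
  then show "pderiv P = R" by (simp add: poly_as_sum_of_monoms)
  show "poly P 0 = 0" by (simp add: P_def poly_sum poly_monom)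
qed

lemma Weierstrass_real_poly:
  fixes f :: "real \<Rightarrow> real"
  assumes "continuous_on {a..b} f" "e > 0"
  obtains R :: "real poly" where "\<And>u. u \<in> {a..b} \<Longrightarrow> \<bar>poly R u - f u\<bar> \<le> e"
proof -
  obtain g where g: "real_polynomial_function g" "\<And>u. u \<in> {a..b} \<Longrightarrow> \<bar>f u - g u\<bar> < e"
    using Stone_Weierstrass_real_polynomial_function[of "{a..b}" f e] assms by auto
  obtain c n where c: "g = (\<lambda>u. \<Sum>i\<le>n. c i * u ^ i)"
    using g(1) by (auto simp: real_polynomial_function_iff_sum)
  show thesis
  proof (rule that[of "\<Sum>i\<le>n. monom (c i) i"])
    fix u assume "u \<in> {a..b}"
    then show "\<bar>poly (\<Sum>i\<le>n. monom (c i) i) u - f u\<bar> \<le> e"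
      using g(2)[of u] by (simp add: poly_sum poly_monom c abs_minus_commute)
  qed
qed

lemma poly_increment_bound:
  fixes Q :: "real poly"
  assumes "\<And>u. p \<le> u \<Longrightarrow> u \<le> q \<Longrightarrow> \<bar>poly (pderiv Q) u\<bar> \<le> B" "p \<le> v" "v \<le> q"
  shows "\<bar>poly Q v - poly Q p\<bar> \<le> B * (v - p)"
proof (cases "p = v")
  case False
  then obtain w where "p < w" "w < v" "poly Q v - poly Q p = (v - p) * poly (pderiv Q) w"
    using poly_MVT[of p v Q] assms by auto
  moreover from this have "\<bar>poly (pderiv Q) w\<bar> \<le> B" using assms by auto
  ultimately show ?thesis using assms(2) by (simp add: abs_mult mult.commute mult_left_mono)
qed simp

lemma poly_bounded_unit_interval:
  fixes Q :: "real poly"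
  shows "\<exists>M. \<forall>u\<in>{0..1}. \<bar>poly Q u\<bar> \<le> M"
proof -
  have "compact (poly Q ` {0..1})"
    by (intro compact_continuous_image continuous_intros) auto
  then show ?thesis
    by (auto dest!: compact_imp_bounded simp: bounded_iff)
qed

text \<open>P is close to g in value and first derivative everywhere, but in second derivative only
  away from (\<tau>, \<tau> + \<eta>). The conclusions are what this weaker closeness gives:
  near-nonnegativity for the off-diagonal terms, the product bound for the diagonal ones, and the
  two comparisons with C on caps for the mean. K is fixed before \<eta>.\<close>

lemma smooth_cap_approximation:
  fixes a b \<tau> l C :: real and Y :: "real poly"
  assumes \<tau>: "0 < \<tau>" "\<tau> < 1" and y0: "poly (pderiv Y) \<tau> = 0"
    and ypos: "\<And>u. \<tau> < u \<Longrightarrow> poly (pderiv Y) u > 0"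
    and eig: "Lop a b Y = smult (- l) Y" and C: "C = - l * poly Y \<tau>" "C > 0" and l: "l > 0"
  obtains K where "K > 0" "\<And>\<eta>. 0 < \<eta> \<Longrightarrow> \<eta> < 1 - \<tau> \<Longrightarrow>
    \<exists>P. \<forall>u\<in>{0..1}. - K * \<eta> \<le> poly P u \<and> \<bar>poly P u\<bar> \<le> K
       \<and> - K * \<eta> \<le> poly (Lop a b P + smult l P) u
       \<and> poly (Lop a b P + smult l P) u \<le> (if \<tau> \<le> u then C else 0) + K * \<eta>
       \<and> \<bar>poly P u * (poly (Lop a b P + smult l P) u - C)\<bar> \<le> K * \<eta>
       \<and> (\<tau> + \<eta> \<le> u \<longrightarrow> C - K * \<eta> \<le> poly (Lop a b P + smult l P) u)"
proof -
  define y where "y = pderiv Y"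
  define y2 where "y2 = pderiv y"
  obtain M where M: "M \<ge> 1" "\<And>u. 0 \<le> u \<Longrightarrow> u \<le> 1 \<Longrightarrow> \<bar>poly Y u\<bar> \<le> M"
    "\<And>u. 0 \<le> u \<Longrightarrow> u \<le> 1 \<Longrightarrow> \<bar>poly y u\<bar> \<le> M" "\<And>u. 0 \<le> u \<Longrightarrow> u \<le> 1 \<Longrightarrow> \<bar>poly y2 u\<bar> \<le> M"
  proof -
    obtain M1 M2 M3 where "\<forall>u\<in>{0..1}. \<bar>poly Y u\<bar> \<le> M1" "\<forall>u\<in>{0..1}. \<bar>poly y u\<bar> \<le> M2"
      "\<forall>u\<in>{0..1}. \<bar>poly y2 u\<bar> \<le> M3"
      using poly_bounded_unit_interval by meson
    then show thesis
      by (intro that[of "max 1 (max M1 (max M2 M3))"]) (auto simp: le_max_iff_disj)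
  qed
  define m0 where "m0 = \<bar>b + 1\<bar> + \<bar>a + b + 2\<bar>"
  \<comment> \<open>Error budgets in units of \<eta>. K1, for P': 1 up to \<tau>, 1 + M across the
    ramp, where the error of the second derivative is merely bounded, and 1 beyond it. K4, for (L +
    l) P: the first group comes from the errors of P'', P' and P, the second from the lower-order
    terms inside the ramp. K dominates every bound needed below.\<close>
  define K1 where "K1 = 3 + M"
  define K4 where "K4 = (1 + (m0 * K1 + l * (2 * K1))) + (m0 * M + l * M)"
  have pos: "m0 \<ge> 0" "K1 > 0" "K4 > 0"
    unfolding K4_def using M l by (auto simp: m0_def K1_def intro!: add_pos_nonneg mult_nonneg_nonneg)
  define K where "K = 2 * K1 + (2 * M + 2 * K1) + K4 + (2 * M + 2 * K1) * K4 + (M + 2 * K1) * (K4 + C)"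
  have Kge: "2 * K1 \<le> K" "2 * M + 2 * K1 \<le> K" "K4 \<le> K" "(2 * M + 2 * K1) * K4 \<le> K"
    "(M + 2 * K1) * (K4 + C) \<le> K"
    using pos M(1) C(2) by (auto simp: K_def intro!: add_nonneg_nonneg mult_nonneg_nonneg)
  have "K > 0" using Kge pos by linarith
  have approx: "\<exists>P. \<forall>u\<in>{0..1}. - K * \<eta> \<le> poly P u \<and> \<bar>poly P u\<bar> \<le> K
       \<and> - K * \<eta> \<le> poly (Lop a b P + smult l P) u
       \<and> poly (Lop a b P + smult l P) u \<le> (if \<tau> \<le> u then C else 0) + K * \<eta>
       \<and> \<bar>poly P u * (poly (Lop a b P + smult l P) u - C)\<bar> \<le> K * \<eta>
       \<and> (\<tau> + \<eta> \<le> u \<longrightarrow> C - K * \<eta> \<le> poly (Lop a b P + smult l P) u)"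
    if \<eta>: "0 < \<eta>" "\<eta> < 1 - \<tau>" for \<eta>
  proof -
    \<comment> \<open>A ramp from 0 at \<tau> to 1 at \<tau> + \<eta> replaces the jump of g'', so
      that Weierstrass applies. Integrating R twice from 0 controls P, P' and P'' together.\<close>
    define \<kappa> where "\<kappa> u = max 0 (min 1 ((u - \<tau>) / \<eta>))" for u
    have \<kappa>: "0 \<le> \<kappa> u" "\<kappa> u \<le> 1" "u \<le> \<tau> \<Longrightarrow> \<kappa> u = 0" "\<tau> + \<eta> \<le> u \<Longrightarrow> \<kappa> u = 1" for u
      using \<eta> by (auto simp: \<kappa>_def field_simps max_def min_def)
    have "continuous_on {0..1} (\<lambda>u. \<kappa> u * poly y2 u)"
      unfolding \<kappa>_def using \<eta> by (intro continuous_intros) auto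
    from Weierstrass_real_poly[OF this \<eta>(1)]
    obtain R where R: "\<And>u. u \<in> {0..1} \<Longrightarrow> \<bar>poly R u - \<kappa> u * poly y2 u\<bar> \<le> \<eta>"
      by blast
    obtain P1 where P1: "pderiv P1 = R" "poly P1 0 = 0" by (rule poly_antiderivative)
    obtain P where P: "pderiv P = P1" "poly P 0 = 0" by (rule poly_antiderivative)
    have R0: "\<bar>poly R u\<bar> \<le> \<eta>" if "0 \<le> u" "u \<le> \<tau>" for u
      using R[of u] \<kappa>(3)[of u] that \<tau> by auto
    have R1: "\<bar>poly (R - y2) u\<bar> \<le> 1 + M" if "\<tau> \<le> u" "u \<le> 1" for u
    proof -
      have "\<bar>\<kappa> u * poly y2 u - poly y2 u\<bar> = \<bar>1 - \<kappa> u\<bar> * \<bar>poly y2 u\<bar>"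
        by (simp add: abs_mult[symmetric] left_diff_distrib abs_minus_commute)
      also have "\<dots> \<le> 1 * M"
        using \<kappa>[of u] M(4)[of u] that \<tau> by (intro mult_mono) auto
      finally show ?thesis using R[of u] that \<tau> \<eta> by auto
    qed
    have R2: "\<bar>poly (R - y2) u\<bar> \<le> \<eta>" if "\<tau> + \<eta> \<le> u" "u \<le> 1" for u
      using R[of u] \<kappa>(4)[of u] that \<tau> \<eta> by auto
    \<comment> \<open>g' and g; g' is continuous at \<tau> because y vanishes there.\<close>
    define g1 where "g1 u = (if u \<le> \<tau> then 0 else poly y u)" for u
    define g0 where "g0 u = (if u \<le> \<tau> then 0 else poly Y u - poly Y \<tau>)" for u
    have e1: "\<bar>poly P1 u - g1 u\<bar> \<le> K1 * \<eta>" if u: "0 \<le> u" "u \<le> 1" for u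
    proof -
      have A: "\<bar>poly P1 v\<bar> \<le> \<eta>" if "0 \<le> v" "v \<le> \<tau>" for v
      proof -
        have "\<bar>poly P1 v\<bar> \<le> \<eta> * v"
          using poly_increment_bound[of 0 \<tau> P1 \<eta> v] R0 that P1 by simp
        also have "\<dots> \<le> \<eta> * 1" using that \<tau> \<eta> by (intro mult_left_mono) auto
        finally show ?thesis by simp
      qed
      have pd: "pderiv (P1 - y) = R - y2" by (simp add: pderiv_diff P1 y2_def)
      \<comment> \<open>The integrand is only bounded here, but the interval has length
        \<eta>.\<close>
      have B: "\<bar>poly (P1 - y) v\<bar> \<le> (2 + M) * \<eta>" if "\<tau> \<le> v" "v \<le> \<tau> + \<eta>" for v
      proof -
        have "\<bar>poly (P1 - y) v - poly (P1 - y) \<tau>\<bar> \<le> (1 + M) * (v - \<tau>)"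
          using \<eta> that by (intro poly_increment_bound[of _ "\<tau> + \<eta>"]) (auto simp only: pd intro!: R1)
        also have "\<dots> \<le> (1 + M) * \<eta>" using M that by (intro mult_left_mono) auto
        finally show ?thesis using A[of \<tau>] \<tau> y0 by (simp add: y_def algebra_simps)
      qed
      have D: "\<bar>poly (P1 - y) v\<bar> \<le> K1 * \<eta>" if "\<tau> + \<eta> \<le> v" "v \<le> 1" for v
      proof -
        have "\<bar>poly (P1 - y) v - poly (P1 - y) (\<tau> + \<eta>)\<bar> \<le> \<eta> * (v - (\<tau> + \<eta>))"
          using \<eta> that by (intro poly_increment_bound[of _ 1]) (auto simp only: pd intro!: R2)
        also have "\<dots> \<le> \<eta> * 1" using \<eta> \<tau> that by (intro mult_left_mono) auto
        finally show ?thesis using B[of "\<tau> + \<eta>"] \<eta> by (simp add: K1_def algebra_simps)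
      qed
      have "\<eta> \<le> K1 * \<eta>" "(2 + M) * \<eta> \<le> K1 * \<eta>"
        using \<eta> M(1) by (simp_all add: K1_def)
      note le = this
      show ?thesis
      proof (cases "u \<le> \<tau>")
        case True
        then show ?thesis using A[OF u(1) True] le by (simp add: g1_def)
      next
        case False
        then show ?thesis
          using B[of u] D[of u] le(2) u unfolding g1_def poly_diff if_not_P[OF False]
          by (cases "u \<le> \<tau> + \<eta>") linarith+
      qed
    qed
    have e0: "\<bar>poly P u - g0 u\<bar> \<le> 2 * K1 * \<eta>" if u: "0 \<le> u" "u \<le> 1" for u
    proof -
      have A: "\<bar>poly P v\<bar> \<le> K1 * \<eta>" if "0 \<le> v" "v \<le> \<tau>" for v
      proof -
        have "\<bar>poly P v\<bar> \<le> (K1 * \<eta>) * v"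
          using poly_increment_bound[of 0 \<tau> P "K1 * \<eta>" v] e1 that P \<tau> by (force simp: g1_def)
        also have "\<dots> \<le> (K1 * \<eta>) * 1" using that \<tau> \<eta> pos by (intro mult_left_mono) auto
        finally show ?thesis by simp
      qed
      have B: "\<bar>poly (P - Y) v - poly (P - Y) \<tau>\<bar> \<le> K1 * \<eta>" if "\<tau> \<le> v" "v \<le> 1" for v
      proof -
        have pd: "pderiv (P - Y) = P1 - y" by (simp add: pderiv_diff P y_def)
        have "\<bar>poly (P - Y) v - poly (P - Y) \<tau>\<bar> \<le> K1 * \<eta> * (v - \<tau>)"
        proof (rule poly_increment_bound[of _ 1])
          show "\<bar>poly (pderiv (P - Y)) w\<bar> \<le> K1 * \<eta>" if "\<tau> \<le> w" "w \<le> 1" for w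
            using e1[of w] that \<tau> y0 by (cases "w = \<tau>") (auto simp: pd g1_def y_def)
        qed (use that in auto)
        also have "\<dots> \<le> (K1 * \<eta>) * 1" using that \<tau> \<eta> pos by (intro mult_left_mono) auto
        finally show ?thesis by simp
      qed
      have "K1 * \<eta> \<ge> 0" using pos \<eta> by simp
      then show ?thesis
        using A[of u] A[of \<tau>] B[of u] u \<tau> by (auto simp: g0_def)
    qed
    have g0_nonneg: "0 \<le> g0 u" if "u \<le> 1" for u
    proof (cases "u \<le> \<tau>")
      case False
      have "poly Y \<tau> \<le> poly Y u"
      proof (rule DERIV_nonneg_imp_nondecreasing[of \<tau> u "poly Y"])
        fix v assume "\<tau> \<le> v"
        then have "0 \<le> poly (pderiv Y) v" using ypos[of v] y0 by (cases "v = \<tau>") auto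
        then show "\<exists>D. (poly Y has_real_derivative D) (at v) \<and> 0 \<le> D"
          using poly_DERIV[of Y v] by blast
      qed (use False in simp)
      then show ?thesis by (simp add: g0_def)
    qed (simp add: g0_def)
    have g0_le: "\<bar>g0 u\<bar> \<le> 2 * M" if "0 \<le> u" "u \<le> 1" for u
      using M(2)[of u] M(2)[of \<tau>] M(1) that \<tau> by (auto simp: g0_def)
    have g_near: "\<bar>g0 u\<bar> \<le> M * \<eta>" "\<bar>g1 u\<bar> \<le> M * \<eta>" if "u \<le> \<tau> + \<eta>" for u
    proof -
      have M\<eta>: "0 \<le> M * \<eta>" using M \<eta> by simp
      have "\<bar>poly Y u - poly Y \<tau>\<bar> \<le> M * \<eta>" "\<bar>poly y u\<bar> \<le> M * \<eta>" if "\<tau> < u"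
      proof -
        have "\<bar>poly Y u - poly Y \<tau>\<bar> \<le> M * (u - \<tau>)" "\<bar>poly y u - poly y \<tau>\<bar> \<le> M * (u - \<tau>)"
          using \<open>u \<le> \<tau> + \<eta>\<close> that \<eta> \<tau> M(3,4)
          by (auto intro!: poly_increment_bound[of _ "\<tau> + \<eta>"] simp: y_def y2_def)
        moreover have "M * (u - \<tau>) \<le> M * \<eta>" using M(1) \<open>u \<le> \<tau> + \<eta>\<close> by (intro mult_left_mono) auto
        ultimately show "\<bar>poly Y u - poly Y \<tau>\<bar> \<le> M * \<eta>" "\<bar>poly y u\<bar> \<le> M * \<eta>"
          using y0 by (auto simp: y_def)
      qed
      then show "\<bar>g0 u\<bar> \<le> M * \<eta>" "\<bar>g1 u\<bar> \<le> M * \<eta>" using M\<eta> by (auto simp: g0_def g1_def)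
    qed
    define DP where "DP u = poly (Lop a b P + smult l P) u" for u
    define m where "m u = b + 1 - (a + b + 2) * u" for u
    have m: "\<bar>m u\<bar> \<le> m0" if "0 \<le> u" "u \<le> 1" for u
    proof -
      have "\<bar>(a + b + 2) * u\<bar> \<le> \<bar>a + b + 2\<bar> * 1"
        unfolding abs_mult using that by (intro mult_left_mono) auto
      then show ?thesis by (simp add: m_def m0_def)
    qed
    have DP_eq: "DP u = u * (1 - u) * poly R u + m u * poly P1 u + l * poly P u" for u
      by (simp add: DP_def poly_Lop P P1 m_def)
    have C_eq: "u * (1 - u) * poly y2 u + (m u * g1 u + l * g0 u) = C" if "u > \<tau>" for u
      using arg_cong[OF eig, of "\<lambda>p. poly p u"] that C
      by (simp add: poly_Lop y2_def y_def g1_def g0_def m_def algebra_simps)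
    \<comment> \<open>With \<kappa> Y'' in place of g'', (L + l) g becomes \<kappa> C plus (1 -
      \<kappa>) times its part of order at most one. That part is O(\<eta>) wherever \<kappa> < 1,
      since both g and g' vanish at \<tau>.\<close>
    have DP: "\<bar>DP u - \<kappa> u * C\<bar> \<le> K4 * \<eta>" if u: "0 \<le> u" "u \<le> 1" for u
    proof -
      define low where "low = m u * g1 u + l * g0 u"
      have uu: "\<bar>u * (1 - u)\<bar> \<le> 1" using u mult_le_one[of u "1 - u"] by (simp add: abs_mult)
      have "\<bar>u * (1 - u) * (poly R u - \<kappa> u * poly y2 u)\<bar> \<le> 1 * \<eta>"
        unfolding abs_mult[of "u * (1 - u)"] using uu R[of u] u by (intro mult_mono) auto
      moreover have "\<bar>m u * (poly P1 u - g1 u)\<bar> \<le> m0 * (K1 * \<eta>)"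
        unfolding abs_mult using m e1 u pos by (intro mult_mono) auto
      moreover have "\<bar>l * (poly P u - g0 u)\<bar> \<le> l * (2 * K1 * \<eta>)"
        unfolding abs_mult using e0 u l by (intro mult_mono) auto
      moreover have "DP u - (u * (1 - u) * (\<kappa> u * poly y2 u) + low)
          = u * (1 - u) * (poly R u - \<kappa> u * poly y2 u) + m u * (poly P1 u - g1 u)
            + l * (poly P u - g0 u)"
        by (simp add: DP_eq low_def algebra_simps)
      ultimately have 1: "\<bar>DP u - (u * (1 - u) * (\<kappa> u * poly y2 u) + low)\<bar>
          \<le> (1 + (m0 * K1 + l * (2 * K1))) * \<eta>"
        by (simp add: algebra_simps)
      have 2: "\<bar>(u * (1 - u) * (\<kappa> u * poly y2 u) + low) - \<kappa> u * C\<bar> \<le> (m0 * M + l * M) * \<eta>"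
      proof (cases "u \<le> \<tau>")
        case True
        then show ?thesis using \<kappa>(3)[of u] pos l M(1) \<eta> by (simp add: low_def g1_def g0_def)
      next
        case False
        have "(u * (1 - u) * (\<kappa> u * poly y2 u) + low) - \<kappa> u * C = (1 - \<kappa> u) * low"
          using C_eq[of u] False unfolding low_def by (auto simp: algebra_simps simp flip: C_eq[of u])
        moreover have "\<bar>(1 - \<kappa> u) * low\<bar> \<le> (m0 * M + l * M) * \<eta>"
        proof (cases "u \<le> \<tau> + \<eta>")
          case True
          have "\<bar>m u * g1 u\<bar> \<le> m0 * (M * \<eta>)" "\<bar>l * g0 u\<bar> \<le> l * (M * \<eta>)"
            unfolding abs_mult using m u g_near[OF True] l pos by (auto intro!: mult_mono)
          then have "\<bar>low\<bar> \<le> (m0 * M + l * M) * \<eta>" by (simp add: low_def algebra_simps)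
          moreover have "\<bar>(1 - \<kappa> u) * low\<bar> \<le> 1 * \<bar>low\<bar>"
            unfolding abs_mult using \<kappa>(1,2)[of u] by (intro mult_right_mono) auto
          ultimately show ?thesis by simp
        next
          case False
          then show ?thesis using \<kappa>(4)[of u] pos l M(1) \<eta> by simp
        qed
        ultimately show ?thesis by simp
      qed
      show ?thesis using 1 2 by (simp add: K4_def algebra_simps)
    qed
    show ?thesis
    proof (intro exI[of _ P] ballI)
      fix u :: real assume "u \<in> {0..1}"
      then have u: "0 \<le> u" "u \<le> 1" by auto
      have K\<eta>: "c * \<eta> \<le> K * \<eta>" if "c \<le> K" for c using that \<eta> by simp
      have \<eta>1: "\<eta> \<le> 1" using \<eta> \<tau> by simp
      have P_le: "\<bar>poly P u\<bar> \<le> 2 * M + 2 * K1"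
      proof -
        have "2 * K1 * \<eta> \<le> 2 * K1 * 1" using pos \<eta>1 by (intro mult_left_mono) auto
        then show ?thesis using e0[OF u] g0_le[OF u] by simp
      qed
      have \<kappa>C: "0 \<le> \<kappa> u * C" "\<kappa> u * C \<le> C"
        using \<kappa>[of u] C(2) mult_right_mono[of "\<kappa> u" 1 C] by auto
      have "\<kappa> u * C \<le> (if \<tau> \<le> u then C else 0)"
        using \<kappa>C \<kappa>(3)[of u] by simp
      then have hi: "DP u \<le> (if \<tau> \<le> u then C else 0) + K * \<eta>"
        using DP[OF u] K\<eta>[OF Kge(3)] by linarith
      have low: "- K * \<eta> \<le> DP u" "- K * \<eta> \<le> poly P u"
        using DP[OF u] K\<eta>[OF Kge(3)] \<kappa>C K\<eta>[OF Kge(1)] e0[OF u] g0_nonneg[OF u(2)] by linarith+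
      \<comment> \<open>Beyond the ramp the second factor is small; up to its end the first one
        is.\<close>
      have prod: "\<bar>poly P u * (DP u - C)\<bar> \<le> K * \<eta>"
      proof (cases "\<tau> + \<eta> \<le> u")
        case True
        have "\<bar>poly P u * (DP u - C)\<bar> \<le> (2 * M + 2 * K1) * (K4 * \<eta>)"
          unfolding abs_mult using P_le DP[OF u] \<kappa>(4)[OF True] by (intro mult_mono) auto
        also have "\<dots> = ((2 * M + 2 * K1) * K4) * \<eta>" by simp
        finally show ?thesis using K\<eta>[OF Kge(4)] by linarith
      next
        case False
        have "\<bar>poly P u\<bar> \<le> (M + 2 * K1) * \<eta>"
          using e0[OF u] g_near(1)[of u] False by (simp add: algebra_simps)
        moreover have "\<bar>DP u - C\<bar> \<le> K4 + C"
        proof -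
          have "K4 * \<eta> \<le> K4 * 1" using pos \<eta>1 by (intro mult_left_mono) auto
          then show ?thesis using DP[OF u] \<kappa>C C(2) by linarith
        qed
        ultimately have "\<bar>poly P u * (DP u - C)\<bar> \<le> ((M + 2 * K1) * \<eta>) * (K4 + C)"
          unfolding abs_mult using M(1) pos \<eta> by (intro mult_mono) auto
        also have "\<dots> = ((M + 2 * K1) * (K4 + C)) * \<eta>" by simp
        finally show ?thesis using K\<eta>[OF Kge(5)] by linarith
      qed
      have lo: "\<tau> + \<eta> \<le> u \<longrightarrow> C - K * \<eta> \<le> DP u"
        using DP[OF u] \<kappa>(4)[of u] K\<eta>[OF Kge(3)] by auto
      show "- K * \<eta> \<le> poly P u \<and> \<bar>poly P u\<bar> \<le> K
       \<and> - K * \<eta> \<le> poly (Lop a b P + smult l P) u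
       \<and> poly (Lop a b P + smult l P) u \<le> (if \<tau> \<le> u then C else 0) + K * \<eta>
       \<and> \<bar>poly P u * (poly (Lop a b P + smult l P) u - C)\<bar> \<le> K * \<eta>
       \<and> (\<tau> + \<eta> \<le> u \<longrightarrow> C - K * \<eta> \<le> poly (Lop a b P + smult l P) u)"
        unfolding DP_def[symmetric]
        using prod lo low hi order.trans[OF P_le Kge(2)] by blast
    qed
  qed
  show thesis by (rule that[OF \<open>K > 0\<close> approx])
qed

section \<open>Gaussian integration by parts\<close>

text \<open>Polynomial functions are given by closure rules instead of coefficients, so membership
  is settled by introduction rules and growth bounds by induction.\<close>

inductive polyfun :: "'i set \<Rightarrow> (('i \<Rightarrow> real) \<Rightarrow> real) \<Rightarrow> bool" for I where
  polyfun_const: "polyfun I (\<lambda>z. c)"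
| polyfun_proj: "k \<in> I \<Longrightarrow> polyfun I (\<lambda>z. z k)"
| polyfun_add: "polyfun I f \<Longrightarrow> polyfun I g \<Longrightarrow> polyfun I (\<lambda>z. f z + g z)"
| polyfun_mult: "polyfun I f \<Longrightarrow> polyfun I g \<Longrightarrow> polyfun I (\<lambda>z. f z * g z)"

lemma polyfun_sum:
  "(\<And>i. i \<in> A \<Longrightarrow> polyfun I (f i)) \<Longrightarrow> polyfun I (\<lambda>z. \<Sum>i\<in>A. f i z)"
  by (induction A rule: infinite_finite_induct) (auto intro: polyfun.intros)

lemma polyfun_power: "polyfun I f \<Longrightarrow> polyfun I (\<lambda>z. f z ^ n)"
  by (induction n) (auto intro: polyfun.intros)

lemmas polyfun_intros = polyfun.intros polyfun_sum polyfun_power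

lemma polyfun_measurable:
  "polyfun I f \<Longrightarrow> f \<in> borel_measurable (PiM I (\<lambda>_. lborel))"
proof (induction rule: polyfun.induct)
  case (polyfun_proj k)
  then show ?case
    using measurable_component_singleton[of k I "\<lambda>_. lborel :: real measure"] by simp
qed auto

text \<open>The majorant factors over the coordinates, so that integrability against the product
  Gaussian reduces to moments in one variable.\<close>

lemma polyfun_bound:
  assumes "polyfun I f" "finite I"
  shows "\<exists>C n. \<forall>z. \<bar>f z\<bar> \<le> C * (\<Prod>k\<in>I. (1 + (z k)\<^sup>2) ^ n)"
  using assms(1)
proof (induction rule: polyfun.induct)
  case (polyfun_const c)
  show ?case by (intro exI[of _ "\<bar>c\<bar>"] exI[of _ 0]) simp
next
  case (polyfun_proj k)
  have "\<bar>z k\<bar> \<le> (\<Prod>j\<in>I. 1 + (z j)\<^sup>2)" for z :: "'a \<Rightarrow> real"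
  proof -
    have "\<bar>z k\<bar> \<le> 1 + (z k)\<^sup>2"
      using zero_le_power2[of "\<bar>z k\<bar> - 1"] by (simp add: power2_eq_square algebra_simps)
    also have "\<dots> = (1 + (z k)\<^sup>2) * 1" by simp
    also have "\<dots> \<le> (1 + (z k)\<^sup>2) * (\<Prod>j\<in>I - {k}. 1 + (z j)\<^sup>2)"
      by (intro mult_left_mono prod_ge_1) auto
    also have "\<dots> = (\<Prod>j\<in>I. 1 + (z j)\<^sup>2)"
      using polyfun_proj assms(2) by (simp add: prod.remove)
    finally show ?thesis .
  qed
  then show ?case by (intro exI[of _ 1]) simp
next
  case (polyfun_add f g)
  then obtain C n D l where f: "\<And>z. \<bar>f z\<bar> \<le> C * (\<Prod>k\<in>I. (1 + (z k)\<^sup>2) ^ n)"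
    and g: "\<And>z. \<bar>g z\<bar> \<le> D * (\<Prod>k\<in>I. (1 + (z k)\<^sup>2) ^ l)" by blast
  have mono: "(\<Prod>k\<in>I. (1 + (z k)\<^sup>2) ^ n) \<le> (\<Prod>k\<in>I. (1 + (z k)\<^sup>2) ^ max n l)"
    "(\<Prod>k\<in>I. (1 + (z k)\<^sup>2) ^ l) \<le> (\<Prod>k\<in>I. (1 + (z k)\<^sup>2) ^ max n l)" for z :: "'a \<Rightarrow> real"
    by (intro prod_mono conjI power_increasing zero_le_power; simp)+
  have nn: "0 \<le> C" "0 \<le> D"
    using order.trans[OF abs_ge_zero f[of "\<lambda>_. 0"]] order.trans[OF abs_ge_zero g[of "\<lambda>_. 0"]] by auto
  have "\<bar>f z + g z\<bar> \<le> (C + D) * (\<Prod>k\<in>I. (1 + (z k)\<^sup>2) ^ max n l)" for z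
    using f[of z] g[of z] mult_left_mono[OF mono(1) nn(1), of z] mult_left_mono[OF mono(2) nn(2), of z]
    unfolding distrib_right by linarith
  then show ?case by blast
next
  case (polyfun_mult f g)
  then obtain C n D l where f: "\<And>z. \<bar>f z\<bar> \<le> C * (\<Prod>k\<in>I. (1 + (z k)\<^sup>2) ^ n)"
    and g: "\<And>z. \<bar>g z\<bar> \<le> D * (\<Prod>k\<in>I. (1 + (z k)\<^sup>2) ^ l)" by blast
  have "\<bar>f z * g z\<bar> \<le> (C * D) * (\<Prod>k\<in>I. (1 + (z k)\<^sup>2) ^ (n + l))" for z
  proof -
    have "\<bar>f z * g z\<bar> \<le> (C * (\<Prod>k\<in>I. (1 + (z k)\<^sup>2) ^ n)) * (D * (\<Prod>k\<in>I. (1 + (z k)\<^sup>2) ^ l))"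
      unfolding abs_mult using f[of z] g[of z] by (intro mult_mono) (auto intro: order.trans[OF abs_ge_zero])
    then show ?thesis by (simp add: power_add prod.distrib mult_ac)
  qed
  then show ?case by blast
qed

lemma polyfun_section:
  assumes "polyfun I f"
  shows "\<exists>p. \<forall>s. f (z(k := s)) = poly p s"
  using assms
proof (induction rule: polyfun.induct)
  case (polyfun_const c)
  show ?case by (intro exI[of _ "[:c:]"]) simp
next
  case (polyfun_proj j)
  show ?case by (intro exI[of _ "if j = k then [:0, 1:] else [:z j:]"]) simp
next
  case (polyfun_add f g)
  then show ?case by (metis poly_add)
next
  case (polyfun_mult f g)
  then show ?case by (metis poly_mult)
qed

lemma integrable_poly_std_normal:
  "integrable lborel (\<lambda>s. poly p s * std_normal_density s)"
proof -
  have "integrable lborel (\<lambda>s. \<Sum>i\<le>degree p. coeff p i * (std_normal_density s * s ^ i))"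
    by (intro Bochner_Integration.integrable_sum integrable_mult_right integrable_std_normal_moment)
  moreover have "(\<Sum>i\<le>degree p. coeff p i * (std_normal_density s * s ^ i)) = poly p s * std_normal_density s" for s
    unfolding poly_altdef sum_distrib_right by (intro sum.cong refl) simp
  ultimately show ?thesis by simp
qed

text \<open>For even n both integrals are odd moments, and at n = 0 the factor n covers the
  truncated exponent. For odd n this is the ratio of consecutive even moments.\<close>

lemma std_normal_Stein_monomial:
  "(\<integral>s. s ^ (n + 1) * std_normal_density s \<partial>lborel)
    = real n * (\<integral>s. s ^ (n - 1) * std_normal_density s \<partial>lborel)"
proof (cases "even n")
  case True
  then obtain k where k: "n = 2 * k" by auto
  have odd: "(\<integral>s. s ^ (2 * j + 1) * std_normal_density s \<partial>lborel) = 0" for j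
    using integral_std_normal_moment_odd[of j] by (simp only: mult.commute)
  show ?thesis
    using odd[of k] odd[of "k - 1"] by (cases k) (simp_all add: k)
next
  case False
  then obtain k where k: "n = 2 * k + 1" by (auto elim: oddE)
  have even: "(\<integral>s. s ^ (2 * j) * std_normal_density s \<partial>lborel) = fact (2 * j) / (2 ^ j * fact j)" for j
    using integral_std_normal_moment_even[of j] by (simp add: mult.commute)
  have "fact (2 * (k + 1)) / (2 ^ (k + 1) * fact (k + 1)) = real n * (fact (2 * k) / (2 ^ k * fact k))"
    by (simp add: k divide_simps)
  moreover have "n + 1 = 2 * (k + 1)" "n - 1 = 2 * k" using k by auto
  ultimately show ?thesis by (simp only: even)
qed

lemma std_normal_Stein:
  "(\<integral>s. (poly (pderiv p) s - s * poly p s) * std_normal_density s \<partial>lborel) = 0"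
proof -
  have int: "integrable lborel (\<lambda>s. s ^ i * std_normal_density s)" for i
    using integrable_std_normal_moment[of i] by (simp add: mult.commute)
  have eq: "poly (pderiv p) s - s * poly p s
      = (\<Sum>i\<le>degree p. coeff p i * (real i * s ^ (i - 1) - s ^ (i + 1)))" for s
  proof -
    have "poly (pderiv (\<Sum>i\<in>A. monom (coeff p i) i)) s = (\<Sum>i\<in>A. coeff p i * (real i * s ^ (i - 1)))"
      if "finite A" for A
      using that by induction (simp_all add: pderiv_add pderiv_monom poly_monom mult_ac)
    from this[of "{..degree p}"] show ?thesis
      by (simp add: poly_as_sum_of_monoms poly_altdef[of p] sum_distrib_left sum_subtractf[symmetric]
          algebra_simps)
  qed
  have "(\<integral>s. (poly (pderiv p) s - s * poly p s) * std_normal_density s \<partial>lborel)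
     = (\<integral>s. (\<Sum>i\<le>degree p. coeff p i * (real i * (s ^ (i - 1) * std_normal_density s)
         - s ^ (i + 1) * std_normal_density s)) \<partial>lborel)"
    unfolding eq sum_distrib_right by (intro Bochner_Integration.integral_cong sum.cong refl) (simp add: algebra_simps)
  also have "\<dots> = (\<Sum>i\<le>degree p. coeff p i * (real i * (\<integral>s. s ^ (i - 1) * std_normal_density s \<partial>lborel)
         - (\<integral>s. s ^ (i + 1) * std_normal_density s \<partial>lborel)))"
    by (subst Bochner_Integration.integral_sum)
       (auto intro!: sum.cong simp: int Bochner_Integration.integral_diff simp del: power_Suc)
  also have "\<dots> = 0"
    by (simp only: std_normal_Stein_monomial) simp
  finally show ?thesis .
qed

definition gauss_density :: "'i set \<Rightarrow> ('i \<Rightarrow> real) \<Rightarrow> real" where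
  "gauss_density I z = (\<Prod>k\<in>I. std_normal_density (z k))"

definition gauss_expect :: "'i set \<Rightarrow> (('i \<Rightarrow> real) \<Rightarrow> real) \<Rightarrow> real" where
  "gauss_expect I f = (\<integral>z. f z * gauss_density I z \<partial>PiM I (\<lambda>_. lborel))"

lemma gauss_density_measurable [measurable]:
  "gauss_density I \<in> borel_measurable (PiM I (\<lambda>_. lborel))"
  unfolding gauss_density_def by measurable

lemma gauss_density_pos: "0 < gauss_density I z"
  unfolding gauss_density_def by (intro prod_pos ballI normal_density_pos) simp

lemma polyfun_gauss_integrable:
  assumes "polyfun I f" "finite I"
  shows "integrable (PiM I (\<lambda>_. lborel)) (\<lambda>z. f z * gauss_density I z)"
proof -
  interpret product_sigma_finite "\<lambda>_. lborel :: real measure"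
    by standard
  obtain C n where C: "\<And>z. \<bar>f z\<bar> \<le> C * (\<Prod>k\<in>I. (1 + (z k)\<^sup>2) ^ n)"
    using polyfun_bound[OF assms] by blast
  have "integrable lborel (\<lambda>s::real. (1 + s\<^sup>2) ^ n * std_normal_density s)"
    using integrable_poly_std_normal[of "[:1, 0, 1:] ^ n"] by (simp add: power2_eq_square)
  then have "integrable (PiM I (\<lambda>_. lborel)) (\<lambda>z. \<Prod>k\<in>I. (1 + (z k)\<^sup>2) ^ n * std_normal_density (z k))"
    using product_integrable_prod[OF assms(2), of "\<lambda>_ s. (1 + s\<^sup>2) ^ n * std_normal_density s"] by simp
  then have "integrable (PiM I (\<lambda>_. lborel))
      (\<lambda>z. C * (\<Prod>k\<in>I. (1 + (z k)\<^sup>2) ^ n * std_normal_density (z k)))"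
    by (rule integrable_mult_right)
  then show ?thesis
  proof (rule Bochner_Integration.integrable_bound)
    show "(\<lambda>z. f z * gauss_density I z) \<in> borel_measurable (PiM I (\<lambda>_. lborel))"
      using polyfun_measurable[OF assms(1)] by measurable
    have "norm (f z * gauss_density I z)
        \<le> norm (C * (\<Prod>k\<in>I. (1 + (z k)\<^sup>2) ^ n * std_normal_density (z k)))" for z
    proof -
      have "\<bar>f z\<bar> * gauss_density I z \<le> C * (\<Prod>k\<in>I. (1 + (z k)\<^sup>2) ^ n) * gauss_density I z"
        by (intro mult_right_mono C less_imp_le[OF gauss_density_pos])
      also have "\<dots> = C * (\<Prod>k\<in>I. (1 + (z k)\<^sup>2) ^ n * std_normal_density (z k))"
        by (simp add: gauss_density_def prod.distrib mult.assoc)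
      also have "\<dots> \<le> norm \<dots>" by simp
      finally show ?thesis
        using gauss_density_pos[of I z] by (simp only: real_norm_def abs_mult[of "f z"] abs_of_pos)
    qed
    then show "AE z in PiM I (\<lambda>_. lborel). norm (f z * gauss_density I z)
        \<le> norm (C * (\<Prod>k\<in>I. (1 + (z k)\<^sup>2) ^ n * std_normal_density (z k)))" by simp
  qed
qed

lemma gauss_expect_add:
  assumes "polyfun I f" "polyfun I g" "finite I"
  shows "gauss_expect I (\<lambda>z. f z + g z) = gauss_expect I f + gauss_expect I g"
  unfolding gauss_expect_def
  using polyfun_gauss_integrable[OF assms(1,3)] polyfun_gauss_integrable[OF assms(2,3)]
  by (simp add: distrib_right)

lemma gauss_expect_cmult: "gauss_expect I (\<lambda>z. c * f z) = c * gauss_expect I f"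
  unfolding gauss_expect_def by (simp add: mult.assoc)

lemma gauss_expect_sum:
  assumes "\<And>i. i \<in> A \<Longrightarrow> polyfun I (f i)" "finite I"
  shows "gauss_expect I (\<lambda>z. \<Sum>i\<in>A. f i z) = (\<Sum>i\<in>A. gauss_expect I (f i))"
  using assms(1)
proof (induction A rule: infinite_finite_induct)
  case (insert i A)
  then show ?case by (simp add: gauss_expect_add polyfun_sum assms(2))
qed (simp_all add: gauss_expect_def)

definition has_partial :: "'i \<Rightarrow> (('i \<Rightarrow> real) \<Rightarrow> real) \<Rightarrow> (('i \<Rightarrow> real) \<Rightarrow> real) \<Rightarrow> bool" where
  "has_partial k f f' \<longleftrightarrow> (\<forall>z s. ((\<lambda>s. f (z(k := s))) has_real_derivative f' (z(k := s))) (at s))"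

text \<open>Fubini isolates coordinate k. On each line f is a polynomial in one variable, f' is its
  derivative by uniqueness, and the one-dimensional identity makes the inner integral
  vanish.\<close>

lemma gauss_Stein:
  assumes f: "polyfun I f" "polyfun I f'" and I: "finite I" "k \<in> I" and part: "has_partial k f f'"
  shows "gauss_expect I (\<lambda>z. z k * f z) = gauss_expect I f'"
proof -
  interpret product_sigma_finite "\<lambda>_. lborel :: real measure"
    by standard
  define F where "F z = (f' z - z k * f z) * gauss_density I z" for z
  define J where "J = I - {k}"
  have J: "finite J" "k \<notin> J" "I = insert k J" using I by (auto simp: J_def)
  have ints: "integrable (PiM I (\<lambda>_. lborel)) (\<lambda>z. f' z * gauss_density I z)"
    "integrable (PiM I (\<lambda>_. lborel)) (\<lambda>z. (z k * f z) * gauss_density I z)"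
    using f I by (auto intro!: polyfun_gauss_integrable polyfun_intros)
  have intF: "integrable (PiM (insert k J) (\<lambda>_. lborel)) F"
    unfolding F_def left_diff_distrib J(3)[symmetric] by (rule Bochner_Integration.integrable_diff[OF ints])
  have "integral\<^sup>L (PiM I (\<lambda>_. lborel)) F
      = (\<integral>x. (\<integral>s. F (x(k := s)) \<partial>lborel) \<partial>PiM J (\<lambda>_. lborel))"
    unfolding J(3) by (rule product_integral_insert[OF J(1,2) intF])
  also have "\<dots> = (\<integral>x. 0 \<partial>PiM J (\<lambda>_. lborel :: real measure))"
  proof (rule Bochner_Integration.integral_cong[OF refl])
    fix x
    obtain p where p: "\<And>s. f (x(k := s)) = poly p s"
      using polyfun_section[OF f(1)] by blast
    have p': "f' (x(k := s)) = poly (pderiv p) s" for s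
      using DERIV_unique[OF part[unfolded has_partial_def, rule_format, of x s, unfolded p] poly_DERIV[of p s]] .
    have gd: "gauss_density I (x(k := s)) = gauss_density J x * std_normal_density s" for s
    proof -
      have "(\<Prod>j\<in>J. std_normal_density ((x(k := s)) j)) = (\<Prod>j\<in>J. std_normal_density (x j))"
        using J by (intro prod.cong) auto
      then show ?thesis using J(1,2) by (simp add: gauss_density_def J(3))
    qed
    have "(\<integral>s. F (x(k := s)) \<partial>lborel)
        = (\<integral>s. gauss_density J x * ((poly (pderiv p) s - s * poly p s) * std_normal_density s) \<partial>lborel)"
      by (intro Bochner_Integration.integral_cong refl) (simp add: F_def gd p p' del: fun_upd_apply, simp)
    also have "\<dots> = 0" by (simp add: std_normal_Stein)
    finally show "(\<integral>s. F (x(k := s)) \<partial>lborel) = 0" .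
  qed
  finally have "integral\<^sup>L (PiM I (\<lambda>_. lborel)) F = 0" by simp
  then show ?thesis
    unfolding F_def gauss_expect_def left_diff_distrib
    by (simp add: Bochner_Integration.integral_diff[OF ints])
qed

lemma has_partial_const: "has_partial k (\<lambda>z. c) (\<lambda>z. 0)"
  by (simp add: has_partial_def)

lemma has_partial_proj: "has_partial k (\<lambda>z. z j) (\<lambda>z. if j = k then 1 else 0)"
  by (auto simp: has_partial_def intro!: derivative_eq_intros)

lemma has_partial_mult:
  "has_partial k f f' \<Longrightarrow> has_partial k g g' \<Longrightarrow>
    has_partial k (\<lambda>z. f z * g z) (\<lambda>z. f' z * g z + f z * g' z)"
  by (auto simp: has_partial_def intro!: derivative_eq_intros)

lemma has_partial_sum:
  "(\<And>i. i \<in> A \<Longrightarrow> has_partial k (f i) (f' i)) \<Longrightarrow> has_partial k (\<lambda>z. \<Sum>i\<in>A. f i z) (\<lambda>z. \<Sum>i\<in>A. f' i z)"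
  by (auto simp: has_partial_def intro!: derivative_intros)

lemma has_partial_power:
  "has_partial k f f' \<Longrightarrow> has_partial k (\<lambda>z. f z ^ n) (\<lambda>z. real n * f z ^ (n - 1) * f' z)"
  by (auto simp: has_partial_def intro!: derivative_eq_intros)

lemma has_partial_cong: "has_partial k f f' \<Longrightarrow> (\<And>z. f' z = g' z) \<Longrightarrow> has_partial k f g'"
  by (metis ext)

section \<open>Sums of squared linear forms under the Gaussian weight\<close>

definition linform :: "'i set \<Rightarrow> ('i \<Rightarrow> real) \<Rightarrow> ('i \<Rightarrow> real) \<Rightarrow> real" where
  "linform I a z = (\<Sum>k\<in>I. a k * z k)"

text \<open>For an orthonormal family this is the squared length of the projection of z to its
  span.\<close>

definition quadform :: "'i set \<Rightarrow> nat \<Rightarrow> (nat \<Rightarrow> 'i \<Rightarrow> real) \<Rightarrow> ('i \<Rightarrow> real) \<Rightarrow> real" where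
  "quadform I d a z = (\<Sum>j<d. (linform I (a j) z)\<^sup>2)"

definition orthonormal_family :: "'i set \<Rightarrow> nat \<Rightarrow> (nat \<Rightarrow> 'i \<Rightarrow> real) \<Rightarrow> bool" where
  "orthonormal_family I d a \<longleftrightarrow> (\<forall>i<d. \<forall>j<d. linform I (a i) (a j) = (if i = j then 1 else 0))"

lemma polyfun_linform: "polyfun I (linform I a)"
  unfolding linform_def by (intro polyfun_intros)

lemma polyfun_quadform: "polyfun I (quadform I d a)"
  unfolding quadform_def by (intro polyfun_intros polyfun_linform)

lemma has_partial_linform:
  assumes "finite I" "k \<in> I"
  shows "has_partial k (linform I a) (\<lambda>z. a k)"
  unfolding linform_def
proof (rule has_partial_cong)
  show "has_partial k (\<lambda>z. \<Sum>j\<in>I. a j * z j) (\<lambda>z. \<Sum>j\<in>I. 0 * z j + a j * (if j = k then 1 else 0))"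
    by (intro has_partial_sum has_partial_mult has_partial_const has_partial_proj)
  show "(\<Sum>j\<in>I. 0 * z j + a j * (if j = k then 1 else 0)) = a k" for z
    using assms by (simp add: if_distrib cong: if_cong)
qed

definition quadgrad :: "'i set \<Rightarrow> nat \<Rightarrow> (nat \<Rightarrow> 'i \<Rightarrow> real) \<Rightarrow> 'i \<Rightarrow> ('i \<Rightarrow> real) \<Rightarrow> real" where
  "quadgrad I d a k z = (\<Sum>j<d. 2 * a j k * linform I (a j) z)"

lemma polyfun_quadgrad: "polyfun I (quadgrad I d a k)"
  unfolding quadgrad_def by (intro polyfun_intros polyfun_linform)

lemma has_partial_quadform:
  assumes "finite I" "k \<in> I"
  shows "has_partial k (quadform I d a) (quadgrad I d a k)"
  unfolding quadform_def quadgrad_def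
proof (rule has_partial_cong)
  show "has_partial k (\<lambda>z. \<Sum>j<d. (linform I (a j) z)\<^sup>2)
     (\<lambda>z. \<Sum>j<d. real 2 * linform I (a j) z ^ (2 - 1) * a j k)"
    by (intro has_partial_sum has_partial_power has_partial_linform assms)
qed (simp add: mult_ac)

lemma has_partial_quadgrad:
  assumes "finite I" "k \<in> I"
  shows "has_partial k (quadgrad I d a k) (\<lambda>z. \<Sum>j<d. 2 * (a j k)\<^sup>2)"
  unfolding quadgrad_def
proof (rule has_partial_cong)
  show "has_partial k (\<lambda>z. \<Sum>j<d. 2 * a j k * linform I (a j) z)
     (\<lambda>z. \<Sum>j<d. 0 * linform I (a j) z + 2 * a j k * a j k)"
    by (intro has_partial_sum has_partial_mult has_partial_const has_partial_linform assms)
qed (simp add: power2_eq_square mult.assoc)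

lemma sum_quadgrad_times_coord:
  "(\<Sum>k\<in>I. z k * quadgrad I d a k z) = 2 * quadform I d a z"
proof -
  have "(\<Sum>k\<in>I. z k * quadgrad I d a k z) = (\<Sum>j<d. \<Sum>k\<in>I. z k * (2 * a j k * linform I (a j) z))"
    unfolding quadgrad_def sum_distrib_left by (rule sum.swap)
  also have "\<dots> = (\<Sum>j<d. 2 * linform I (a j) z * (\<Sum>k\<in>I. a j k * z k))"
    unfolding sum_distrib_left by (intro sum.cong refl) simp
  also have "\<dots> = (\<Sum>j<d. 2 * (linform I (a j) z)\<^sup>2)"
    by (intro sum.cong refl) (simp add: linform_def power2_eq_square)
  finally show ?thesis
    by (simp only: quadform_def sum_distrib_left)
qed

text \<open>The gradient is twice the projection of z to the span of the family.\<close>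

lemma sum_quadgrad_squared:
  assumes "orthonormal_family I d a"
  shows "(\<Sum>k\<in>I. (quadgrad I d a k z)\<^sup>2) = 4 * quadform I d a z"
proof -
  have "(\<Sum>k\<in>I. (quadgrad I d a k z)\<^sup>2)
      = (\<Sum>k\<in>I. \<Sum>i<d. \<Sum>j<d. 2 * a i k * linform I (a i) z * (2 * a j k * linform I (a j) z))"
    unfolding quadgrad_def power2_eq_square sum_product ..
  also have "\<dots> = (\<Sum>i<d. \<Sum>j<d. \<Sum>k\<in>I. 2 * a i k * linform I (a i) z * (2 * a j k * linform I (a j) z))"
    by (subst sum.swap, intro sum.cong refl, rule sum.swap)
  also have "\<dots> = (\<Sum>i<d. \<Sum>j<d. 4 * linform I (a i) z * linform I (a j) z * linform I (a i) (a j))"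
    by (intro sum.cong refl) (simp add: linform_def[of I "a _" "a _"] sum_distrib_left mult_ac)
  also have "\<dots> = (\<Sum>i<d. \<Sum>j<d. if i = j then 4 * linform I (a i) z * linform I (a j) z else 0)"
    using assms by (intro sum.cong refl) (auto simp: orthonormal_family_def)
  also have "\<dots> = 4 * quadform I d a z"
    by (simp add: quadform_def sum_distrib_left power2_eq_square mult.assoc)
  finally show ?thesis .
qed

text \<open>Gaussian integration by parts: the expectation of grad f . grad h is that of f (z . grad
  h - Laplacian h). For h = \<open>quadform I d b z ^ j\<close>, Euler's identity gives z . grad h =
  2 j h, and the Laplacian is 2 j (2 j + d - 2) times the power j - 1, as for a radial power in d
  dimensions.\<close>

lemma gauss_expect_gradient_product:
  assumes I: "finite I" and b: "orthonormal_family I d b"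
  shows "gauss_expect I (\<lambda>z. \<Sum>k\<in>I. (real i * quadform I d a z ^ (i - 1) * quadgrad I d a k z)
            * (real j * quadform I d b z ^ (j - 1) * quadgrad I d b k z))
    = 2 * real j * gauss_expect I (\<lambda>z. quadform I d a z ^ i * quadform I d b z ^ j)
      - 2 * real j * (2 * real j + real d - 2)
        * gauss_expect I (\<lambda>z. quadform I d a z ^ i * quadform I d b z ^ (j - 1))"
proof -
  define p where "p z = quadform I d a z ^ i" for z
  define p' where "p' k z = real i * quadform I d a z ^ (i - 1) * quadgrad I d a k z" for k z
  define q' where "q' k z = real j * quadform I d b z ^ (j - 1) * quadgrad I d b k z" for k z
  define q'' where "q'' k z = (0 * quadform I d b z ^ (j - 1)
      + real j * (real (j - 1) * quadform I d b z ^ (j - 1 - 1) * quadgrad I d b k z)) * quadgrad I d b k z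
      + real j * quadform I d b z ^ (j - 1) * (\<Sum>i<d. 2 * (b i k)\<^sup>2)" for k z
  note pf = polyfun_intros polyfun_quadform polyfun_quadgrad
  have P: "polyfun I p" "polyfun I (p' k)" "polyfun I (q' k)" "polyfun I (q'' k)" for k
    unfolding p_def p'_def q'_def q''_def by (intro pf)+
  have stein: "gauss_expect I (\<lambda>z. z k * (p z * q' k z))
      = gauss_expect I (\<lambda>z. p' k z * q' k z + p z * q'' k z)" if k: "k \<in> I" for k
  proof (rule gauss_Stein)
    show "has_partial k (\<lambda>z. p z * q' k z) (\<lambda>z. p' k z * q' k z + p z * q'' k z)"
      unfolding p_def p'_def q'_def q''_def
      by (intro has_partial_mult has_partial_power has_partial_const
          has_partial_quadform[OF I k] has_partial_quadgrad[OF I k])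
  qed (auto intro!: pf P I k)
  have "gauss_expect I (\<lambda>z. \<Sum>k\<in>I. z k * (p z * q' k z))
      = gauss_expect I (\<lambda>z. (\<Sum>k\<in>I. p' k z * q' k z) + (\<Sum>k\<in>I. p z * q'' k z))"
  proof -
    have "gauss_expect I (\<lambda>z. \<Sum>k\<in>I. z k * (p z * q' k z))
       = (\<Sum>k\<in>I. gauss_expect I (\<lambda>z. z k * (p z * q' k z)))"
      by (intro gauss_expect_sum pf P I)
    also have "\<dots> = (\<Sum>k\<in>I. gauss_expect I (\<lambda>z. p' k z * q' k z + p z * q'' k z))"
      by (intro sum.cong refl stein)
    also have "\<dots> = gauss_expect I (\<lambda>z. \<Sum>k\<in>I. p' k z * q' k z + p z * q'' k z)"
      by (intro gauss_expect_sum[symmetric] pf P I)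
    finally show ?thesis by (simp add: sum.distrib)
  qed
  also have "\<dots> = gauss_expect I (\<lambda>z. \<Sum>k\<in>I. p' k z * q' k z) + gauss_expect I (\<lambda>z. \<Sum>k\<in>I. p z * q'' k z)"
    by (intro gauss_expect_add pf P I)
  also have "(\<lambda>z. \<Sum>k\<in>I. z k * (p z * q' k z)) = (\<lambda>z. 2 * real j * (p z * quadform I d b z ^ j))"
  proof
    fix z
    have "(\<Sum>k\<in>I. z k * (p z * q' k z))
        = p z * real j * quadform I d b z ^ (j - 1) * (\<Sum>k\<in>I. z k * quadgrad I d b k z)"
      by (simp add: q'_def sum_distrib_left mult_ac)
    also have "\<dots> = 2 * real j * (p z * quadform I d b z ^ j)"
      unfolding sum_quadgrad_times_coord by (cases j) simp_all
    finally show "(\<Sum>k\<in>I. z k * (p z * q' k z)) = 2 * real j * (p z * quadform I d b z ^ j)" .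
  qed
  also have "(\<lambda>z. \<Sum>k\<in>I. p z * q'' k z)
      = (\<lambda>z. (2 * real j * (2 * real j + real d - 2)) * (p z * quadform I d b z ^ (j - 1)))"
  proof
    fix z
    have n: "(\<Sum>k\<in>I. \<Sum>i<d. (b i k)\<^sup>2) = real d"
    proof -
      have "(\<Sum>k\<in>I. \<Sum>i<d. (b i k)\<^sup>2) = (\<Sum>i<d. linform I (b i) (b i))"
        by (subst sum.swap) (simp add: linform_def power2_eq_square)
      then show ?thesis using b by (simp add: orthonormal_family_def)
    qed
    have "(\<Sum>k\<in>I. p z * q'' k z) = p z * (real j * real (j - 1) * quadform I d b z ^ (j - 1 - 1)
        * (\<Sum>k\<in>I. (quadgrad I d b k z)\<^sup>2)
        + real j * quadform I d b z ^ (j - 1) * 2 * (\<Sum>k\<in>I. \<Sum>i<d. (b i k)\<^sup>2))"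
      unfolding q''_def by (simp add: sum.distrib sum_distrib_left power2_eq_square algebra_simps)
    also have "\<dots> = (2 * real j * (2 * real j + real d - 2)) * (p z * quadform I d b z ^ (j - 1))"
      unfolding sum_quadgrad_squared[OF b] n
      by (cases j; cases "j - 1") (simp_all add: algebra_simps)
    finally show "(\<Sum>k\<in>I. p z * q'' k z)
      = (2 * real j * (2 * real j + real d - 2)) * (p z * quadform I d b z ^ (j - 1))" .
  qed
  finally show ?thesis
    unfolding gauss_expect_cmult by (simp add: p_def p'_def q'_def)
qed

text \<open>The expectation of the gradient product is symmetric under exchanging (a, i) and (b, j);
  its two evaluations are equated.\<close>

lemma gauss_quadform_symmetry:
  assumes I: "finite I" and ab: "orthonormal_family I d a" "orthonormal_family I d b"
  shows "2 * real j * (2 * real j + real d - 2)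
        * gauss_expect I (\<lambda>z. quadform I d a z ^ i * quadform I d b z ^ (j - 1))
      - 2 * real i * (2 * real i + real d - 2)
        * gauss_expect I (\<lambda>z. quadform I d a z ^ (i - 1) * quadform I d b z ^ j)
      = 2 * (real j - real i) * gauss_expect I (\<lambda>z. quadform I d a z ^ i * quadform I d b z ^ j)"
proof -
  have "gauss_expect I (\<lambda>z. \<Sum>k\<in>I. (real i * quadform I d a z ^ (i - 1) * quadgrad I d a k z)
            * (real j * quadform I d b z ^ (j - 1) * quadgrad I d b k z))
    = gauss_expect I (\<lambda>z. \<Sum>k\<in>I. (real j * quadform I d b z ^ (j - 1) * quadgrad I d b k z)
            * (real i * quadform I d a z ^ (i - 1) * quadgrad I d a k z))"
    by (simp add: mult.commute)
  moreover have "gauss_expect I (\<lambda>z. quadform I d b z ^ k * quadform I d a z ^ l)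
      = gauss_expect I (\<lambda>z. quadform I d a z ^ l * quadform I d b z ^ k)" for k l
    by (simp only: mult.commute)
  ultimately show ?thesis
    using gauss_expect_gradient_product[OF I ab(1), of j b i] gauss_expect_gradient_product[OF I ab(2), of i a j]
    by (simp only: left_diff_distrib right_diff_distrib)
qed

text \<open>Stein's identity for z_k times the n-th power of the squared norm, summed over k. These
  moments are the factors between Gaussian expectations and integrals over the sphere.\<close>

lemma gauss_norm_moment_Suc:
  assumes I: "finite I"
  shows "gauss_expect I (\<lambda>z. (\<Sum>k\<in>I. (z k)\<^sup>2) ^ Suc n)
    = (real (card I) + 2 * real n) * gauss_expect I (\<lambda>z. (\<Sum>k\<in>I. (z k)\<^sup>2) ^ n)"
proof -
  define r :: "('a \<Rightarrow> real) \<Rightarrow> real" where "r z = (\<Sum>k\<in>I. (z k)\<^sup>2)" for z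
  define r' where "r' k z = (\<Sum>j\<in>I. real 2 * z j ^ (2 - 1) * (if j = k then 1 else 0))" for k and z :: "'a \<Rightarrow> real"
  have r': "r' k z = 2 * z k" if "k \<in> I" for k z
    using that I by (simp add: r'_def if_distrib cong: if_cong)
  have pr: "polyfun I r" unfolding r_def by (intro polyfun_intros)
  have stein: "gauss_expect I (\<lambda>z. z k * (z k * r z ^ n))
     = gauss_expect I (\<lambda>z. 1 * r z ^ n + z k * (real n * r z ^ (n - 1) * (2 * z k)))" if k: "k \<in> I" for k
  proof (rule gauss_Stein)
    have "has_partial k r (\<lambda>z. 2 * z k)"
    proof (rule has_partial_cong)
      show "has_partial k r (r' k)"
        unfolding r_def r'_def by (intro has_partial_sum has_partial_power has_partial_proj)
    qed (use r' k in auto)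
    moreover have "has_partial k (\<lambda>z. z k) (\<lambda>z. 1)"
      using has_partial_proj[of k k] by simp
    ultimately show "has_partial k (\<lambda>z. z k * r z ^ n) (\<lambda>z. 1 * r z ^ n + z k * (real n * r z ^ (n - 1) * (2 * z k)))"
      by (intro has_partial_mult has_partial_power)
  qed (auto intro!: polyfun_intros pr I k)
  have "gauss_expect I (\<lambda>z. r z ^ Suc n) = gauss_expect I (\<lambda>z. \<Sum>k\<in>I. z k * (z k * r z ^ n))"
    by (simp add: r_def sum_distrib_right power2_eq_square mult_ac)
  also have "\<dots> = (\<Sum>k\<in>I. gauss_expect I (\<lambda>z. z k * (z k * r z ^ n)))"
    by (intro gauss_expect_sum polyfun_intros pr I)
  also have "\<dots> = (\<Sum>k\<in>I. gauss_expect I (\<lambda>z. 1 * r z ^ n + z k * (real n * r z ^ (n - 1) * (2 * z k))))"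
    by (intro sum.cong refl stein)
  also have "\<dots> = gauss_expect I (\<lambda>z. \<Sum>k\<in>I. 1 * r z ^ n + z k * (real n * r z ^ (n - 1) * (2 * z k)))"
    by (intro gauss_expect_sum[symmetric] polyfun_intros pr I)
  also have "(\<lambda>z. \<Sum>k\<in>I. 1 * r z ^ n + z k * (real n * r z ^ (n - 1) * (2 * z k)))
     = (\<lambda>z. (real (card I) + 2 * real n) * r z ^ n)"
  proof
    fix z
    have "(\<Sum>k\<in>I. z k * (real n * r z ^ (n - 1) * (2 * z k))) = 2 * real n * r z ^ (n - 1) * r z"
      unfolding r_def[of z] power2_eq_square sum_distrib_left by (intro sum.cong refl) (simp add: mult_ac)
    also have "\<dots> = 2 * real n * r z ^ n" by (cases n) simp_all
    finally show "(\<Sum>k\<in>I. 1 * r z ^ n + z k * (real n * r z ^ (n - 1) * (2 * z k)))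
      = (real (card I) + 2 * real n) * r z ^ n"
      by (simp add: sum.distrib algebra_simps)
  qed
  finally show ?thesis unfolding r_def gauss_expect_cmult .
qed

section \<open>The surface measure\<close>

lemma PiM_lborel_scaling:
  fixes I :: "'i set"
  assumes I: "finite I" and c: "c > 0"
    and f: "f \<in> borel_measurable (PiM I (\<lambda>_. lborel :: real measure))"
  shows "(\<integral>\<^sup>+z. f z \<partial>PiM I (\<lambda>_. lborel :: real measure))
    = ennreal c ^ card I * (\<integral>\<^sup>+z. f (\<lambda>k\<in>I. c * z k) \<partial>PiM I (\<lambda>_. lborel))"
proof -
  interpret product_sigma_finite "\<lambda>_. lborel :: real measure"
    by standard
  define \<mu> where "\<mu> = PiM I (\<lambda>_. lborel :: real measure)"
  define S where "S z = (\<lambda>k\<in>I. c * z k)" for z :: "'i \<Rightarrow> real"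
  have S[measurable]: "S \<in> measurable \<mu> \<mu>"
    unfolding S_def \<mu>_def by measurable
  have "density (distr \<mu> \<mu> S) (\<lambda>_. ennreal c ^ card I) = PiM I (\<lambda>_. lborel :: real measure)"
  proof (rule PiM_eqI[OF I])
    show "sets (density (distr \<mu> \<mu> S) (\<lambda>_. ennreal c ^ card I)) = sets (PiM I (\<lambda>_. lborel :: real measure))"
      by (simp add: \<mu>_def)
  next
    fix A :: "'i \<Rightarrow> real set" assume A: "\<And>i. i \<in> I \<Longrightarrow> A i \<in> sets lborel"
    have PiA: "Pi\<^sub>E I A \<in> sets \<mu>" unfolding \<mu>_def using I A by (intro sets_PiM_I_finite) auto
    have vim: "(\<lambda>s. c * s) -` A i \<in> sets lborel" if "i \<in> I" for i
      using measurable_sets[of "\<lambda>s. c * s" lborel lborel "A i"] A[OF that] by simp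
    have "S -` Pi\<^sub>E I A \<inter> space \<mu> = Pi\<^sub>E I (\<lambda>i. (\<lambda>s. c * s) -` A i)"
      by (auto simp: S_def \<mu>_def space_PiM PiE_def Pi_def extensional_def)
    moreover have "emeasure lborel ((\<lambda>s. c * s) -` A i) * ennreal c = emeasure lborel (A i)" if "i \<in> I" for i
    proof -
      have "emeasure lborel (A i) = emeasure (density (distr lborel borel ((*) c)) (\<lambda>_. ennreal \<bar>c\<bar>)) (A i)"
        using lborel_distr_mult'[of c] c by simp
      also have "\<dots> = ennreal c * emeasure (distr lborel borel ((*) c)) (A i)"
        using A[OF that] c by (simp add: emeasure_density_const)
      also have "\<dots> = ennreal c * emeasure lborel ((\<lambda>s. c * s) -` A i)"
        using A[OF that] by (subst emeasure_distr) auto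
      finally show ?thesis by (simp add: mult.commute)
    qed
    ultimately have "emeasure (distr \<mu> \<mu> S) (Pi\<^sub>E I A) * ennreal c ^ card I = (\<Prod>i\<in>I. emeasure lborel (A i))"
      using PiA vim I
      by (simp add: emeasure_distr) (simp add: \<mu>_def emeasure_PiM prod.distrib[symmetric] flip: prod_constant)
    then show "emeasure (density (distr \<mu> \<mu> S) (\<lambda>_. ennreal c ^ card I)) (Pi\<^sub>E I A)
        = (\<Prod>i\<in>I. emeasure lborel (A i))"
      using PiA by (simp add: emeasure_density_const mult.commute)
  qed
  then have eq: "\<mu> = density (distr \<mu> \<mu> S) (\<lambda>_. ennreal c ^ card I)" by (simp add: \<mu>_def)
  have f'[measurable]: "f \<in> borel_measurable \<mu>" using f by (simp add: \<mu>_def)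
  have "(\<integral>\<^sup>+z. f z \<partial>\<mu>) = (\<integral>\<^sup>+z. f z \<partial>density (distr \<mu> \<mu> S) (\<lambda>_. ennreal c ^ card I))"
    using eq by simp
  also have "\<dots> = (\<integral>\<^sup>+z. ennreal c ^ card I * f (S z) \<partial>\<mu>)"
    by (subst nn_integral_density) (auto simp: nn_integral_distr)
  also have "\<dots> = ennreal c ^ card I * (\<integral>\<^sup>+z. f (S z) \<partial>\<mu>)"
    by (rule nn_integral_cmult) measurable
  finally show ?thesis by (simp add: \<mu>_def S_def)
qed

definition sqn :: "'i set \<Rightarrow> ('i \<Rightarrow> real) \<Rightarrow> real" where
  "sqn I z = (\<Sum>k\<in>I. (z k)\<^sup>2)"

lemma sqn_nonneg: "0 \<le> sqn I z"
  by (simp add: sqn_def sum_nonneg)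

lemma sqn_measurable [measurable]: "sqn I \<in> borel_measurable (PiM I (\<lambda>_. lborel))"
  unfolding sqn_def by measurable

lemma sqn_scale: "sqn I (\<lambda>k\<in>I. c * z k) = c\<^sup>2 * sqn I z"
  by (simp add: sqn_def power_mult_distrib sum_distrib_left)

lemma coord_square_le_sqn: "finite I \<Longrightarrow> k \<in> I \<Longrightarrow> (z k)\<^sup>2 \<le> sqn I z"
  unfolding sqn_def by (rule member_le_sum) auto

lemma emeasure_sqn_le_finite:
  assumes "finite I"
  shows "emeasure (PiM I (\<lambda>_. lborel)) {z \<in> space (PiM I (\<lambda>_. lborel)). sqn I z \<le> 1} < \<infinity>"
proof -
  interpret product_sigma_finite "\<lambda>_. lborel :: real measure"
    by standard
  have "{z \<in> space (PiM I (\<lambda>_. lborel)). sqn I z \<le> 1} \<subseteq> Pi\<^sub>E I (\<lambda>_. {-1..1})"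
  proof
    fix z assume z: "z \<in> {z \<in> space (PiM I (\<lambda>_. lborel)). sqn I z \<le> 1}"
    then have "\<bar>z k\<bar> \<le> 1" if "k \<in> I" for k
      using coord_square_le_sqn[OF assms that, of z] by (simp flip: abs_square_le_1)
    then show "z \<in> Pi\<^sub>E I (\<lambda>_. {-1..1})"
      using z by (auto simp: space_PiM PiE_def Pi_def abs_le_iff minus_le_iff)
  qed
  then have "emeasure (PiM I (\<lambda>_. lborel)) {z \<in> space (PiM I (\<lambda>_. lborel)). sqn I z \<le> 1}
      \<le> emeasure (PiM I (\<lambda>_. lborel)) (Pi\<^sub>E I (\<lambda>_. {-1..1::real}))"
    by (rule emeasure_mono) (auto intro!: sets_PiM_I_finite assms)
  also have "\<dots> = (\<Prod>i\<in>I. emeasure lborel {-1..1::real})"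
    by (rule emeasure_PiM[OF assms]) auto
  also have "\<dots> < \<infinity>" by (simp add: power_less_top_ennreal)
  finally show ?thesis .
qed

lemma emeasure_sqn_pos:
  assumes I: "finite I" "I \<noteq> {}"
  shows "0 < emeasure (PiM I (\<lambda>_. lborel)) {z \<in> space (PiM I (\<lambda>_. lborel)). 0 < sqn I z \<and> sqn I z < 1}"
proof -
  interpret product_sigma_finite "\<lambda>_. lborel :: real measure"
    by standard
  \<comment> \<open>If each of the card I coordinates lies in (0, c), with c at most 1, then each
    square is below c and their sum below 1.\<close>
  define c where "c = 1 / real (card I)"
  have cI: "card I > 0" using I by (simp add: card_gt_0_iff)
  then have c: "c > 0" "c \<le> 1" by (simp_all add: c_def field_simps Suc_le_eq)
  have sub: "Pi\<^sub>E I (\<lambda>_. {0<..<c}) \<subseteq> {z \<in> space (PiM I (\<lambda>_. lborel)). 0 < sqn I z \<and> sqn I z < 1}"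
  proof
    fix z assume z: "z \<in> Pi\<^sub>E I (\<lambda>_. {0<..<c})"
    then have zk: "0 < z k" "z k < c" if "k \<in> I" for k using that by (auto simp: PiE_def Pi_def)
    have "0 < sqn I z" unfolding sqn_def using I zk by (intro sum_pos) (auto simp: less_le)
    moreover have "sqn I z < (\<Sum>k\<in>I. c)"
      unfolding sqn_def
    proof (rule sum_strict_mono[OF I])
      fix k assume k: "k \<in> I"
      have "z k * z k < c * 1"
        using zk[OF k] c by (intro mult_strict_mono) auto
      then show "(z k)\<^sup>2 < c" by (simp add: power2_eq_square)
    qed
    ultimately show "z \<in> {z \<in> space (PiM I (\<lambda>_. lborel)). 0 < sqn I z \<and> sqn I z < 1}"
      using z cI by (auto simp: space_PiM PiE_def c_def)
  qed
  have "0 < ennreal (c ^ card I)"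
    using c by simp
  also have "\<dots> = (\<Prod>i\<in>I. emeasure lborel {0<..<c})"
    using c by (simp add: ennreal_power)
  also have "\<dots> = emeasure (PiM I (\<lambda>_. lborel)) (Pi\<^sub>E I (\<lambda>_. {0<..<c}))"
    by (rule emeasure_PiM[OF I(1), symmetric]) auto
  also have "\<dots> \<le> emeasure (PiM I (\<lambda>_. lborel)) {z \<in> space (PiM I (\<lambda>_. lborel)). 0 < sqn I z \<and> sqn I z < 1}"
    by (rule emeasure_mono[OF sub]) measurable
  finally show ?thesis .
qed

text \<open>Stands in for polar coordinates: for g constant on rays, the distribution of
  \<open>sqn I\<close> under the density g is a multiple of its distribution under the plain
  measure. By scaling this has to be compared on one ball only. The cross-multiplied form avoids
  dividing in \<open>ennreal\<close>.\<close>

lemma nn_integral_homogeneous_radial: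
  fixes I :: "'i set" and g :: "('i \<Rightarrow> real) \<Rightarrow> ennreal" and h :: "real \<Rightarrow> ennreal"
  defines "\<mu> \<equiv> PiM I (\<lambda>_. lborel :: real measure)"
  assumes I: "finite I" and g: "g \<in> borel_measurable \<mu>" and h: "h \<in> borel_measurable borel"
    and hom: "\<And>c z. c > 0 \<Longrightarrow> z \<in> space \<mu> \<Longrightarrow> g (\<lambda>k\<in>I. c * z k) = g z"
    and bdd: "\<And>z. g z \<le> K" "K < \<infinity>"
  shows "(\<integral>\<^sup>+z. g z * h (sqn I z) \<partial>\<mu>) * (\<integral>\<^sup>+z. indicator {..<1} (sqn I z) \<partial>\<mu>)
       = (\<integral>\<^sup>+z. g z * indicator {..<1} (sqn I z) \<partial>\<mu>) * (\<integral>\<^sup>+z. h (sqn I z) \<partial>\<mu>)"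
proof -
  define V where "V = (\<integral>\<^sup>+z. indicator {..<1} (sqn I z) \<partial>\<mu>)"
  define G where "G = (\<integral>\<^sup>+z. g z * indicator {..<1} (sqn I z) \<partial>\<mu>)"
  have [measurable]: "g \<in> borel_measurable \<mu>" "h \<in> borel_measurable borel" "sqn I \<in> borel_measurable \<mu>"
    using g h by (auto simp: \<mu>_def)
  have Vfin: "V < \<infinity>"
  proof -
    have "V \<le> (\<integral>\<^sup>+z. indicator {z \<in> space \<mu>. sqn I z \<le> 1} z \<partial>\<mu>)"
      unfolding V_def by (intro nn_integral_mono) (auto split: split_indicator)
    also have "\<dots> = emeasure \<mu> {z \<in> space \<mu>. sqn I z \<le> 1}" by simp
    also have "\<dots> < \<infinity>" unfolding \<mu>_def by (rule emeasure_sqn_le_finite[OF I])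
    finally show ?thesis .
  qed
  have Gfin: "G < \<infinity>"
  proof -
    have "G \<le> (\<integral>\<^sup>+z. K * indicator {..<1} (sqn I z) \<partial>\<mu>)"
      unfolding G_def by (intro nn_integral_mono mult_right_mono bdd) auto
    also have "\<dots> = K * V" unfolding V_def by (rule nn_integral_cmult) measurable
    also have "\<dots> < \<infinity>" using Vfin bdd by (simp add: ennreal_mult_less_top)
    finally show ?thesis .
  qed
  have scal: "(\<integral>\<^sup>+z. g' z * indicator {..<s} (sqn I z) \<partial>\<mu>)
      = ennreal (sqrt s) ^ card I * (\<integral>\<^sup>+z. g' z * indicator {..<1} (sqn I z) \<partial>\<mu>)"
    if s: "s > 0" and g': "g' \<in> borel_measurable \<mu>"
      "\<And>c z. c > 0 \<Longrightarrow> z \<in> space \<mu> \<Longrightarrow> g' (\<lambda>k\<in>I. c * z k) = g' z" for s and g' :: "('i \<Rightarrow> real) \<Rightarrow> ennreal"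
  proof -
    have [measurable]: "g' \<in> borel_measurable \<mu>" by fact
    have "(\<integral>\<^sup>+z. g' z * indicator {..<s} (sqn I z) \<partial>\<mu>) = ennreal (sqrt s) ^ card I *
       (\<integral>\<^sup>+z. g' (\<lambda>k\<in>I. sqrt s * z k) * indicator {..<s} (sqn I (\<lambda>k\<in>I. sqrt s * z k)) \<partial>\<mu>)"
      unfolding \<mu>_def using s by (intro PiM_lborel_scaling[OF I]) (auto simp flip: \<mu>_def)
    also have "(\<integral>\<^sup>+z. g' (\<lambda>k\<in>I. sqrt s * z k) * indicator {..<s} (sqn I (\<lambda>k\<in>I. sqrt s * z k)) \<partial>\<mu>)
       = (\<integral>\<^sup>+z. g' z * indicator {..<1} (sqn I z) \<partial>\<mu>)"
      using s by (intro nn_integral_cong) (auto simp: g'(2) sqn_scale split: split_indicator)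
    finally show ?thesis .
  qed
  \<comment> \<open>The minus sign turns balls into the half-lines {x<..} of the uniqueness
    criterion, which also requires them to have finite measure.\<close>
  define \<nu>1 where "\<nu>1 = distr (density \<mu> (\<lambda>z. V * g z)) borel (\<lambda>z. - sqn I z)"
  define \<nu>2 where "\<nu>2 = distr (density \<mu> (\<lambda>z. G)) borel (\<lambda>z. - sqn I z)"
  have em1: "emeasure \<nu>1 {x<..} = V * (\<integral>\<^sup>+z. g z * indicator {..<-x} (sqn I z) \<partial>\<mu>)" for x
  proof -
    have "emeasure \<nu>1 {x<..} = (\<integral>\<^sup>+z. V * g z * indicator ((\<lambda>z. - sqn I z) -` {x<..} \<inter> space \<mu>) z \<partial>\<mu>)"
      unfolding \<nu>1_def by (subst emeasure_distr) (auto simp: emeasure_density)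
    also have "\<dots> = (\<integral>\<^sup>+z. V * (g z * indicator {..<-x} (sqn I z)) \<partial>\<mu>)"
      by (intro nn_integral_cong) (auto split: split_indicator)
    also have "\<dots> = V * (\<integral>\<^sup>+z. g z * indicator {..<-x} (sqn I z) \<partial>\<mu>)"
      by (rule nn_integral_cmult) measurable
    finally show ?thesis .
  qed
  have em2: "emeasure \<nu>2 {x<..} = G * (\<integral>\<^sup>+z. 1 * indicator {..<-x} (sqn I z) \<partial>\<mu>)" for x
  proof -
    have "emeasure \<nu>2 {x<..} = (\<integral>\<^sup>+z. G * indicator ((\<lambda>z. - sqn I z) -` {x<..} \<inter> space \<mu>) z \<partial>\<mu>)"
      unfolding \<nu>2_def by (subst emeasure_distr) (auto simp: emeasure_density)
    also have "\<dots> = (\<integral>\<^sup>+z. G * (1 * indicator {..<-x} (sqn I z)) \<partial>\<mu>)"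
      by (intro nn_integral_cong) (auto split: split_indicator)
    also have "\<dots> = G * (\<integral>\<^sup>+z. 1 * indicator {..<-x} (sqn I z) \<partial>\<mu>)"
      by (rule nn_integral_cmult) measurable
    finally show ?thesis .
  qed
  have ind0: "indicator {..<-x} (sqn I z) = (0 :: ennreal)" if "\<not> x < 0" for x z
    using that sqn_nonneg[of I z] by simp
  have "\<nu>1 = \<nu>2"
  proof (rule measure_eqI_lessThan)
    fix x :: real
    show "emeasure \<nu>1 {x<..} < \<infinity>"
    proof (cases "x < 0")
      case True
      then show ?thesis
        unfolding em1 using scal[of "-x" g] hom Vfin Gfin
        by (simp add: G_def[symmetric] ennreal_mult_less_top power_less_top_ennreal)
    next
      case False
      then show ?thesis by (simp add: em1 ind0)
    qed
    show "emeasure \<nu>1 {x<..} = emeasure \<nu>2 {x<..}"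
    proof (cases "x < 0")
      case True
      then show ?thesis
        unfolding em1 em2 using scal[of "-x" g] scal[of "-x" "\<lambda>_. 1"] hom
        by (simp add: G_def[symmetric] V_def[symmetric] mult_ac)
    next
      case False
      then show ?thesis by (simp add: em1 em2 ind0)
    qed
  qed (simp_all add: \<nu>1_def \<nu>2_def)
  then have "(\<integral>\<^sup>+r. h (- r) \<partial>\<nu>1) = (\<integral>\<^sup>+r. h (- r) \<partial>\<nu>2)" by simp
  moreover have "(\<integral>\<^sup>+r. h (- r) \<partial>\<nu>1) = (\<integral>\<^sup>+z. V * (g z * h (sqn I z)) \<partial>\<mu>)"
    unfolding \<nu>1_def by (subst nn_integral_distr) (auto simp: nn_integral_density mult.assoc)
  moreover have "(\<integral>\<^sup>+r. h (- r) \<partial>\<nu>2) = (\<integral>\<^sup>+z. G * h (sqn I z) \<partial>\<mu>)"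
    unfolding \<nu>2_def by (subst nn_integral_distr) (auto simp: nn_integral_density)
  ultimately have "V * (\<integral>\<^sup>+z. g z * h (sqn I z) \<partial>\<mu>) = G * (\<integral>\<^sup>+z. h (sqn I z) \<partial>\<mu>)"
    by (simp add: nn_integral_cmult)
  then show ?thesis by (simp add: V_def G_def mult.commute)
qed

section \<open>Radial projection and the measure on the sphere\<close>

lemma finite_idx: "finite (idx \<delta> m)"
  by (simp add: idx_def)

lemma sqnorm_eq_sqn: "sqnorm \<delta> m = sqn (idx \<delta> m)"
  by (simp add: fun_eq_iff sqnorm_def sqn_def)

definition sphere_proj :: "'i set \<Rightarrow> ('i \<Rightarrow> real) \<Rightarrow> 'i \<Rightarrow> real" where
  "sphere_proj I z = (\<lambda>k\<in>I. z k / sqrt (sqn I z))"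

lemma sphere_proj_measurable [measurable]:
  "sphere_proj I \<in> measurable (PiM I (\<lambda>_. lborel)) (PiM I (\<lambda>_. lborel))"
  unfolding sphere_proj_def by measurable

lemma sphere_proj_scale:
  assumes "c > 0"
  shows "sphere_proj I (\<lambda>k\<in>I. c * z k) = sphere_proj I z"
  using assms unfolding sphere_proj_def sqn_scale by (auto simp: fun_eq_iff real_sqrt_mult)

lemma sqn_sphere_proj:
  assumes "0 < sqn I z"
  shows "sqn I (sphere_proj I z) = 1"
proof -
  have "(sphere_proj I z k)\<^sup>2 = (z k)\<^sup>2 / sqn I z" if "k \<in> I" for k
    using that sqn_nonneg[of I z] by (simp add: sphere_proj_def power_divide)
  then have "sqn I (sphere_proj I z) = (\<Sum>k\<in>I. (z k)\<^sup>2 / sqn I z)"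
    unfolding sqn_def[of I "sphere_proj I z"] by (intro sum.cong refl)
  also have "\<dots> = 1" using assms by (simp add: sqn_def flip: sum_divide_distrib)
  finally show ?thesis .
qed

lemma sphere_proj_coord_le:
  assumes "finite I" "k \<in> I"
  shows "\<bar>sphere_proj I z k\<bar> \<le> 1"
proof (cases "0 < sqn I z")
  case True
  have "(sphere_proj I z k)\<^sup>2 \<le> 1"
    using coord_square_le_sqn[OF assms, of "sphere_proj I z"] sqn_sphere_proj[OF True] by simp
  then show ?thesis by (simp add: abs_square_le_1)
next
  case False
  then have "sqn I z = 0" using sqn_nonneg[of I z] by linarith
  then show ?thesis using assms by (simp add: sphere_proj_def)
qed

lemma polyfun_bounded_on_cube:
  assumes "polyfun I f" "finite I"
  obtains K where "K \<ge> 0" "\<And>z. (\<And>k. k \<in> I \<Longrightarrow> \<bar>z k\<bar> \<le> 1) \<Longrightarrow> \<bar>f z\<bar> \<le> K"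
proof -
  obtain C n where C: "\<And>z. \<bar>f z\<bar> \<le> C * (\<Prod>k\<in>I. (1 + (z k)\<^sup>2) ^ n)"
    using polyfun_bound[OF assms] by blast
  have C0: "C \<ge> 0" using order.trans[OF abs_ge_zero C[of "\<lambda>_. 0"]] by simp
  show thesis
  proof (rule that[of "C * (\<Prod>k\<in>I. 2 ^ n)"])
    fix z :: "'a \<Rightarrow> real" assume z: "\<And>k. k \<in> I \<Longrightarrow> \<bar>z k\<bar> \<le> 1"
    have "(\<Prod>k\<in>I. (1 + (z k)\<^sup>2) ^ n) \<le> (\<Prod>k\<in>I. 2 ^ n)"
      using z by (intro prod_mono conjI power_mono) (auto simp: abs_square_le_1)
    then show "\<bar>f z\<bar> \<le> C * (\<Prod>k\<in>I. 2 ^ n)"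
      using C[of z] mult_left_mono[OF _ C0] order.trans by blast
  qed (use C0 in auto)
qed

context
  fixes \<delta> m :: nat and I :: "(nat \<times> nat) set" and \<mu> :: "(nat \<times> nat \<Rightarrow> real) measure"
    and B :: "(nat \<times> nat \<Rightarrow> real) set"
  defines "I \<equiv> idx \<delta> m" and "\<mu> \<equiv> eucl \<delta> m" and "B \<equiv> punct_ball \<delta> m"
  assumes pos: "\<delta> > 0" "m > 0"
begin

lemma ball_measure: "B \<in> sets \<mu>" "emeasure \<mu> B \<noteq> 0" "emeasure \<mu> B < \<infinity>"
proof -
  have mu: "\<mu> = PiM I (\<lambda>_. lborel)" by (simp add: \<mu>_def eucl_def I_def)
  have I: "finite I" "I \<noteq> {}" using pos by (auto simp: I_def idx_def)
  have Beq: "B = {z \<in> space \<mu>. 0 < sqn I z \<and> sqn I z \<le> 1}"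
    by (simp add: B_def punct_ball_def \<mu>_def I_def sqnorm_eq_sqn)
  show sets: "B \<in> sets \<mu>" unfolding Beq mu by measurable
  have "emeasure \<mu> {z \<in> space \<mu>. 0 < sqn I z \<and> sqn I z < 1} \<le> emeasure \<mu> B"
    by (rule emeasure_mono[OF _ sets]) (auto simp: Beq)
  then show "emeasure \<mu> B \<noteq> 0"
    using emeasure_sqn_pos[OF I] by (simp add: mu)
  have "emeasure \<mu> B \<le> emeasure \<mu> {z \<in> space \<mu>. sqn I z \<le> 1}"
    by (rule emeasure_mono) (auto simp: Beq mu)
  then show "emeasure \<mu> B < \<infinity>"
    using emeasure_sqn_le_finite[OF I(1)] by (simp add: mu)
qed

lemma sphere_proj_measurable_sphere:
  "sphere_proj I \<in> measurable (uniform_measure (restrict_space \<mu> B) B) (restrict_space \<mu> (sphere_K \<delta> m))"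
proof (rule measurable_restrict_space2)
  show "sphere_proj I \<in> space (uniform_measure (restrict_space \<mu> B) B) \<rightarrow> sphere_K \<delta> m"
  proof
    fix z assume "z \<in> space (uniform_measure (restrict_space \<mu> B) B)"
    then have "0 < sqn I z"
      by (auto simp: space_restrict_space B_def punct_ball_def sqnorm_eq_sqn I_def)
    then show "sphere_proj I z \<in> sphere_K \<delta> m"
      using sqn_sphere_proj[of I z]
      by (auto simp: sphere_K_def sqnorm_eq_sqn eucl_def space_PiM I_def sphere_proj_def)
  qed
  show "sphere_proj I \<in> measurable (uniform_measure (restrict_space \<mu> B) B) \<mu>"
    using measurable_restrict_space1[OF sphere_proj_measurable[of I], of B]
    by (simp add: \<mu>_def eucl_def I_def cong: measurable_cong_sets)
qed

lemma sigma_K_eq: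
  "sigma_K \<delta> m = distr (uniform_measure (restrict_space \<mu> B) B)
     (restrict_space \<mu> (sphere_K \<delta> m)) (sphere_proj I)"
  by (simp add: sigma_K_def sphere_proj_def[abs_def] sqnorm_eq_sqn \<mu>_def B_def I_def)

lemma space_sigma_K: "space (sigma_K \<delta> m) = sphere_K \<delta> m"
  by (auto simp: sigma_K_eq space_restrict_space sphere_K_def \<mu>_def)

lemma prob_space_sigma_K: "prob_space (sigma_K \<delta> m)"
  unfolding sigma_K_eq
proof (rule prob_space.prob_space_distr)
  have "emeasure (restrict_space \<mu> B) B = emeasure \<mu> B"
    using ball_measure(1) by (subst emeasure_restrict_space) auto
  then show "prob_space (uniform_measure (restrict_space \<mu> B) B)"
    using ball_measure by (intro prob_space_uniform_measure) auto
qed (rule sphere_proj_measurable_sphere)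

lemma borel_measurable_sigma_K:
  "f \<in> borel_measurable \<mu> \<Longrightarrow> f \<in> borel_measurable (sigma_K \<delta> m)"
proof -
  assume "f \<in> borel_measurable \<mu>"
  then have "f \<in> borel_measurable (restrict_space \<mu> (sphere_K \<delta> m))"
    by (rule measurable_restrict_space1)
  moreover have "sets (sigma_K \<delta> m) = sets (restrict_space \<mu> (sphere_K \<delta> m))"
    by (simp add: sigma_K_eq)
  ultimately show ?thesis using measurable_cong_sets by blast
qed

lemma nn_integral_sigma_K:
  assumes f: "f \<in> borel_measurable \<mu>"
  shows "(\<integral>\<^sup>+z. f z \<partial>sigma_K \<delta> m) = (\<integral>\<^sup>+z. f (sphere_proj I z) * indicator B z \<partial>\<mu>) / emeasure \<mu> B"
proof -
  have Bs: "B \<in> sets (restrict_space \<mu> B)" "B \<inter> space \<mu> \<in> sets \<mu>"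
    using ball_measure(1) by (auto simp: sets_restrict_space image_iff)
  have m[measurable]: "(\<lambda>z. f (sphere_proj I z)) \<in> borel_measurable \<mu>"
    using measurable_compose[OF sphere_proj_measurable[of I], of f borel] f
    by (simp add: \<mu>_def eucl_def I_def)
  have "(\<integral>\<^sup>+z. f z \<partial>sigma_K \<delta> m)
     = (\<integral>\<^sup>+z. f (sphere_proj I z) \<partial>uniform_measure (restrict_space \<mu> B) B)"
    using borel_measurable_sigma_K[OF f] unfolding sigma_K_eq
    by (intro nn_integral_distr sphere_proj_measurable_sphere)
  also have "\<dots> = (\<integral>\<^sup>+z. f (sphere_proj I z) * indicator B z \<partial>restrict_space \<mu> B)
      / emeasure (restrict_space \<mu> B) B"
    using Bs m by (intro nn_integral_uniform_measure measurable_restrict_space1)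
  also have "\<dots> = (\<integral>\<^sup>+z. f (sphere_proj I z) * indicator B z \<partial>\<mu>) / emeasure \<mu> B"
  proof -
    have "emeasure (restrict_space \<mu> B) B = emeasure \<mu> B"
      using ball_measure(1) by (subst emeasure_restrict_space) auto
    moreover have "(\<integral>\<^sup>+z. f (sphere_proj I z) * indicator B z \<partial>restrict_space \<mu> B)
        = (\<integral>\<^sup>+z. f (sphere_proj I z) * indicator B z \<partial>\<mu>)"
      using Bs(2) by (subst nn_integral_restrict_space) (auto intro!: nn_integral_cong split: split_indicator)
    ultimately show ?thesis by simp
  qed
  finally show ?thesis .
qed

lemma sphere_K_coord_le:
  assumes "z \<in> sphere_K \<delta> m" "k \<in> I"
  shows "\<bar>z k\<bar> \<le> 1"
  using coord_square_le_sqn[of I k z] assms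
  by (simp add: sphere_K_def sqnorm_eq_sqn I_def finite_idx flip: abs_square_le_1)

lemma polyfun_integrable_sigma_K:
  assumes "polyfun I f"
  shows "integrable (sigma_K \<delta> m) f"
proof -
  interpret prob_space "sigma_K \<delta> m" by (rule prob_space_sigma_K)
  obtain K where "\<And>z. (\<And>k. k \<in> I \<Longrightarrow> \<bar>z k\<bar> \<le> 1) \<Longrightarrow> \<bar>f z\<bar> \<le> K"
    using polyfun_bounded_on_cube[OF assms] finite_idx I_def by metis
  then have "AE z in sigma_K \<delta> m. norm (f z) \<le> K"
    using sphere_K_coord_le by (intro AE_I2) (simp add: space_sigma_K)
  then show ?thesis
    using polyfun_measurable[OF assms]
    by (intro integrable_const_bound borel_measurable_sigma_K) (auto simp: \<mu>_def eucl_def I_def)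
qed

lemma gauss_density_radial:
  "gauss_density I z = (1 / sqrt (2 * pi)) ^ card I * exp (- sqn I z / 2)"
proof -
  have "gauss_density I z = (\<Prod>k\<in>I. 1 / sqrt (2 * pi)) * (\<Prod>k\<in>I. exp (- (z k)\<^sup>2 / 2))"
    unfolding gauss_density_def std_normal_density_def prod.distrib ..
  also have "(\<Prod>k\<in>I. exp (- (z k)\<^sup>2 / 2)) = exp (- sqn I z / 2)"
    using finite_idx[of \<delta> m]
    by (simp add: I_def exp_sum[symmetric] sqn_def sum_negf sum_divide_distrib)
  finally show ?thesis by simp
qed

text \<open>Both sides are the integral of the angular part of \<open>f\<close> against a radial weight.\<close>

lemma sigma_K_homogeneous:
  assumes f: "polyfun I f" and hom: "\<And>c z. c > 0 \<Longrightarrow> f (\<lambda>k\<in>I. c * z k) = c ^ (2 * n) * f z"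
    and ext: "\<And>z. f (restrict z I) = f z"
  shows "(\<integral>z. f z \<partial>sigma_K \<delta> m) * gauss_expect I (\<lambda>z. sqn I z ^ n) = gauss_expect I f"
proof -
  interpret prob_space "sigma_K \<delta> m" by (rule prob_space_sigma_K)
  have mu: "\<mu> = PiM I (\<lambda>_. lborel)" by (simp add: \<mu>_def eucl_def I_def)
  have fin: "finite I" by (simp add: I_def finite_idx)
  obtain K where K: "K \<ge> 0" "\<And>z. (\<And>k. k \<in> I \<Longrightarrow> \<bar>z k\<bar> \<le> 1) \<Longrightarrow> \<bar>f z\<bar> \<le> K"
    using polyfun_bounded_on_cube[OF f fin] by metis
  \<comment> \<open>The part of f that depends on the direction only; adding K makes it nonnegative
    and keeps it bounded.\<close>
  define g where "g z = ennreal (f (sphere_proj I z) + K)" for z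
  define V where "V = (\<integral>\<^sup>+z. indicator {..<1} (sqn I z) \<partial>\<mu>)"
  define G where "G = (\<integral>\<^sup>+z. g z * indicator {..<1} (sqn I z) \<partial>\<mu>)"
  define w where "w r = r ^ n * ((1 / sqrt (2 * pi)) ^ card I * exp (- r / 2))" for r :: real
  have fm[measurable]: "f \<in> borel_measurable \<mu>" using polyfun_measurable[OF f] by (simp add: mu)
  have [measurable]: "sphere_proj I \<in> measurable \<mu> \<mu>" "sqn I \<in> borel_measurable \<mu>"
    by (simp_all add: mu)
  have gm[measurable]: "g \<in> borel_measurable \<mu>" unfolding g_def by measurable
  have fK: "\<bar>f (sphere_proj I z)\<bar> \<le> K" for z by (intro K sphere_proj_coord_le fin)
  have radial: "(\<integral>\<^sup>+z. g z * h (sqn I z) \<partial>\<mu>) * V = G * (\<integral>\<^sup>+z. h (sqn I z) \<partial>\<mu>)"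
    if "h \<in> borel_measurable borel" for h
    unfolding V_def G_def mu
  proof (rule nn_integral_homogeneous_radial[OF fin _ that])
    show "g z \<le> ennreal (2 * K)" for z using fK[of z] by (auto simp: g_def intro!: ennreal_leI)
    show "g (\<lambda>k\<in>I. c * z k) = g z" if "c > 0" for c z
      by (simp add: g_def sphere_proj_scale[OF that])
  qed (use gm in \<open>auto simp: mu\<close>)
  have Vpos: "V \<noteq> 0" "V < \<infinity>"
  proof -
    have ne: "I \<noteq> {}" using pos by (auto simp: I_def idx_def)
    have V: "V = emeasure \<mu> {z \<in> space \<mu>. sqn I z < 1}"
    proof -
      have "V = (\<integral>\<^sup>+z. indicator {z \<in> space \<mu>. sqn I z < 1} z \<partial>\<mu>)"
        unfolding V_def by (intro nn_integral_cong) (auto split: split_indicator)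
      then show ?thesis by simp
    qed
    have "emeasure \<mu> {z \<in> space \<mu>. 0 < sqn I z \<and> sqn I z < 1} \<le> V"
      unfolding V by (rule emeasure_mono) auto
    then show "V \<noteq> 0" using emeasure_sqn_pos[OF fin ne] by (simp add: mu)
    have "V \<le> emeasure \<mu> {z \<in> space \<mu>. sqn I z \<le> 1}"
      unfolding V by (rule emeasure_mono) auto
    then show "V < \<infinity>" using emeasure_sqn_le_finite[OF fin] by (simp add: mu)
  qed
  \<comment> \<open>First radial weight: the indicator of the punctured ball, which produces the
    cone measure.\<close>
  have 1: "(\<integral>\<^sup>+z. g z * indicator B z \<partial>\<mu>) * V = G * emeasure \<mu> B"
  proof -
    have B_ind: "indicator B z = (indicator {0<..1} (sqn I z) :: ennreal)" if "z \<in> space \<mu>" for z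
      using that by (auto simp: B_def punct_ball_def sqnorm_eq_sqn I_def \<mu>_def split: split_indicator)
    have "emeasure \<mu> B = (\<integral>\<^sup>+z. indicator {0<..1} (sqn I z) \<partial>\<mu>)"
    proof -
      have "(\<integral>\<^sup>+z. indicator {0<..1} (sqn I z) \<partial>\<mu>) = (\<integral>\<^sup>+z. indicator B z \<partial>\<mu>)"
        by (intro nn_integral_cong) (simp add: B_ind)
      then show ?thesis using ball_measure(1) by simp
    qed
    moreover have "(\<integral>\<^sup>+z. g z * indicator B z \<partial>\<mu>) = (\<integral>\<^sup>+z. g z * indicator {0<..1} (sqn I z) \<partial>\<mu>)"
      by (auto intro!: nn_integral_cong simp: B_ind)
    ultimately show ?thesis using radial[of "indicator {0<..1}"] by simp
  qed
  have pr: "polyfun I (\<lambda>z. sqn I z ^ n)"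
    unfolding sqn_def by (intro polyfun_intros)
  have w_eq: "w (sqn I z) = sqn I z ^ n * gauss_density I z" for z
    by (simp add: w_def gauss_density_radial)
  have w_nonneg: "0 \<le> w (sqn I z)" for z
    using gauss_density_pos[of I z] sqn_nonneg[of I z] by (simp add: w_eq)
  have fw: "f (sphere_proj I z) * w (sqn I z) = f z * gauss_density I z" for z
  proof (cases "0 < sqn I z")
    case True
    have "f z = f (\<lambda>k\<in>I. sqrt (sqn I z) * sphere_proj I z k)"
      unfolding ext[of z, symmetric] using True
      by (intro arg_cong[of _ _ f]) (auto simp: sphere_proj_def fun_eq_iff)
    also have "\<dots> = sqn I z ^ n * f (sphere_proj I z)"
      using True by (subst hom) (auto simp: power_mult)
    finally show ?thesis by (simp add: w_eq)
  next
    \<comment> \<open>At the origin the projection is the zero vector, as division by zero gives 0.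
      Homogeneity makes f vanish there unless n = 0, and in that case both sides agree.\<close>
    case False
    then have z0: "sqn I z = 0" using sqn_nonneg[of I z] by linarith
    then have zk: "z k = 0" if "k \<in> I" for k
      using coord_square_le_sqn[OF fin that, of z] by simp
    have sp: "sphere_proj I z = restrict z I"
      using zk by (auto simp: sphere_proj_def)
    have "f z = 2 ^ (2 * n) * f z"
    proof -
      have "f (\<lambda>k\<in>I. 2 * z k) = f (restrict z I)"
        using zk by (intro arg_cong[of _ _ f]) auto
      then show ?thesis using hom[of 2 z] by (simp add: ext)
    qed
    moreover have "(2 :: real) ^ (2 * n) \<noteq> 1" if "n \<noteq> 0"
      using one_less_power[of "2 :: real" "2 * n"] that by (metis less_irrefl nat_0_less_mult_iff one_less_numeral_iff semiring_norm(76) zero_less_numeral neq0_conv)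
    ultimately have "f z = 0 \<or> n = 0" by (metis mult_cancel_right1)
    then show ?thesis using sp by (auto simp: ext w_eq)
  qed
  \<comment> \<open>Second radial weight: \<open>sqn I z ^ n\<close> times the Gaussian density; the
    power restores the degree of f.\<close>
  have 2: "(\<integral>\<^sup>+z. g z * ennreal (w (sqn I z)) \<partial>\<mu>) * V = G * ennreal (gauss_expect I (\<lambda>z. sqn I z ^ n))"
  proof -
    have "(\<integral>\<^sup>+z. ennreal (w (sqn I z)) \<partial>\<mu>) = ennreal (gauss_expect I (\<lambda>z. sqn I z ^ n))"
      unfolding gauss_expect_def mu w_eq
      using polyfun_gauss_integrable[OF pr fin] w_nonneg by (intro nn_integral_eq_integral) (auto simp: w_eq)
    moreover have "(\<lambda>r. ennreal (w r)) \<in> borel_measurable borel" unfolding w_def by measurable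
    ultimately show ?thesis using radial[of "\<lambda>r. ennreal (w r)"] by simp
  qed
  have 3: "(\<integral>\<^sup>+z. g z * ennreal (w (sqn I z)) \<partial>\<mu>)
      = ennreal (gauss_expect I f + K * gauss_expect I (\<lambda>z. sqn I z ^ n))"
  proof -
    have "g z * ennreal (w (sqn I z)) = ennreal ((f z + K * sqn I z ^ n) * gauss_density I z)" for z
    proof -
      have "g z * ennreal (w (sqn I z)) = ennreal ((f (sphere_proj I z) + K) * w (sqn I z))"
        unfolding g_def using fK[of z] w_nonneg by (intro ennreal_mult[symmetric]) auto
      then show ?thesis by (simp add: distrib_right fw) (simp add: w_eq mult.assoc)
    qed
    then have "(\<integral>\<^sup>+z. g z * ennreal (w (sqn I z)) \<partial>\<mu>)
        = (\<integral>\<^sup>+z. ennreal ((f z + K * sqn I z ^ n) * gauss_density I z) \<partial>\<mu>)" by simp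
    also have "\<dots> = ennreal (gauss_expect I (\<lambda>z. f z + K * sqn I z ^ n))"
      unfolding gauss_expect_def mu
    proof (rule nn_integral_eq_integral)
      show "integrable (PiM I (\<lambda>_. lborel)) (\<lambda>z. (f z + K * sqn I z ^ n) * gauss_density I z)"
        by (intro polyfun_gauss_integrable polyfun_intros f pr fin)
      have "0 \<le> (f z + K * sqn I z ^ n) * gauss_density I z" for z
      proof -
        have "(f z + K * sqn I z ^ n) * gauss_density I z = (f (sphere_proj I z) + K) * w (sqn I z)"
          by (simp add: distrib_right fw) (simp add: w_eq mult.assoc)
        also have "0 \<le> \<dots>" using fK[of z] w_nonneg by (intro mult_nonneg_nonneg) auto
        finally show ?thesis .
      qed
      then show "AE z in PiM I (\<lambda>_. lborel). 0 \<le> (f z + K * sqn I z ^ n) * gauss_density I z" by simp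
    qed
    also have "gauss_expect I (\<lambda>z. f z + K * sqn I z ^ n) = gauss_expect I f + K * gauss_expect I (\<lambda>z. sqn I z ^ n)"
      by (subst gauss_expect_add) (auto intro!: polyfun_intros f pr fin simp: gauss_expect_cmult)
    finally show ?thesis .
  qed
  define E where "E = gauss_expect I (\<lambda>z. sqn I z ^ n)"
  have E0: "E \<ge> 0"
    unfolding E_def gauss_expect_def using w_nonneg by (intro integral_nonneg_AE) (auto simp: w_eq)
  have int: "integrable (sigma_K \<delta> m) f" by (rule polyfun_integrable_sigma_K[OF f])
  have fS: "0 \<le> f z + K" if "z \<in> space (sigma_K \<delta> m)" for z
    using K(2)[of z] sphere_K_coord_le[of z] that by (force simp: space_sigma_K)
  have 4: "(\<integral>\<^sup>+z. ennreal (f z + K) \<partial>sigma_K \<delta> m) = ennreal ((\<integral>z. f z \<partial>sigma_K \<delta> m) + K)"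
    using int fS by (subst nn_integral_eq_integral) (auto simp: prob_space)
  have 5: "ennreal ((\<integral>z. f z \<partial>sigma_K \<delta> m) + K) * emeasure \<mu> B = (\<integral>\<^sup>+z. g z * indicator B z \<partial>\<mu>)"
  proof -
    have "emeasure \<mu> B / emeasure \<mu> B = 1"
      using ball_measure mult_divide_eq_ennreal[of "emeasure \<mu> B" 1] by (simp add: less_top)
    then show ?thesis
      unfolding 4[symmetric] g_def
      by (subst nn_integral_sigma_K) (measurable, simp add: ennreal_divide_times)
  qed
  \<comment> \<open>Both radial relations contain G and V. Eliminating G and cancelling V and the
    volume of the ball leaves the claim for f shifted by K.\<close>
  have "ennreal ((\<integral>z. f z \<partial>sigma_K \<delta> m) + K) * ennreal E * (emeasure \<mu> B * V)
      = ennreal (gauss_expect I f + K * E) * (emeasure \<mu> B * V)"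
  proof -
    have "ennreal ((\<integral>z. f z \<partial>sigma_K \<delta> m) + K) * ennreal E * (emeasure \<mu> B * V)
        = (ennreal ((\<integral>z. f z \<partial>sigma_K \<delta> m) + K) * emeasure \<mu> B) * V * ennreal E" by (simp add: mult_ac)
    also have "\<dots> = G * emeasure \<mu> B * ennreal E" unfolding 5 1 ..
    also have "\<dots> = (G * ennreal E) * emeasure \<mu> B" by (simp add: mult_ac)
    also have "\<dots> = ennreal (gauss_expect I f + K * E) * V * emeasure \<mu> B"
      unfolding E_def 2[symmetric] 3 ..
    finally show ?thesis by (simp add: mult_ac)
  qed
  then have "ennreal ((\<integral>z. f z \<partial>sigma_K \<delta> m) + K) * ennreal E = ennreal (gauss_expect I f + K * E)"
    using Vpos ball_measure unfolding mult.commute[of _ "emeasure \<mu> B * V"] ennreal_mult_cancel_left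
    by (auto simp: ennreal_mult_eq_top_iff less_top)
  moreover have "0 \<le> (\<integral>z. f z \<partial>sigma_K \<delta> m) + K"
  proof -
    have "0 \<le> (\<integral>z. f z + K \<partial>sigma_K \<delta> m)" using fS by (intro integral_nonneg_AE AE_I2)
    then show ?thesis using int by (simp add: prob_space)
  qed
  moreover have "0 \<le> gauss_expect I f + K * E"
  proof -
    have "0 \<le> (\<integral>z. (f (sphere_proj I z) + K) * w (sqn I z) \<partial>\<mu>)"
    proof (intro integral_nonneg_AE AE_I2 mult_nonneg_nonneg)
      show "0 \<le> f (sphere_proj I z) + K" for z using fK[of z] by linarith
    qed (rule w_nonneg)
    also have "\<dots> = gauss_expect I (\<lambda>z. f z + K * sqn I z ^ n)"
      unfolding gauss_expect_def mu
      by (intro Bochner_Integration.integral_cong refl) (simp add: distrib_right fw, simp add: w_eq mult.assoc)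
    also have "\<dots> = gauss_expect I f + K * E"
      unfolding E_def by (subst gauss_expect_add) (auto intro!: polyfun_intros f pr fin simp: gauss_expect_cmult)
    finally show ?thesis .
  qed
  ultimately have "((\<integral>z. f z \<partial>sigma_K \<delta> m) + K) * E = gauss_expect I f + K * E"
    using E0 by (simp add: ennreal_mult[symmetric])
  then show ?thesis by (simp add: E_def algebra_simps)
qed

end

section \<open>The incomplete Beta integral\<close>

text \<open>Up to the factor (a + 1)/(a + 1 + k) these are the coefficients of (1 - z)^b; the factor
  is what integrating z^a (1 - z)^b term by term produces.\<close>

lemma hyp2F1_coeff:
  fixes a b :: real
  assumes "a > -1"
  shows "pochhammer (- b) k * pochhammer (a + 1) k / (pochhammer (a + 2) k * fact k)
    = (a + 1) / (a + 1 + real k) * ((-1) ^ k * (b gchoose k))"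
proof -
  have "(a + 1) * pochhammer (a + 2) k = pochhammer (a + 1) k * (a + 1 + real k)"
    using pochhammer_rec[of "a + 1" k] pochhammer_Suc[of "a + 1" k] by (simp add: add_ac)
  moreover have "pochhammer (a + 2) k > 0" "a + 1 + real k > 0"
    using assms by (auto intro!: pochhammer_pos)
  ultimately have "pochhammer (a + 1) k / pochhammer (a + 2) k = (a + 1) / (a + 1 + real k)"
    by (simp add: field_simps)
  moreover have "pochhammer (- b) k / fact k = (-1) ^ k * (b gchoose k)"
    by (simp add: gbinomial_pochhammer)
  ultimately show ?thesis
    by (metis times_divide_times_eq mult.commute)
qed

text \<open>Comparing coefficients gives (a + 1) H + z H' = (a + 1) (1 - z)^b for the hypergeometric
  series H. Multiplied by z^a / (a + 1), the left side is the derivative of z^(a+1) H / (a + 1).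
  Continuity at 0 is recorded for the endpoint of the integral.\<close>

lemma incomplete_beta_has_derivative:
  fixes a b z :: real
  assumes a: "a > -1" and z: "0 < z" "z < 1"
  shows "((\<lambda>z. z powr (a + 1) / (a + 1) * hyp2F1 (- b) (a + 1) (a + 2) z)
     has_real_derivative z powr a * (1 - z) powr b) (at z)"
    and "isCont (hyp2F1 (- b) (a + 1) (a + 2)) 0" and "isCont (hyp2F1 (- b) (a + 1) (a + 2)) z"
proof -
  define c where "c k = (-1) ^ k * (b gchoose k)" for k
  define h where "h k = (a + 1) / (a + 1 + real k) * c k" for k
  have hyp: "hyp2F1 (- b) (a + 1) (a + 2) = (\<lambda>z. \<Sum>k. h k * z ^ k)"
    unfolding hyp2F1_def h_def c_def hyp2F1_coeff[OF a] ..
  have csum: "(\<lambda>k. c k * x ^ k) sums (1 - x) powr b" if "\<bar>x\<bar> < 1" for x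
    using gen_binomial_real[of "- x" b] that
    by (simp add: c_def power_minus[of x] mult_ac)
  have hsum: "summable (\<lambda>k. h k * x ^ k)" if x: "\<bar>x\<bar> < 1" for x
  proof -
    obtain y where y: "\<bar>x\<bar> < y" "y < 1" using dense[OF x] by blast
    have "summable (\<lambda>k. norm (c k * x ^ k))"
      using powser_insidea[of c y x] csum[of y] y by (auto simp: sums_iff)
    then show ?thesis
    proof (rule summable_comparison_test_ev[rotated])
      have "norm (h k * x ^ k) \<le> norm (c k * x ^ k)" for k
      proof -
        have "\<bar>(a + 1) / (a + 1 + real k)\<bar> * (\<bar>c k\<bar> * \<bar>x ^ k\<bar>) \<le> 1 * (\<bar>c k\<bar> * \<bar>x ^ k\<bar>)"
          using a by (intro mult_right_mono) (auto simp: field_simps)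
        then show ?thesis by (simp add: h_def abs_mult mult.assoc)
      qed
      then show "\<forall>\<^sub>F k in sequentially. norm (h k * x ^ k) \<le> norm (c k * x ^ k)" by simp
    qed
  qed
  define H where "H x = (\<Sum>k. h k * x ^ k)" for x
  have dH: "(H has_real_derivative (\<Sum>k. diffs h k * x ^ k)) (at x)" if "\<bar>x\<bar> < 1" for x
    unfolding H_def using termdiffs_strong'[of 1 h x] hsum that by simp
  show "isCont (hyp2F1 (- b) (a + 1) (a + 2)) 0" "isCont (hyp2F1 (- b) (a + 1) (a + 2)) z"
    using DERIV_isCont[OF dH] z unfolding hyp H_def by auto
  have dsum: "summable (\<lambda>k. diffs h k * z ^ k)"
    using termdiff_converges[of z 1 h] hsum z by simp
  have "(\<lambda>k. real (Suc k) * h (Suc k) * z ^ Suc k) sums (z * (\<Sum>k. diffs h k * z ^ k))"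
    using sums_mult[OF summable_sums[OF dsum], of z] by (simp add: diffs_def mult_ac)
  then have "(\<lambda>k. real k * h k * z ^ k) sums (z * (\<Sum>k. diffs h k * z ^ k))"
    by (subst (asm) sums_Suc_iff) simp
  then have "(\<lambda>k. (a + 1) * (h k * z ^ k) + real k * h k * z ^ k) sums
      ((a + 1) * H z + z * (\<Sum>k. diffs h k * z ^ k))"
    unfolding H_def using hsum[of z] z by (intro sums_add sums_mult summable_sums) auto
  moreover have "(a + 1) * (h k * z ^ k) + real k * h k * z ^ k = (a + 1) * (c k * z ^ k)" for k
  proof -
    have "(a + 1) * (h k * z ^ k) + real k * h k * z ^ k = (a + 1 + real k) * h k * z ^ k"
      by (simp add: algebra_simps)
    also have "(a + 1 + real k) * h k = (a + 1) * c k"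
      using a by (simp add: h_def)
    finally show ?thesis by simp
  qed
  moreover have "(\<lambda>k. (a + 1) * (c k * z ^ k)) sums ((a + 1) * (1 - z) powr b)"
    using csum[of z] z by (intro sums_mult) auto
  ultimately have eq: "(a + 1) * H z + z * (\<Sum>k. diffs h k * z ^ k) = (a + 1) * (1 - z) powr b"
    by (simp add: sums_unique2)
  have "((\<lambda>z. z powr (a + 1) / (a + 1) * H z) has_real_derivative
      z powr a * H z + z powr (a + 1) / (a + 1) * (\<Sum>k. diffs h k * z ^ k)) (at z)"
  proof -
    have "((\<lambda>z. z powr (a + 1)) has_real_derivative (a + 1) * z powr (a + 1 - 1)) (at z)"
      using z by (intro has_real_derivative_powr) auto
    from DERIV_cdivide[OF this, of "a + 1"]
    have "((\<lambda>z. z powr (a + 1) / (a + 1)) has_real_derivative z powr a) (at z)" using a by simp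
    from DERIV_mult[OF this dH[of z]] show ?thesis using z by (simp add: mult.commute add.commute)
  qed
  moreover have "z powr a * H z + z powr (a + 1) / (a + 1) * (\<Sum>k. diffs h k * z ^ k)
      = z powr a * (1 - z) powr b"
  proof -
    have "z powr a * H z + z powr (a + 1) / (a + 1) * (\<Sum>k. diffs h k * z ^ k)
       = z powr a / (a + 1) * ((a + 1) * H z + z * (\<Sum>k. diffs h k * z ^ k))"
      using a z by (simp add: powr_add field_simps)
    then show ?thesis using a by (simp only: eq) simp
  qed
  ultimately show "((\<lambda>z. z powr (a + 1) / (a + 1) * hyp2F1 (- b) (a + 1) (a + 2) z)
     has_real_derivative z powr a * (1 - z) powr b) (at z)"
    by (simp add: hyp H_def)
qed

text \<open>After the reflection z = 1 - u, the fundamental theorem is applied with derivatives in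
  the open interval only, since for a < 0 the integrand is unbounded near u = 1.\<close>

lemma incomplete_beta_has_integral:
  fixes a b \<tau> :: real
  assumes a: "a > -1" and \<tau>: "0 < \<tau>" "\<tau> < 1"
  defines "X \<equiv> (1 - \<tau>) powr (a + 1) / (a + 1) * hyp2F1 (- b) (a + 1) (a + 2) (1 - \<tau>)"
  shows "((\<lambda>u. u powr b * (1 - u) powr a) has_integral X) {\<tau>..1}" and "X > 0"
proof -
  define G where "G z = z powr (a + 1) / (a + 1) * hyp2F1 (- b) (a + 1) (a + 2) z" for z
  have "isCont (hyp2F1 (- b) (a + 1) (a + 2)) z" if "z \<in> {0..1 - \<tau>}" for z
    using incomplete_beta_has_derivative(3)[OF a, of z b] incomplete_beta_has_derivative(2)[OF a \<tau>]
      that \<tau> by (cases "z = 0") auto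
  then have "continuous_on {0..1 - \<tau>} (hyp2F1 (- b) (a + 1) (a + 2))"
    by (auto intro: continuous_at_imp_continuous_on)
  moreover have "continuous_on {0..1 - \<tau>} (\<lambda>z. z powr (a + 1))"
    using a by (intro continuous_on_powr' continuous_intros) auto
  ultimately have "continuous_on {0..1 - \<tau>} G"
    unfolding G_def using a by (intro continuous_on_mult continuous_on_divide continuous_on_const) auto
  then have "continuous_on {\<tau>..1} (\<lambda>u. G (1 - u))"
    by (rule continuous_on_compose2[where f = "\<lambda>u. 1 - u"]) (auto intro!: continuous_intros)
  then have cont: "continuous_on {\<tau>..1} (\<lambda>u. - G (1 - u))"
    by (rule continuous_on_minus)
  have deriv: "((\<lambda>u. - G (1 - u)) has_real_derivative (u powr b * (1 - u) powr a)) (at u)"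
    if u: "\<tau> < u" "u < 1" for u
  proof -
    have "(G has_real_derivative (1 - u) powr a * (1 - (1 - u)) powr b) (at (1 - u))"
      unfolding G_def using u \<tau> by (intro incomplete_beta_has_derivative(1)[OF a]) auto
    then have "((\<lambda>u. G (1 - u)) has_real_derivative ((1 - u) powr a * u powr b) * (- 1)) (at u)"
      by (intro DERIV_chain2[where g = "\<lambda>u. 1 - u"]) (auto intro!: derivative_eq_intros)
    then show ?thesis
      by (auto dest: DERIV_minus simp: mult.commute)
  qed
  have ends: "- G (1 - 1) = 0" "- G (1 - \<tau>) = - X"
    using a by (simp_all add: G_def X_def)
  have "((\<lambda>u. u powr b * (1 - u) powr a) has_integral ((- G (1 - 1)) - (- G (1 - \<tau>)))) {\<tau>..1}"
    using \<tau> cont deriv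
    by (intro fundamental_theorem_of_calculus_interior)
       (auto simp flip: has_real_derivative_iff_has_vector_derivative)
  then show "((\<lambda>u. u powr b * (1 - u) powr a) has_integral X) {\<tau>..1}"
    unfolding ends by simp
  have "- G (1 - \<tau>) < - G (1 - 1)"
    using \<tau> deriv
    by (intro DERIV_pos_imp_increasing_open[OF \<tau>(2) _ cont]) (metis less_trans mult_pos_pos powr_gt_zero
        diff_gt_0_iff_gt less_irrefl)
  then show "X > 0" unfolding ends by simp
qed

section \<open>Zonal polynomials and cubature formulas\<close>

lemma finite_exps: "finite (exps \<delta> m p)"
  by (rule finite_subset[of _ "PiE (idx \<delta> m) (\<lambda>_. {..p})"]) (auto simp: exps_def finite_idx intro!: finite_PiE)

lemma homog_poly_add:
  assumes "homog_poly \<delta> m p f" "homog_poly \<delta> m p g"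
  shows "homog_poly \<delta> m p (\<lambda>y. f y + g y)"
proof -
  obtain c d where "\<And>y. f y = (\<Sum>a\<in>exps \<delta> m p. c a * (\<Prod>k\<in>idx \<delta> m. complex_of_real (y k) ^ a k))"
    "\<And>y. g y = (\<Sum>a\<in>exps \<delta> m p. d a * (\<Prod>k\<in>idx \<delta> m. complex_of_real (y k) ^ a k))"
    using assms unfolding homog_poly_def by blast
  then show ?thesis
    unfolding homog_poly_def by (intro exI[of _ "\<lambda>a. c a + d a"]) (simp add: sum.distrib distrib_right)
qed

lemma homog_poly_cmult:
  assumes "homog_poly \<delta> m p f"
  shows "homog_poly \<delta> m p (\<lambda>y. e * f y)"
proof -
  obtain c where "\<And>y. f y = (\<Sum>a\<in>exps \<delta> m p. c a * (\<Prod>k\<in>idx \<delta> m. complex_of_real (y k) ^ a k))"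
    using assms unfolding homog_poly_def by blast
  then show ?thesis
    unfolding homog_poly_def by (intro exI[of _ "\<lambda>a. e * c a"]) (simp add: sum_distrib_left mult.assoc)
qed

lemma homog_poly_sum:
  "(\<And>i. i \<in> A \<Longrightarrow> homog_poly \<delta> m p (f i)) \<Longrightarrow> homog_poly \<delta> m p (\<lambda>y. \<Sum>i\<in>A. f i y)"
proof (induction A rule: infinite_finite_induct)
  case (insert i A)
  then show ?case by (simp add: homog_poly_add)
qed (auto simp: homog_poly_def intro!: exI[of _ "\<lambda>_. 0"])

lemma homog_poly_monomial:
  assumes "a \<in> exps \<delta> m p"
  shows "homog_poly \<delta> m p (\<lambda>y. \<Prod>k\<in>idx \<delta> m. complex_of_real (y k) ^ a k)"
  unfolding homog_poly_def
proof (intro exI[of _ "\<lambda>a'. if a' = a then 1 else 0"] allI)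
  fix y
  have "(\<Sum>a'\<in>exps \<delta> m p. (if a' = a then 1 else 0) * (\<Prod>k\<in>idx \<delta> m. complex_of_real (y k) ^ a' k))
    = (\<Sum>a'\<in>exps \<delta> m p. if a' = a then (\<Prod>k\<in>idx \<delta> m. complex_of_real (y k) ^ a' k) else 0)"
    by (intro sum.cong) auto
  then show "(\<Prod>k\<in>idx \<delta> m. complex_of_real (y k) ^ a k)
    = (\<Sum>a'\<in>exps \<delta> m p. (if a' = a then 1 else 0) * (\<Prod>k\<in>idx \<delta> m. complex_of_real (y k) ^ a' k))"
    using assms by (simp add: finite_exps)
qed

lemma homog_poly_mult:
  assumes "homog_poly \<delta> m p f" "homog_poly \<delta> m q g"
  shows "homog_poly \<delta> m (p + q) (\<lambda>y. f y * g y)"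
proof -
  obtain c d where f: "\<And>y. f y = (\<Sum>a\<in>exps \<delta> m p. c a * (\<Prod>k\<in>idx \<delta> m. complex_of_real (y k) ^ a k))"
    and g: "\<And>y. g y = (\<Sum>a\<in>exps \<delta> m q. d a * (\<Prod>k\<in>idx \<delta> m. complex_of_real (y k) ^ a k))"
    using assms unfolding homog_poly_def by blast
  define s where "s a b = (\<lambda>k\<in>idx \<delta> m. a k + b k)" for a b :: "nat \<times> nat \<Rightarrow> nat"
  have s: "s a b \<in> exps \<delta> m (p + q)" if "a \<in> exps \<delta> m p" "b \<in> exps \<delta> m q" for a b
    using that by (fastforce simp: s_def exps_def PiE_def Pi_def sum.distrib intro: add_mono)
  have "homog_poly \<delta> m (p + q) (\<lambda>y. \<Sum>a\<in>exps \<delta> m p. \<Sum>b\<in>exps \<delta> m q. (c a * d b) *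
      (\<Prod>k\<in>idx \<delta> m. complex_of_real (y k) ^ s a b k))"
    by (intro homog_poly_sum homog_poly_cmult homog_poly_monomial s)
  moreover have "f y * g y = (\<Sum>a\<in>exps \<delta> m p. \<Sum>b\<in>exps \<delta> m q. (c a * d b) *
      (\<Prod>k\<in>idx \<delta> m. complex_of_real (y k) ^ s a b k))" for y
    unfolding f g sum_product by (intro sum.cong refl) (simp add: s_def power_add prod.distrib mult_ac)
  ultimately show ?thesis by simp
qed

lemma homog_poly_const: "homog_poly \<delta> m 0 (\<lambda>y. c)"
proof -
  have "(\<lambda>k\<in>idx \<delta> m. 0) \<in> exps \<delta> m 0" by (simp add: exps_def PiE_def)
  from homog_poly_cmult[OF homog_poly_monomial[OF this], of c] show ?thesis by simp
qed

lemma homog_poly_power: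
  "homog_poly \<delta> m p f \<Longrightarrow> homog_poly \<delta> m (p * n) (\<lambda>y. f y ^ n)"
proof (induction n)
  case 0
  then show ?case by (simp add: homog_poly_const)
next
  case (Suc n)
  then show ?case using homog_poly_mult[of \<delta> m p f "p * n" "\<lambda>y. f y ^ n"] by simp
qed

lemma homog_poly_linform: "homog_poly \<delta> m 1 (\<lambda>y. complex_of_real (linform (idx \<delta> m) a y))"
proof -
  have e: "(\<lambda>j\<in>idx \<delta> m. if j = k then 1 else 0) \<in> exps \<delta> m 1" if "k \<in> idx \<delta> m" for k
    using that by (auto simp: exps_def PiE_def finite_idx)
  have "homog_poly \<delta> m 1 (\<lambda>y. \<Sum>k\<in>idx \<delta> m. complex_of_real (a k) *
      (\<Prod>j\<in>idx \<delta> m. complex_of_real (y j) ^ (\<lambda>j\<in>idx \<delta> m. if j = k then 1 else 0) j))"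
    by (intro homog_poly_sum homog_poly_cmult homog_poly_monomial e)
  moreover have "(\<Prod>j\<in>idx \<delta> m. complex_of_real (y j) ^ (\<lambda>j\<in>idx \<delta> m. if j = k then 1 else 0) j)
      = complex_of_real (y k)" if "k \<in> idx \<delta> m" for y k
  proof -
    have "(\<Prod>j\<in>idx \<delta> m. complex_of_real (y j) ^ (\<lambda>j\<in>idx \<delta> m. if j = k then 1 else 0) j)
      = (\<Prod>j\<in>idx \<delta> m. if j = k then complex_of_real (y j) else 1)"
      by (intro prod.cong) auto
    then show ?thesis using that by (simp add: finite_idx)
  qed
  ultimately show ?thesis by (simp add: linform_def cong: sum.cong)
qed

lemma homog_poly_quadform:
  "homog_poly \<delta> m 2 (\<lambda>y. complex_of_real (quadform (idx \<delta> m) d a y))"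
  using homog_poly_sum[of "{..<d}" \<delta> m 2 "\<lambda>j y. complex_of_real (linform (idx \<delta> m) (a j) y) ^ 2"]
    homog_poly_power[OF homog_poly_linform, of \<delta> m 2]
  by (simp add: quadform_def)

lemma homog_poly_sqn: "homog_poly \<delta> m 2 (\<lambda>y. complex_of_real (sqn (idx \<delta> m) y))"
proof -
  have "linform (idx \<delta> m) (\<lambda>j. if j = k then 1 else 0) y = y k" if "k \<in> idx \<delta> m" for k y
    using that by (simp add: linform_def finite_idx if_distrib[of "\<lambda>x. x * _"] cong: if_cong)
  then have eq: "(\<Sum>k\<in>idx \<delta> m. complex_of_real (linform (idx \<delta> m) (\<lambda>j. if j = k then 1 else 0) y) ^ 2)
      = complex_of_real (sqn (idx \<delta> m) y)" for y
    by (simp add: sqn_def)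
  have "homog_poly \<delta> m 2 (\<lambda>y. \<Sum>k\<in>idx \<delta> m.
      complex_of_real (linform (idx \<delta> m) (\<lambda>j. if j = k then 1 else 0) y) ^ 2)"
    using homog_poly_power[OF homog_poly_linform, of \<delta> m 2] by (intro homog_poly_sum) simp
  then show ?thesis unfolding eq .
qed

section \<open>The K-valued inner product in real coordinates\<close>

definition unit_vec :: "nat \<Rightarrow> nat \<Rightarrow> real" where
  "unit_vec j = (\<lambda>k. if k = j then 1 else 0)"

text \<open>With \<open>e\<^sub>j\<close> the units of K, the \<open>j\<close>-th real component of the K-valued inner product
  \<open>(x, z)\<close> is the real inner product of \<open>x e\<^sub>j\<close> with \<open>z\<close>; hence \<open>|(x, z)|\<^sup>2\<close>
  is \<open>quadform (idx \<delta> m) \<delta> (frame \<delta> m x) z\<close>.\<close>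

definition frame :: "nat \<Rightarrow> nat \<Rightarrow> (nat \<times> nat \<Rightarrow> real) \<Rightarrow> nat \<Rightarrow> nat \<times> nat \<Rightarrow> real" where
  "frame \<delta> m x j = rmult \<delta> m x (unit_vec j)"

text \<open>\<open>qmul\<close> reads four components; padding with zeros embeds K into the
  quaternions, as \<open>rmult\<close> does.\<close>

definition pad :: "nat \<Rightarrow> (nat \<Rightarrow> real) \<Rightarrow> nat \<Rightarrow> real" where
  "pad \<delta> w = (\<lambda>k. if k < \<delta> then w k else 0)"

lemma less_2_cases_nat: "i < 2 \<longleftrightarrow> i = 0 \<or> i = (1::nat)" by auto

lemma less_4_cases_nat: "i < 4 \<longleftrightarrow> i = 0 \<or> i = 1 \<or> i = 2 \<or> i = (3::nat)" by auto

lemma sum_lessThan_4: "(\<Sum>k<4. f k) = f 0 + f 1 + f 2 + f (3::nat)" for f :: "nat \<Rightarrow> real"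
  by (simp add: eval_nat_numeral)

lemma sum_lessThan_2: "(\<Sum>k<2. f k) = f 0 + f (1::nat)" for f :: "nat \<Rightarrow> real"
  by (simp add: eval_nat_numeral)

text \<open>Right multiplication by the units sends w to mutually orthogonal vectors of its own
  length; checked in coordinates for each \<delta>.\<close>

lemma qmul_frame_orthogonal:
  assumes "\<delta> \<in> {1, 2, 4}" "i < \<delta>" "j < \<delta>"
  shows "(\<Sum>k<\<delta>. qmul (pad \<delta> w) (unit_vec i) k * qmul (pad \<delta> w) (unit_vec j) k)
    = (if i = j then (\<Sum>k<\<delta>. (w k)\<^sup>2) else 0)"
  using assms
  by (auto simp: less_2_cases_nat less_4_cases_nat sum_lessThan_4 sum_lessThan_2 qmul_def unit_vec_def
      pad_def power2_eq_square)

text \<open>The transpose of right multiplication by a unit is right multiplication by its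
  conjugate, which is a change of sign except for e_0 = 1.\<close>

lemma qmul_frame_adjoint:
  assumes "\<delta> \<in> {1, 2, 4}" "j < \<delta>"
  shows "(\<Sum>k<\<delta>. qmul (pad \<delta> w) (unit_vec j) k * v k)
    = (if j = 0 then 1 else - 1) * (\<Sum>k<\<delta>. qmul (pad \<delta> v) (unit_vec j) k * w k)"
  using assms
  by (auto simp: less_2_cases_nat less_4_cases_nat sum_lessThan_4 sum_lessThan_2 qmul_def unit_vec_def
      pad_def mult.commute)

text \<open>Component j of (w, v l) = (w, v) l, that is, associativity of conj(w) v l.\<close>

lemma qmul_frame_mult:
  assumes "\<delta> \<in> {1, 2, 4}" "j < \<delta>" "\<And>k. k \<ge> \<delta> \<Longrightarrow> l k = 0"
  shows "(\<Sum>k<\<delta>. qmul (pad \<delta> w) (unit_vec j) k * qmul (pad \<delta> v) l k)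
    = qmul (pad \<delta> (\<lambda>i. \<Sum>k<\<delta>. qmul (pad \<delta> w) (unit_vec i) k * v k)) l j"
  using assms
  by (auto simp: less_2_cases_nat less_4_cases_nat sum_lessThan_4 sum_lessThan_2 qmul_def unit_vec_def
      pad_def algebra_simps)

text \<open>The norm of K is multiplicative and l has norm 1.\<close>

lemma qmul_norm:
  assumes "\<delta> \<in> {1, 2, 4}" "unit_K \<delta> l"
  shows "(\<Sum>j<\<delta>. (qmul (pad \<delta> c) l j)\<^sup>2) = (\<Sum>j<\<delta>. (c j)\<^sup>2)"
proof -
  have l: "(l 0)\<^sup>2 + (l 1)\<^sup>2 + (l 2)\<^sup>2 + (l 3)\<^sup>2 = 1" "\<And>k. k \<ge> \<delta> \<Longrightarrow> l k = 0"
    using assms(2) by (auto simp: unit_K_def sum_lessThan_4)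
  have "(\<Sum>j<\<delta>. (qmul (pad \<delta> c) l j)\<^sup>2)
     = (\<Sum>j<\<delta>. (c j)\<^sup>2) * ((l 0)\<^sup>2 + (l 1)\<^sup>2 + (l 2)\<^sup>2 + (l 3)\<^sup>2)"
    using assms(1) l(2)
    by (auto simp: sum_lessThan_4 sum_lessThan_2 qmul_def pad_def power2_eq_square algebra_simps)
  then show ?thesis unfolding l(1) by simp
qed

lemma qmul_sum_left: "qmul (\<lambda>i. \<Sum>r\<in>A. f r i) l j = (\<Sum>r\<in>A. qmul (f r) l j)"
  by (auto simp: qmul_def sum_distrib_right sum.distrib sum_subtractf)

lemma sum_idx: "(\<Sum>k\<in>idx \<delta> m. f k) = (\<Sum>r<m. \<Sum>k<\<delta>. f (r, k))"
  by (simp add: idx_def sum.cartesian_product atLeast0LessThan)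

lemma rmult_apply: "r < m \<Longrightarrow> k < \<delta> \<Longrightarrow> rmult \<delta> m x l (r, k) = qmul (pad \<delta> (\<lambda>k. x (r, k))) l k"
  by (simp add: rmult_def idx_def pad_def)

lemma linform_frame:
  "linform (idx \<delta> m) (frame \<delta> m x j) z
     = (\<Sum>r<m. \<Sum>k<\<delta>. qmul (pad \<delta> (\<lambda>k. x (r, k))) (unit_vec j) k * z (r, k))"
  unfolding linform_def sum_idx frame_def by (intro sum.cong refl) (simp add: rmult_apply)

lemma orthonormal_frame:
  assumes \<delta>: "\<delta> \<in> {1, 2, 4}" and x: "sqn (idx \<delta> m) x = 1"
  shows "orthonormal_family (idx \<delta> m) \<delta> (frame \<delta> m x)"
  unfolding orthonormal_family_def
proof (intro allI impI)
  fix i j assume ij: "i < \<delta>" "j < \<delta>"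
  have "linform (idx \<delta> m) (frame \<delta> m x i) (frame \<delta> m x j)
    = (\<Sum>r<m. \<Sum>k<\<delta>. qmul (pad \<delta> (\<lambda>k. x (r, k))) (unit_vec i) k * qmul (pad \<delta> (\<lambda>k. x (r, k))) (unit_vec j) k)"
    unfolding linform_frame by (intro sum.cong refl) (simp add: frame_def rmult_apply)
  also have "\<dots> = (\<Sum>r<m. if i = j then (\<Sum>k<\<delta>. (x (r, k))\<^sup>2) else 0)"
    unfolding qmul_frame_orthogonal[OF \<delta> ij] ..
  also have "\<dots> = (if i = j then 1 else 0)"
    using x by (simp add: sqn_def sum_idx)
  finally show "linform (idx \<delta> m) (frame \<delta> m x i) (frame \<delta> m x j) = (if i = j then 1 else 0)" .
qed

lemma quadform_frame_commute:
  assumes \<delta>: "\<delta> \<in> {1, 2, 4}"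
  shows "quadform (idx \<delta> m) \<delta> (frame \<delta> m x) z = quadform (idx \<delta> m) \<delta> (frame \<delta> m z) x"
  unfolding quadform_def
proof (intro sum.cong refl)
  fix j assume "j \<in> {..<\<delta>}"
  then have "linform (idx \<delta> m) (frame \<delta> m x j) z
      = (if j = 0 then 1 else - 1) * linform (idx \<delta> m) (frame \<delta> m z j) x"
    unfolding linform_frame sum_distrib_left[of _ _ "{..<m}"]
    by (intro sum.cong refl qmul_frame_adjoint[OF \<delta>]) auto
  then show "(linform (idx \<delta> m) (frame \<delta> m x j) z)\<^sup>2 = (linform (idx \<delta> m) (frame \<delta> m z j) x)\<^sup>2"
    by auto
qed

text \<open>Follows from (z, y l) = (z, y) l and |l| = 1. This invariance puts zonal functions into
  \<open>Phi_K\<close>.\<close>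

lemma quadform_frame_rmult:
  assumes \<delta>: "\<delta> \<in> {1, 2, 4}" and l: "unit_K \<delta> l"
  shows "quadform (idx \<delta> m) \<delta> (frame \<delta> m z) (rmult \<delta> m y l) = quadform (idx \<delta> m) \<delta> (frame \<delta> m z) y"
proof -
  have l0: "\<And>k. k \<ge> \<delta> \<Longrightarrow> l k = 0" using l by (simp add: unit_K_def)
  have "linform (idx \<delta> m) (frame \<delta> m z j) (rmult \<delta> m y l)
      = qmul (pad \<delta> (\<lambda>i. linform (idx \<delta> m) (frame \<delta> m z i) y)) l j" if j: "j < \<delta>" for j
  proof -
    have "linform (idx \<delta> m) (frame \<delta> m z j) (rmult \<delta> m y l)
      = (\<Sum>r<m. \<Sum>k<\<delta>. qmul (pad \<delta> (\<lambda>k. z (r, k))) (unit_vec j) k * qmul (pad \<delta> (\<lambda>k. y (r, k))) l k)"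
      unfolding linform_frame by (intro sum.cong refl) (simp add: rmult_apply)
    also have "\<dots> = (\<Sum>r<m. qmul (pad \<delta> (\<lambda>i. \<Sum>k<\<delta>. qmul (pad \<delta> (\<lambda>k. z (r, k))) (unit_vec i) k * y (r, k))) l j)"
      by (intro sum.cong refl qmul_frame_mult[OF \<delta> j l0])
    also have "\<dots> = qmul (\<lambda>i. \<Sum>r<m. pad \<delta> (\<lambda>i. \<Sum>k<\<delta>. qmul (pad \<delta> (\<lambda>k. z (r, k))) (unit_vec i) k * y (r, k)) i) l j"
      by (rule qmul_sum_left[symmetric])
    also have "(\<lambda>i. \<Sum>r<m. pad \<delta> (\<lambda>i. \<Sum>k<\<delta>. qmul (pad \<delta> (\<lambda>k. z (r, k))) (unit_vec i) k * y (r, k)) i)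
        = pad \<delta> (\<lambda>i. linform (idx \<delta> m) (frame \<delta> m z i) y)"
      by (auto simp: pad_def linform_frame fun_eq_iff)
    finally show ?thesis .
  qed
  then show ?thesis
    unfolding quadform_def using qmul_norm[OF \<delta> l, of "\<lambda>i. linform (idx \<delta> m) (frame \<delta> m z i) y"] by simp
qed

lemma sqn_rmult:
  assumes \<delta>: "\<delta> \<in> {1, 2, 4}" and l: "unit_K \<delta> l"
  shows "sqn (idx \<delta> m) (rmult \<delta> m y l) = sqn (idx \<delta> m) y"
  unfolding sqn_def sum_idx using qmul_norm[OF \<delta> l] by (simp add: rmult_apply)

text \<open>Bessel's inequality: with w the projection of z, both (z, w) and |w|^2 equal the
  quadratic form, and |z - w|^2 is nonnegative. The value of |w|^2 is read off from the gradient,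
  which is 2 w.\<close>

lemma quadform_le_sqn:
  assumes I: "finite I" and a: "orthonormal_family I d a"
  shows "quadform I d a z \<le> sqn I z"
proof -
  define w where "w k = (\<Sum>j<d. linform I (a j) z * a j k)" for k
  have zw: "(\<Sum>k\<in>I. z k * w k) = quadform I d a z"
  proof -
    have "(\<Sum>k\<in>I. z k * w k) = (\<Sum>j<d. \<Sum>k\<in>I. z k * (linform I (a j) z * a j k))"
      unfolding w_def sum_distrib_left by (rule sum.swap)
    also have "\<dots> = (\<Sum>j<d. linform I (a j) z * (\<Sum>k\<in>I. a j k * z k))"
      by (simp add: sum_distrib_left mult_ac)
    also have "\<dots> = quadform I d a z"
      by (simp add: quadform_def linform_def power2_eq_square)
    finally show ?thesis .
  qed
  have "4 * (\<Sum>k\<in>I. (w k)\<^sup>2) = (\<Sum>k\<in>I. (quadgrad I d a k z)\<^sup>2)"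
  proof -
    have "quadgrad I d a k z = 2 * w k" for k
      by (simp add: quadgrad_def w_def sum_distrib_left mult_ac)
    then show ?thesis by (simp add: sum_distrib_left power_mult_distrib)
  qed
  then have ww: "(\<Sum>k\<in>I. (w k)\<^sup>2) = quadform I d a z"
    unfolding sum_quadgrad_squared[OF a] by simp
  have "0 \<le> (\<Sum>k\<in>I. (z k - w k)\<^sup>2)" by (simp add: sum_nonneg)
  also have "\<dots> = sqn I z - 2 * (\<Sum>k\<in>I. z k * w k) + (\<Sum>k\<in>I. (w k)\<^sup>2)"
    unfolding sqn_def sum_distrib_left sum_subtractf[symmetric] sum.distrib[symmetric]
    by (intro sum.cong refl) (simp add: power2_diff mult.assoc)
  finally show ?thesis unfolding zw ww by simp
qed

text \<open>A polynomial in |(z, y)|^2 is not homogeneous in y, but multiplying each term by the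
  missing power of |y|^2, which is 1 on the sphere, gives an element of \<open>Phi_K\<close> of
  degree 2 d with the same values there.\<close>

lemma proj_cubature_zonal:
  assumes \<delta>: "\<delta> \<in> {1, 2, 4}" and cub: "proj_cubature \<delta> m (2 * d) n x \<rho>"
    and R: "degree R \<le> d" and m: "m > 0"
  shows "(\<Sum>i<n. \<rho> i * poly R (quadform (idx \<delta> m) \<delta> (frame \<delta> m z) (x i)))
    = (\<integral>y. poly R (quadform (idx \<delta> m) \<delta> (frame \<delta> m z) y) \<partial>sigma_K \<delta> m)"
proof -
  define t where "t = quadform (idx \<delta> m) \<delta> (frame \<delta> m z)"
  define r where "r = sqn (idx \<delta> m)"
  define f where "f y = (\<Sum>j\<le>d. coeff R j * (t y ^ j * r y ^ (d - j)))" for y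
  have fS: "f y = poly R (t y)" if "y \<in> sphere_K \<delta> m" for y
  proof -
    have "r y = 1" using that by (simp add: r_def sphere_K_def sqnorm_eq_sqn)
    then have "f y = (\<Sum>j\<le>d. coeff R j * t y ^ j)" by (simp add: f_def)
    also have "\<dots> = poly R (t y)"
      using R by (simp add: poly_altdef, intro sum.mono_neutral_right) (auto simp: coeff_eq_0)
    finally show ?thesis .
  qed
  have "homog_poly \<delta> m (2 * d) (\<lambda>y. complex_of_real (f y))"
  proof -
    have "homog_poly \<delta> m (2 * d) (\<lambda>y. \<Sum>j\<le>d. complex_of_real (coeff R j) *
        (complex_of_real (t y) ^ j * complex_of_real (r y) ^ (d - j)))"
    proof (intro homog_poly_sum homog_poly_cmult)
      fix j assume "j \<in> {..d}"
      then have e: "2 * d = 2 * j + 2 * (d - j)" by auto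
      show "homog_poly \<delta> m (2 * d) (\<lambda>y. complex_of_real (t y) ^ j * complex_of_real (r y) ^ (d - j))"
        unfolding e t_def r_def
        by (intro homog_poly_mult homog_poly_power homog_poly_quadform homog_poly_sqn)
    qed
    then show ?thesis by (simp add: f_def)
  qed
  moreover have "f (rmult \<delta> m w l) = f w" if "unit_K \<delta> l" for w l
    by (simp add: f_def t_def r_def quadform_frame_rmult[OF \<delta> that] sqn_rmult[OF \<delta> that])
  ultimately have "(\<lambda>y. complex_of_real (f y)) \<in> Phi_K \<delta> m (2 * d)"
    by (simp add: Phi_K_def)
  then have "(\<integral>y. complex_of_real (f y) \<partial>sigma_K \<delta> m) = (\<Sum>i<n. complex_of_real (\<rho> i) * complex_of_real (f (x i)))"
    using cub unfolding proj_cubature_def by blast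
  then have "complex_of_real (\<integral>y. f y \<partial>sigma_K \<delta> m) = complex_of_real (\<Sum>i<n. \<rho> i * f (x i))"
    by simp
  then have "(\<integral>y. f y \<partial>sigma_K \<delta> m) = (\<Sum>i<n. \<rho> i * f (x i))"
    by (simp only: of_real_eq_iff)
  moreover have "(\<integral>y. f y \<partial>sigma_K \<delta> m) = (\<integral>y. poly R (t y) \<partial>sigma_K \<delta> m)"
    using \<delta> m by (intro Bochner_Integration.integral_cong refl fS) (auto simp: space_sigma_K)
  moreover have "(\<Sum>i<n. \<rho> i * f (x i)) = (\<Sum>i<n. \<rho> i * poly R (t (x i)))"
    using cub by (intro sum.cong refl) (simp add: fS proj_cubature_def)
  ultimately show ?thesis by (simp add: t_def)
qed

section \<open>Symmetry and moments of zonal functions\<close>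

lemma Lop_monom:
  "Lop a b (monom c j) = monom (- (c * real j * (real j + a + b + 1))) j + monom (c * real j * (real j + b)) (j - 1)"
proof (rule poly_eq_poly_eq_iff[THEN iffD1], rule ext)
  fix u :: real
  have e1: "u * (real j * u ^ (j - 1)) = real j * u ^ j" by (cases j) auto
  have e2: "u * (real j * real (j - 1) * u ^ (j - 1 - 1)) = (real j - 1) * (real j * u ^ (j - 1))"
    by (cases j; cases "j - 1") auto
  have "poly (Lop a b (monom c j)) u
      = c * ((1 - u) * (u * (real j * real (j - 1) * u ^ (j - 1 - 1))) + (b + 1) * (real j * u ^ (j - 1))
          - (a + b + 2) * (u * (real j * u ^ (j - 1))))"
    unfolding poly_Lop pderiv_monom poly_monom by (simp add: algebra_simps)
  also have "\<dots> = c * ((real j + b) * (real j * u ^ (j - 1))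
      - (real j + a + b + 1) * (u * (real j * u ^ (j - 1))))"
    unfolding e2 by (simp add: algebra_simps)
  finally show "poly (Lop a b (monom c j)) u
     = poly (monom (- (c * real j * (real j + a + b + 1))) j + monom (c * real j * (real j + b)) (j - 1)) u"
    unfolding e1 by (simp add: poly_monom algebra_simps)
qed

lemma poly_linear_functional_zero:
  fixes f :: "real poly \<Rightarrow> real"
  assumes add: "\<And>P Q. f (P + Q) = f P + f Q" and scale: "\<And>c P. f (smult c P) = c * f P"
    and mono: "\<And>i. f (monom 1 i) = 0"
  shows "f P = 0"
proof -
  have f0: "f 0 = 0" using scale[of 0 0] by simp
  have "f (\<Sum>i\<in>A. monom (coeff P i) i) = 0" for A
  proof (induction A rule: infinite_finite_induct)
    case (insert i A)
    have "f (monom (coeff P i) i) = coeff P i * f (monom 1 i)"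
      using scale[of "coeff P i" "monom 1 i"] by (simp add: smult_monom)
    then show ?case using insert by (simp add: add mono)
  qed (simp_all add: f0)
  from this[of "{..degree P}"] show ?thesis by (simp add: poly_as_sum_of_monoms)
qed

lemma polyfun_poly: "polyfun I f \<Longrightarrow> polyfun I (\<lambda>z. poly P (f z))"
  unfolding poly_altdef by (intro polyfun_intros)

lemma quadform_scale: "quadform I d a (\<lambda>k\<in>I. c * z k) = c\<^sup>2 * quadform I d a z"
proof -
  have "linform I (a j) (\<lambda>k\<in>I. c * z k) = c * linform I (a j) z" for j
    by (simp add: linform_def sum_distrib_left mult_ac cong: sum.cong)
  then show ?thesis by (simp add: quadform_def power_mult_distrib sum_distrib_left)
qed

lemma quadform_restrict: "quadform I d a (restrict z I) = quadform I d a z"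
  by (simp add: quadform_def linform_def cong: sum.cong)

context
  fixes \<delta> m :: nat and \<alpha> \<beta> :: real and I :: "(nat \<times> nat) set"
  assumes \<delta>: "\<delta> \<in> {1, 2, 4}" and m: "m \<ge> 2"
    and \<alpha>: "\<alpha> = (real (\<delta> * (m - 1)) - 2) / 2" and \<beta>: "\<beta> = (real \<delta> - 2) / 2"
    and I: "I = idx \<delta> m"
begin

lemma dim_pos: "\<delta> > 0" "m > 0" using \<delta> m by auto

lemma alpha_beta_gt: "\<alpha> > -1" "\<beta> > -1"
proof -
  have "\<delta> * (m - 1) > 0" using dim_pos m by simp
  then have "real (\<delta> * (m - 1)) > 0" by (simp only: of_nat_0_less_iff)
  then show "\<alpha> > -1" unfolding \<alpha> by (simp only: less_divide_eq_numeral1)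
  show "\<beta> > -1" unfolding \<beta> using dim_pos by simp
qed

lemma alpha_beta_sum: "\<alpha> + \<beta> + 1 = real (\<delta> * m) / 2 - 1"
  unfolding \<alpha> \<beta> using m by (simp add: of_nat_diff field_simps)

lemma alpha_beta_nonneg: "\<alpha> + \<beta> + 1 \<ge> 0"
proof -
  have "\<delta> * m \<ge> 1 * 2" using dim_pos m by (intro mult_le_mono) auto
  then have "real (\<delta> * m) \<ge> 2" by linarith
  then show ?thesis unfolding alpha_beta_sum by simp
qed

lemma integrable_sigma_polyfun: "polyfun I f \<Longrightarrow> integrable (sigma_K \<delta> m) f"
  unfolding I by (rule polyfun_integrable_sigma_K[OF dim_pos])

text \<open>\<open>gauss_quadform_symmetry\<close> transferred to the sphere. Its terms have degrees
  2 (i + j) and 2 (i + j) - 2, so dividing by the Gaussian moments of the norm leaves the ratio of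
  two consecutive moments as a factor.\<close>

lemma sigma_quadform_recurrence:
  assumes a: "orthonormal_family I \<delta> a" and b: "orthonormal_family I \<delta> b"
  defines "S \<equiv> \<lambda>i j. \<integral>z. quadform I \<delta> a z ^ i * quadform I \<delta> b z ^ j \<partial>sigma_K \<delta> m"
  shows "real j * (2 * real j + real \<delta> - 2) * S i (j - 1) - real i * (2 * real i + real \<delta> - 2) * S (i - 1) j
    = (real j - real i) * (real (\<delta> * m) + 2 * real (i + j) - 2) * S i j"
proof -
  have fin: "finite I" by (simp add: I finite_idx)
  define E where "E n = gauss_expect I (\<lambda>z. sqn I z ^ n)" for n
  define g where "g i j = gauss_expect I (\<lambda>z. quadform I \<delta> a z ^ i * quadform I \<delta> b z ^ j)" for i j
  have cardI: "card I = \<delta> * m" by (simp add: I idx_def mult.commute)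
  have ES: "E (Suc n) = (real (\<delta> * m) + 2 * real n) * E n" for n
    unfolding E_def sqn_def using gauss_norm_moment_Suc[OF fin, of n] by (simp add: cardI)
  have E0: "E 0 = 1"
  proof -
    interpret product_sigma_finite "\<lambda>_. lborel :: real measure"
      by standard
    have "(\<integral>z. (\<Prod>k\<in>I. std_normal_density (z k)) \<partial>PiM I (\<lambda>_. lborel)) = (\<Prod>k\<in>I. integral\<^sup>L lborel std_normal_density)"
      by (rule product_integral_prod[OF fin]) simp
    also have "\<dots> = 1" by simp
    finally show ?thesis by (simp add: E_def gauss_expect_def gauss_density_def)
  qed
  have Epos: "E n > 0" for n
  proof (induction n)
    case (Suc n)
    have "real (\<delta> * m) > 0" using dim_pos by simp
    then show ?case using Suc unfolding ES by (intro mult_pos_pos) auto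
  qed (simp add: E0)
  have Sg: "S i j * E (i + j) = g i j" for i j
    unfolding S_def E_def g_def unfolding I
  proof (rule sigma_K_homogeneous[OF dim_pos])
    show "polyfun (idx \<delta> m) (\<lambda>z. quadform (idx \<delta> m) \<delta> a z ^ i * quadform (idx \<delta> m) \<delta> b z ^ j)"
      by (intro polyfun_intros polyfun_quadform)
  qed (simp_all add: quadform_scale quadform_restrict power_mult_distrib power_mult[symmetric] power_add distrib_left mult_ac)
  show ?thesis
  proof (cases "i + j")
    case (Suc n)
    \<comment> \<open>The factor \<open>real j\<close> is kept so that the truncated index j - 1
      does no harm at j = 0.\<close>
    have A: "real j * g i (j - 1) = real j * (S i (j - 1) * E n)"
      using Sg[of i "j - 1"] Suc by (cases j) simp_all
    have B: "real i * g (i - 1) j = real i * (S (i - 1) j * E n)"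
      using Sg[of "i - 1" j] Suc by (cases i) simp_all
    have C: "g i j = S i j * ((real (\<delta> * m) + 2 * real n) * E n)"
      using Sg[of i j] Suc ES[of n] by simp
    have "2 * (2 * real j + real \<delta> - 2) * (real j * g i (j - 1))
        - 2 * (2 * real i + real \<delta> - 2) * (real i * g (i - 1) j) = 2 * (real j - real i) * g i j"
      using gauss_quadform_symmetry[OF fin a b, of j i] unfolding g_def by (simp add: mult_ac)
    then have "E n * (real j * (2 * real j + real \<delta> - 2) * S i (j - 1) - real i * (2 * real i + real \<delta> - 2) * S (i - 1) j)
       = E n * ((real j - real i) * (real (\<delta> * m) + 2 * real n) * S i j)"
      unfolding A B C by (simp add: algebra_simps)
    then have "real j * (2 * real j + real \<delta> - 2) * S i (j - 1) - real i * (2 * real i + real \<delta> - 2) * S (i - 1) j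
       = (real j - real i) * (real (\<delta> * m) + 2 * real n) * S i j"
      using Epos[of n] by (simp only: mult_cancel_left) auto
    moreover have "real (\<delta> * m) + 2 * real n = real (\<delta> * m) + 2 * real (i + j) - 2" using Suc by simp
    ultimately show ?thesis by (simp only:)
  qed auto
qed

text \<open>By bilinearity monomials suffice, and for them this is the recurrence with \<delta> = 2
  \<beta> + 2 and \<delta> m = 2 (\<alpha> + \<beta> + 1) + 2. Allowing two different frames
  replaces an addition theorem: zonal eigenpolynomials of different eigenvalues are orthogonal even
  around different centres.\<close>

lemma sigma_Lop_symmetric:
  assumes a: "orthonormal_family I \<delta> a" and b: "orthonormal_family I \<delta> b"
  shows "(\<integral>z. poly P (quadform I \<delta> a z) * poly (Lop \<alpha> \<beta> R) (quadform I \<delta> b z) \<partial>sigma_K \<delta> m)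
    = (\<integral>z. poly (Lop \<alpha> \<beta> P) (quadform I \<delta> a z) * poly R (quadform I \<delta> b z) \<partial>sigma_K \<delta> m)"
proof -
  define T where "T P R = (\<integral>z. poly P (quadform I \<delta> a z) * poly R (quadform I \<delta> b z) \<partial>sigma_K \<delta> m)" for P R
  have int: "integrable (sigma_K \<delta> m) (\<lambda>z. poly P (quadform I \<delta> a z) * poly R (quadform I \<delta> b z))" for P R
    by (intro integrable_sigma_polyfun polyfun_intros polyfun_poly polyfun_quadform)
  have T_add: "T (P + Q) R = T P R + T Q R" "T R (P + Q) = T R P + T R Q" for P Q R
    unfolding T_def by (simp_all add: distrib_right distrib_left int)
  have T_smult: "T (smult c P) R = c * T P R" "T P (smult c R) = c * T P R" for c P R
    unfolding T_def by (simp_all add: mult.assoc mult.left_commute)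
  have dims: "real \<delta> = 2 * \<beta> + 2" "real (\<delta> * m) = 2 * (\<alpha> + \<beta> + 1) + 2"
    using alpha_beta_sum \<beta> by (simp_all add: field_simps)
  define D where "D P R = T P (Lop \<alpha> \<beta> R) - T (Lop \<alpha> \<beta> P) R" for P R
  have "D P R = 0"
  proof (rule poly_linear_functional_zero[of "\<lambda>P. D P R"])
    fix i
    show "D (monom 1 i) R = 0"
    proof (rule poly_linear_functional_zero[of "D (monom 1 i)"])
      fix j
      have Tm: "T (monom c k) (monom e l) = c * e * T (monom 1 k) (monom 1 l)" for c e k l
        using T_smult(1)[of c "monom 1 k" "monom e l"] T_smult(2)[of "monom 1 k" e "monom 1 l"]
        by (simp add: smult_monom)
      have Tmm: "T (monom 1 k) (monom 1 l) = (\<integral>z. quadform I \<delta> a z ^ k * quadform I \<delta> b z ^ l \<partial>sigma_K \<delta> m)" for k l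
        by (simp add: T_def poly_monom)
      have "D (monom 1 i) (monom 1 j)
         = - (real j * (real j + (\<alpha> + \<beta> + 1))) * T (monom 1 i) (monom 1 j)
           + real j * (real j + \<beta>) * T (monom 1 i) (monom 1 (j - 1))
           + real i * (real i + (\<alpha> + \<beta> + 1)) * T (monom 1 i) (monom 1 j)
           - real i * (real i + \<beta>) * T (monom 1 (i - 1)) (monom 1 j)"
        unfolding D_def Lop_monom T_add by (subst (1 2 3 4) Tm) (simp add: algebra_simps)
      also have "2 * \<dots> = (real j * (2 * real j + real \<delta> - 2) * T (monom 1 i) (monom 1 (j - 1))
           - real i * (2 * real i + real \<delta> - 2) * T (monom 1 (i - 1)) (monom 1 j))
           - (real j - real i) * (real (\<delta> * m) + 2 * real (i + j) - 2) * T (monom 1 i) (monom 1 j)"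
        unfolding dims by (simp add: algebra_simps)
      also have "\<dots> = 0"
        unfolding Tmm using sigma_quadform_recurrence[OF a b, of j i] by simp
      finally show "D (monom 1 i) (monom 1 j) = 0" by simp
    qed (simp_all add: D_def T_add T_smult Lop_add Lop_smult algebra_simps)
  qed (simp_all add: D_def T_add T_smult Lop_add Lop_smult algebra_simps)
  then show ?thesis by (simp add: D_def T_def)
qed

lemma sigma_Lop_zero:
  assumes "orthonormal_family I \<delta> b"
  shows "(\<integral>z. poly (Lop \<alpha> \<beta> R) (quadform I \<delta> b z) \<partial>sigma_K \<delta> m) = 0"
  using sigma_Lop_symmetric[OF assms assms, of 1 R] by (simp add: Lop_def)

text \<open>The values of the zonal variable are Beta distributed. On moments, the recurrence with
  one exponent 0 is the functional equation of Beta in its first argument; linearity gives all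
  polynomials.\<close>

lemma zonal_has_integral:
  assumes b: "orthonormal_family I \<delta> b"
  shows "((\<lambda>u. poly P u * (u powr \<beta> * (1 - u) powr \<alpha>)) has_integral
     (Beta (\<beta> + 1) (\<alpha> + 1) * (\<integral>z. poly P (quadform I \<delta> b z) \<partial>sigma_K \<delta> m))) {0..1}"
proof -
  interpret prob_space "sigma_K \<delta> m" by (rule prob_space_sigma_K[OF dim_pos])
  define S where "S j = (\<integral>z. quadform I \<delta> b z ^ j \<partial>sigma_K \<delta> m)" for j
  have SB: "Beta (\<beta> + 1) (\<alpha> + 1) * S j = Beta (\<beta> + 1 + real j) (\<alpha> + 1)" for j
  proof (induction j)
    case 0
    then show ?case by (simp add: S_def prob_space)
  next
    case (Suc j)
    define x where "x = \<beta> + 1 + real j"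
    have x: "x > 0" "x + (\<alpha> + 1) > 0" "x \<notin> \<int>\<^sub>\<le>\<^sub>0"
      using alpha_beta_gt by (auto simp: x_def nonpos_Ints_def dest!: Ints_cases)
    have "real (Suc j) * (2 * real (Suc j) + real \<delta> - 2) * S j
        = real (Suc j) * (real (\<delta> * m) + 2 * real (Suc j) - 2) * S (Suc j)"
      using sigma_quadform_recurrence[OF b b, of "Suc j" 0] by (simp add: S_def)
    then have "(2 * real (Suc j) + real \<delta> - 2) * S j = (real (\<delta> * m) + 2 * real (Suc j) - 2) * S (Suc j)"
      by (simp only: mult.assoc mult_cancel_left) simp
    moreover have "2 * real (Suc j) + real \<delta> - 2 = 2 * x" by (simp add: x_def \<beta> field_simps)
    moreover have "real (\<delta> * m) + 2 * real (Suc j) - 2 = 2 * (x + (\<alpha> + 1))"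
      using alpha_beta_sum by (simp add: x_def)
    ultimately have "2 * (x * S j) = 2 * ((x + (\<alpha> + 1)) * S (Suc j))" by (simp only: mult.assoc)
    then have "x * S j = (x + (\<alpha> + 1)) * S (Suc j)" by linarith
    then have "(x + (\<alpha> + 1)) * (Beta (\<beta> + 1) (\<alpha> + 1) * S (Suc j)) = x * (Beta (\<beta> + 1) (\<alpha> + 1) * S j)"
      by (simp add: mult_ac)
    also have "\<dots> = x * Beta x (\<alpha> + 1)" unfolding Suc.IH x_def ..
    also have "\<dots> = (x + (\<alpha> + 1)) * Beta (x + 1) (\<alpha> + 1)"
      using Beta_plus1_left[OF x(3), of "\<alpha> + 1"] by simp
    finally have "Beta (\<beta> + 1) (\<alpha> + 1) * S (Suc j) = Beta (x + 1) (\<alpha> + 1)" using x by simp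
    then show ?case by (simp add: x_def add_ac)
  qed
  have mono: "((\<lambda>u. u ^ j * (u powr \<beta> * (1 - u) powr \<alpha>)) has_integral (Beta (\<beta> + 1) (\<alpha> + 1) * S j)) {0..1}" for j
  proof -
    have "((\<lambda>u. u powr (\<beta> + 1 + real j - 1) * (1 - u) powr (\<alpha> + 1 - 1)) has_integral Beta (\<beta> + 1 + real j) (\<alpha> + 1)) {0..1}"
      using alpha_beta_gt by (intro has_integral_Beta_real) auto
    then show ?thesis
      unfolding SB
    proof (rule has_integral_eq[rotated])
      fix u :: real assume "u \<in> {0..1}"
      then show "u powr (\<beta> + 1 + real j - 1) * (1 - u) powr (\<alpha> + 1 - 1) = u ^ j * (u powr \<beta> * (1 - u) powr \<alpha>)"
        by (cases "u = 0") (auto simp: powr_add powr_realpow)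
    qed
  qed
  have "((\<lambda>u. \<Sum>j\<le>degree P. coeff P j * (u ^ j * (u powr \<beta> * (1 - u) powr \<alpha>))) has_integral
      (\<Sum>j\<le>degree P. coeff P j * (Beta (\<beta> + 1) (\<alpha> + 1) * S j))) {0..1}"
    by (intro has_integral_sum has_integral_mult_right mono) simp
  moreover have "(\<Sum>j\<le>degree P. coeff P j * (Beta (\<beta> + 1) (\<alpha> + 1) * S j))
     = Beta (\<beta> + 1) (\<alpha> + 1) * (\<integral>z. poly P (quadform I \<delta> b z) \<partial>sigma_K \<delta> m)"
  proof -
    have "(\<integral>z. poly P (quadform I \<delta> b z) \<partial>sigma_K \<delta> m) = (\<Sum>j\<le>degree P. coeff P j * S j)"
      unfolding poly_altdef S_def
      by (subst Bochner_Integration.integral_sum)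
         (auto intro!: integrable_sigma_polyfun polyfun_intros polyfun_quadform)
    then show ?thesis by (simp add: sum_distrib_left mult_ac)
  qed
  moreover have "(\<Sum>j\<le>degree P. coeff P j * (u ^ j * w)) = poly P u * w" for u w :: real
    by (simp add: poly_altdef sum_distrib_right mult.assoc)
  ultimately show ?thesis by simp
qed

end

section \<open>The bound\<close>

context
  fixes \<delta> m :: nat and \<alpha> \<beta> :: real and I :: "(nat \<times> nat) set"
    and d n :: nat and x :: "nat \<Rightarrow> nat \<times> nat \<Rightarrow> real" and \<rho> :: "nat \<Rightarrow> real"
  assumes \<delta>: "\<delta> \<in> {1, 2, 4}" and m: "m \<ge> 2"
    and \<alpha>: "\<alpha> = (real (\<delta> * (m - 1)) - 2) / 2" and \<beta>: "\<beta> = (real \<delta> - 2) / 2"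
    and I: "I = idx \<delta> m" and cub: "proj_cubature \<delta> m (2 * d) n x \<rho>"
begin

lemmas ctx = \<delta> m \<alpha> \<beta> I

definition zonal :: "nat \<Rightarrow> (nat \<times> nat \<Rightarrow> real) \<Rightarrow> real" where
  "zonal i = quadform I \<delta> (frame \<delta> m (x i))"

definition averaged :: "real poly \<Rightarrow> (nat \<times> nat \<Rightarrow> real) \<Rightarrow> real" where
  "averaged P z = (\<Sum>i<n. \<rho> i * poly P (zonal i z))"

definition averaged_form :: "real poly \<Rightarrow> real poly \<Rightarrow> real" where
  "averaged_form P R = (\<integral>z. averaged P z * averaged R z \<partial>sigma_K \<delta> m)"

text \<open>Taken as a Beta integral, not as an integral over the sphere, so that it visibly depends
  on no frame.\<close>

definition zonal_mean :: "real poly \<Rightarrow> real" where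
  "zonal_mean P = integral {0..1} (\<lambda>u. poly P u * (u powr \<beta> * (1 - u) powr \<alpha>)) / Beta (\<beta> + 1) (\<alpha> + 1)"

lemma weights: "i < n \<Longrightarrow> \<rho> i > 0"
  using cub by (simp add: proj_cubature_def)

lemma orthonormal_node_frame: "i < n \<Longrightarrow> orthonormal_family I \<delta> (frame \<delta> m (x i))"
  unfolding I using cub by (intro orthonormal_frame[OF \<delta>]) (simp add: proj_cubature_def sphere_K_def sqnorm_eq_sqn)

lemma orthonormal_sphere_frame: "z \<in> sphere_K \<delta> m \<Longrightarrow> orthonormal_family I \<delta> (frame \<delta> m z)"
  unfolding I by (intro orthonormal_frame[OF \<delta>]) (simp add: sphere_K_def sqnorm_eq_sqn)

lemma zonal_range:
  assumes "i < n" "z \<in> sphere_K \<delta> m"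
  shows "zonal i z \<in> {0..1}"
proof -
  have "quadform I \<delta> (frame \<delta> m (x i)) z \<le> sqn I z"
    by (intro quadform_le_sqn orthonormal_node_frame assms) (simp add: I finite_idx)
  moreover have "sqn I z = 1" using assms(2) unfolding I by (simp add: sphere_K_def sqnorm_eq_sqn)
  moreover have "0 \<le> quadform I \<delta> (frame \<delta> m (x i)) z" by (simp add: quadform_def sum_nonneg)
  ultimately show ?thesis by (simp add: zonal_def)
qed

lemma polyfun_zonal: "polyfun I (\<lambda>z. poly P (zonal i z))"
  unfolding zonal_def by (intro polyfun_poly polyfun_quadform)

lemma polyfun_averaged: "polyfun I (averaged P)"
  unfolding averaged_def by (intro polyfun_intros polyfun_zonal)

lemma integrable_polyfun: "polyfun I f \<Longrightarrow> integrable (sigma_K \<delta> m) f"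
  by (rule integrable_sigma_polyfun[OF ctx])

lemma Beta_pos: "Beta (\<beta> + 1) (\<alpha> + 1) > 0"
  using alpha_beta_gt[OF ctx] by (simp add: Beta_def Gamma_real_pos)

lemma mean_eq_zonal_mean:
  assumes "orthonormal_family I \<delta> b"
  shows "(\<integral>z. poly P (quadform I \<delta> b z) \<partial>sigma_K \<delta> m) = zonal_mean P"
  using integral_unique[OF zonal_has_integral[OF ctx assms, of P]] Beta_pos
  by (simp add: zonal_mean_def)

lemma zonal_mean_node: "i < n \<Longrightarrow> (\<integral>z. poly P (zonal i z) \<partial>sigma_K \<delta> m) = zonal_mean P"
  unfolding zonal_def by (intro mean_eq_zonal_mean orthonormal_node_frame)

lemma zonal_weight_has_integral:
  "((\<lambda>u. u powr \<beta> * (1 - u) powr \<alpha>) has_integral Beta (\<beta> + 1) (\<alpha> + 1)) {0..1}"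
  using has_integral_Beta_real[of "\<beta> + 1" "\<alpha> + 1"] alpha_beta_gt[OF ctx] by simp

lemma sum_weights: "(\<Sum>i<n. \<rho> i) = 1"
proof -
  interpret prob_space "sigma_K \<delta> m" by (rule prob_space_sigma_K) (use \<delta> m in auto)
  have "(\<Sum>i<n. \<rho> i * poly 1 (quadform (idx \<delta> m) \<delta> (frame \<delta> m z) (x i)))
    = (\<integral>y. poly 1 (quadform (idx \<delta> m) \<delta> (frame \<delta> m z) y) \<partial>sigma_K \<delta> m)" for z
    using m by (intro proj_cubature_zonal[OF \<delta> cub]) auto
  then show ?thesis by (simp add: prob_space)
qed

text \<open>Makes node 0 available as a reference frame; linearity of \<open>zonal_mean\<close> is
  read off from integrals over the sphere there.\<close>

lemma n_pos: "n > 0"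
  using sum_weights by (cases n) auto

lemma zonal_mean_has_integral:
  "((\<lambda>u. poly P u * (u powr \<beta> * (1 - u) powr \<alpha>)) has_integral (Beta (\<beta> + 1) (\<alpha> + 1) * zonal_mean P)) {0..1}"
  using zonal_has_integral[OF ctx orthonormal_node_frame[OF n_pos], of P]
  by (simp add: mean_eq_zonal_mean[OF orthonormal_node_frame[OF n_pos]])

lemma zonal_mean_add: "zonal_mean (P + Q) = zonal_mean P + zonal_mean Q"
  unfolding zonal_mean_node[OF n_pos, symmetric] by (simp add: integrable_polyfun[OF polyfun_zonal])

lemma zonal_mean_smult: "zonal_mean (smult c P) = c * zonal_mean P"
  unfolding zonal_mean_node[OF n_pos, symmetric] by simp

lemma zonal_mean_sum: "zonal_mean (\<Sum>k\<in>A. f k) = (\<Sum>k\<in>A. zonal_mean (f k))"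
  unfolding zonal_mean_node[OF n_pos, symmetric]
  by (simp add: poly_sum integrable_polyfun[OF polyfun_zonal])

lemma zonal_mean_Lop: "zonal_mean (Lop \<alpha> \<beta> P) = 0"
  unfolding zonal_mean_node[OF n_pos, symmetric] zonal_def
  by (rule sigma_Lop_zero[OF ctx orthonormal_node_frame[OF n_pos]])

lemma zonal_mean_1: "zonal_mean 1 = 1"
proof -
  interpret prob_space "sigma_K \<delta> m" by (rule prob_space_sigma_K) (use \<delta> m in auto)
  show ?thesis unfolding zonal_mean_node[OF n_pos, symmetric] by (simp add: prob_space)
qed

text \<open>|(x, z)| is symmetric, so the sum over the nodes is the cubature sum of the zonal
  polynomial centred at z, which the formula integrates exactly.\<close>

lemma averaged_low_degree:
  assumes "degree R \<le> d" "z \<in> sphere_K \<delta> m"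
  shows "averaged R z = zonal_mean R"
proof -
  have "averaged R z = (\<Sum>i<n. \<rho> i * poly R (quadform (idx \<delta> m) \<delta> (frame \<delta> m z) (x i)))"
    unfolding averaged_def zonal_def unfolding I by (subst quadform_frame_commute[OF \<delta>]) simp
  also have "\<dots> = zonal_mean R"
    using proj_cubature_zonal[OF \<delta> cub assms(1), of z] m
      mean_eq_zonal_mean[OF orthonormal_sphere_frame[OF assms(2)], of R] by (simp add: I)
  finally show ?thesis .
qed

lemma averaged_form_expand:
  "averaged_form P R
    = (\<Sum>i<n. \<Sum>j<n. \<rho> i * \<rho> j * (\<integral>z. poly P (zonal i z) * poly R (zonal j z) \<partial>sigma_K \<delta> m))"
proof -
  have "averaged_form P R
     = (\<integral>z. (\<Sum>i<n. \<Sum>j<n. \<rho> i * \<rho> j * (poly P (zonal i z) * poly R (zonal j z))) \<partial>sigma_K \<delta> m)"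
    unfolding averaged_form_def averaged_def sum_product by (simp add: mult_ac)
  also have "\<dots> = (\<Sum>i<n. \<integral>z. (\<Sum>j<n. \<rho> i * \<rho> j * (poly P (zonal i z) * poly R (zonal j z))) \<partial>sigma_K \<delta> m)"
    by (intro Bochner_Integration.integral_sum integrable_polyfun polyfun_intros polyfun_zonal)
  also have "\<dots> = (\<Sum>i<n. \<Sum>j<n. \<integral>z. \<rho> i * \<rho> j * (poly P (zonal i z) * poly R (zonal j z)) \<partial>sigma_K \<delta> m)"
    by (intro sum.cong refl Bochner_Integration.integral_sum integrable_polyfun polyfun_intros polyfun_zonal)
  finally show ?thesis by simp
qed

lemma averaged_form_Lop: "averaged_form P (Lop \<alpha> \<beta> R) = averaged_form (Lop \<alpha> \<beta> P) R"
  unfolding averaged_form_expand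
proof (intro sum.cong refl)
  fix i j assume "i \<in> {..<n}" "j \<in> {..<n}"
  then show "\<rho> i * \<rho> j * (\<integral>z. poly P (zonal i z) * poly (Lop \<alpha> \<beta> R) (zonal j z) \<partial>sigma_K \<delta> m)
    = \<rho> i * \<rho> j * (\<integral>z. poly (Lop \<alpha> \<beta> P) (zonal i z) * poly R (zonal j z) \<partial>sigma_K \<delta> m)"
    unfolding zonal_def
    using sigma_Lop_symmetric[OF ctx orthonormal_node_frame orthonormal_node_frame, of i j P R] by simp
qed

lemma averaged_smult: "averaged (smult c P) z = c * averaged P z"
  by (simp add: averaged_def sum_distrib_left mult_ac)

lemma averaged_sum: "averaged (\<Sum>k\<in>A. f k) z = (\<Sum>k\<in>A. averaged (f k) z)"
  unfolding averaged_def poly_sum sum_distrib_left by (rule sum.swap)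

definition eigenvalue :: "nat \<Rightarrow> real" where
  "eigenvalue k = real k * (real k + \<alpha> + \<beta> + 1)"

lemma eigenvalue_strict_mono: "k < l \<Longrightarrow> eigenvalue k < eigenvalue l"
  unfolding eigenvalue_def using alpha_beta_nonneg[OF ctx] by (intro mult_strict_mono') auto

lemma Lop_jacobi: "Lop \<alpha> \<beta> (jacobi_poly k \<alpha> \<beta>) = smult (- eigenvalue k) (jacobi_poly k \<alpha> \<beta>)"
  unfolding eigenvalue_def by (rule Lop_jacobi_poly)

lemma averaged_form_jacobi_orthogonal:
  assumes "k \<noteq> l"
  shows "averaged_form (jacobi_poly k \<alpha> \<beta>) (jacobi_poly l \<alpha> \<beta>) = 0"
proof -
  have "- eigenvalue l * averaged_form (jacobi_poly k \<alpha> \<beta>) (jacobi_poly l \<alpha> \<beta>)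
      = - eigenvalue k * averaged_form (jacobi_poly k \<alpha> \<beta>) (jacobi_poly l \<alpha> \<beta>)"
    using averaged_form_Lop[of "jacobi_poly k \<alpha> \<beta>" "jacobi_poly l \<alpha> \<beta>"]
    unfolding Lop_jacobi averaged_form_def averaged_smult by (simp add: mult.left_commute mult.assoc)
  moreover have "eigenvalue k \<noteq> eigenvalue l"
    using assms eigenvalue_strict_mono[of k l] eigenvalue_strict_mono[of l k] by (cases k l rule: linorder_cases) auto
  ultimately show ?thesis by simp
qed

lemma zonal_mean_jacobi: "k > 0 \<Longrightarrow> zonal_mean (jacobi_poly k \<alpha> \<beta>) = 0"
  using zonal_mean_Lop[of "jacobi_poly k \<alpha> \<beta>"] eigenvalue_strict_mono[of 0 k]
  unfolding Lop_jacobi zonal_mean_smult by (auto simp: eigenvalue_def)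

text \<open>The components of degree 1 to \<open>d\<close> vanish because the cubature formula is exact on them,
  and for those of degree above \<open>d\<close> the operator is negative.\<close>

lemma averaged_form_upper:
  fixes P :: "real poly"
  defines "l \<equiv> eigenvalue (d + 1)"
  shows "averaged_form P (Lop \<alpha> \<beta> P + smult l P) \<le> l * (zonal_mean P)\<^sup>2"
proof -
  interpret prob_space "sigma_K \<delta> m" by (rule prob_space_sigma_K) (use \<delta> m in auto)
  define J where "J k = jacobi_poly k \<alpha> \<beta>" for k
  obtain c where P: "P = (\<Sum>k\<le>degree P. smult (c k) (J k))"
    using poly_span_of_degrees[of J P "degree P"] degree_jacobi_poly[OF alpha_beta_gt[OF ctx]]
    by (auto simp: J_def)
  define N where "N = degree P"
  have P: "P = (\<Sum>k\<le>N. smult (c k) (J k))" using P by (simp add: N_def)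
  have smult_sum: "smult l (\<Sum>k\<in>A. f k) = (\<Sum>k\<in>A. smult l (f k))" for A and f :: "nat \<Rightarrow> real poly"
    by (induction A rule: infinite_finite_induct) (simp_all add: smult_add_right)
  \<comment> \<open>In the Jacobi basis L + l is diagonal with entries l -
    \<open>eigenvalue k\<close>, positive for k up to d, zero at d + 1 and negative beyond.\<close>
  have DP: "Lop \<alpha> \<beta> P + smult l P = (\<Sum>k\<le>N. smult (c k * (l - eigenvalue k)) (J k))"
    unfolding P Lop_sum smult_sum sum.distrib[symmetric]
    by (intro sum.cong refl)
       (simp add: Lop_smult J_def Lop_jacobi right_diff_distrib smult_diff_left mult.commute)
  have mean: "zonal_mean P = c 0"
  proof -
    have "zonal_mean P = (\<Sum>k\<le>N. if k = 0 then c 0 else 0)"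
      unfolding P zonal_mean_sum
      by (intro sum.cong refl) (auto simp: zonal_mean_smult J_def zonal_mean_1 zonal_mean_jacobi)
    then show ?thesis by simp
  qed
  have int: "integrable (sigma_K \<delta> m) (\<lambda>z. averaged A z * averaged B z)" for A B
    by (intro integrable_polyfun polyfun_intros polyfun_averaged)
  have "averaged_form P (Lop \<alpha> \<beta> P + smult l P)
      = (\<integral>z. (\<Sum>k\<le>N. \<Sum>j\<le>N. c k * (c j * (l - eigenvalue j)) * (averaged (J k) z * averaged (J j) z)) \<partial>sigma_K \<delta> m)"
    unfolding averaged_form_def DP unfolding P averaged_sum averaged_smult sum_product by (simp add: mult_ac)
  also have "\<dots> = (\<Sum>k\<le>N. \<Sum>j\<le>N. c k * (c j * (l - eigenvalue j)) * averaged_form (J k) (J j))"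
    unfolding averaged_form_def by (simp add: int Bochner_Integration.integral_sum)
  also have "\<dots> = (\<Sum>k\<le>N. \<Sum>j\<le>N. if k = j then (c k)\<^sup>2 * (l - eigenvalue k) * averaged_form (J k) (J k) else 0)"
    by (intro sum.cong refl) (auto simp: averaged_form_jacobi_orthogonal J_def power2_eq_square)
  also have "\<dots> = (\<Sum>k\<le>N. (c k)\<^sup>2 * (l - eigenvalue k) * averaged_form (J k) (J k))"
    by simp
  also have "\<dots> \<le> (\<Sum>k\<le>N. if k = 0 then l * (c 0)\<^sup>2 else 0)"
  proof (intro sum_mono)
    fix k
    show "(c k)\<^sup>2 * (l - eigenvalue k) * averaged_form (J k) (J k) \<le> (if k = 0 then l * (c 0)\<^sup>2 else 0)"
    proof -
      consider "k = 0" | "k > 0" "k \<le> d" | "k > d" by linarith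
      then show ?thesis
      proof cases
        case 1
        have "averaged_form (J 0) (J 0) = 1"
          unfolding averaged_form_def by (simp add: J_def averaged_def sum_weights prob_space)
        then show ?thesis using 1 by (simp add: eigenvalue_def)
      next
        case 2
        have "averaged (J k) z = 0" if "z \<in> sphere_K \<delta> m" for z
          using averaged_low_degree[OF _ that, of "J k"] 2 zonal_mean_jacobi[of k]
            degree_jacobi_poly[OF alpha_beta_gt[OF ctx]] by (simp add: J_def)
        then have "averaged_form (J k) (J k) = (\<integral>z. 0 \<partial>sigma_K \<delta> m)"
          unfolding averaged_form_def using \<delta> m
          by (intro Bochner_Integration.integral_cong refl) (auto simp: space_sigma_K)
        then show ?thesis using 2 by simp
      next
        case 3
        have "l \<le> eigenvalue k"
          using 3 eigenvalue_strict_mono[of "d + 1" k] unfolding l_def by (cases "k = d + 1") auto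
        moreover have "averaged_form (J k) (J k) \<ge> 0"
          unfolding averaged_form_def by (intro integral_nonneg_AE AE_I2) simp
        ultimately have "(c k)\<^sup>2 * (l - eigenvalue k) * averaged_form (J k) (J k) \<le> 0"
          by (intro mult_nonpos_nonneg[OF mult_nonneg_nonpos]) auto
        then show ?thesis using 3 by simp
      qed
    qed
  qed
  also have "\<dots> = l * (zonal_mean P)\<^sup>2" by (simp add: mean)
  finally show ?thesis .
qed

text \<open>On the diagonal P Q is close to C P, whose integral is C times the mean. Off the
  diagonal only near-nonnegativity is available, and it bounds the integral below by a multiple of
  -\<eta>.\<close>

lemma averaged_form_lower:
  fixes P Q :: "real poly" and K C \<eta> :: real
  assumes K: "K > 0" and C: "C > 0" and \<eta>: "0 < \<eta>" "\<eta> \<le> 1"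
    and P: "\<And>u. u \<in> {0..1} \<Longrightarrow> - K * \<eta> \<le> poly P u \<and> \<bar>poly P u\<bar> \<le> K"
    and Q: "\<And>u. u \<in> {0..1} \<Longrightarrow> - K * \<eta> \<le> poly Q u \<and> poly Q u \<le> C + K * \<eta>"
    and PQ: "\<And>u. u \<in> {0..1} \<Longrightarrow> \<bar>poly P u * (poly Q u - C)\<bar> \<le> K * \<eta>"
  shows "C * zonal_mean P * (\<Sum>i<n. (\<rho> i)\<^sup>2) - (K + (3 * K\<^sup>2 + K * C)) * \<eta> \<le> averaged_form P Q"
proof -
  interpret prob_space "sigma_K \<delta> m" by (rule prob_space_sigma_K) (use \<delta> m in auto)
  have space: "space (sigma_K \<delta> m) = sphere_K \<delta> m" by (rule space_sigma_K) (use \<delta> m in auto)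
  \<comment> \<open>From (P + K \<eta>) (Q + K \<eta>) \<ge> 0: the correction K \<eta> (P + Q + K
    \<eta>) is at most K \<eta> (K + (C + K) + K), using \<eta> \<le> 1.\<close>
  define K' where "K' = 3 * K\<^sup>2 + K * C"
  have K': "K' \<ge> 0" using K C by (simp add: K'_def)
  have prod_ge: "- K' * \<eta> \<le> poly P u * poly Q v" if "u \<in> {0..1}" "v \<in> {0..1}" for u v
  proof -
    have "0 \<le> (poly P u + K * \<eta>) * (poly Q v + K * \<eta>)"
      using P[OF that(1)] Q[OF that(2)] by (intro mult_nonneg_nonneg) auto
    then have "- (K * \<eta>) * (poly P u + poly Q v + K * \<eta>) \<le> poly P u * poly Q v"
      by (simp add: algebra_simps)
    moreover have "(K * \<eta>) * (poly P u + poly Q v + K * \<eta>) \<le> (K * \<eta>) * (3 * K + C)"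
    proof (rule mult_left_mono)
      have "K * \<eta> \<le> K * 1" using K \<eta> by (intro mult_left_mono) auto
      then show "poly P u + poly Q v + K * \<eta> \<le> 3 * K + C"
        using P[OF that(1)] Q[OF that(2)] by linarith
    qed (use K \<eta> in simp)
    moreover have "(K * \<eta>) * (3 * K + C) = K' * \<eta>" by (simp add: K'_def power2_eq_square algebra_simps)
    ultimately show ?thesis unfolding mult_minus_left by linarith
  qed
  \<comment> \<open>The slack K' \<eta> is granted on the diagonal as well, so that it sums to K'
    \<eta> over all pairs, the weights having sum 1.\<close>
  have entry: "(if i = j then C * zonal_mean P - K * \<eta> else 0) - K' * \<eta>
      \<le> (\<integral>z. poly P (zonal i z) * poly Q (zonal j z) \<partial>sigma_K \<delta> m)" if ij: "i < n" "j < n" for i j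
  proof (cases "i = j")
    case True
    have "C * zonal_mean P - K * \<eta> - K' * \<eta> \<le> C * zonal_mean P - K * \<eta>" using K' \<eta> by simp
    also have "\<dots> = (\<integral>z. C * poly P (zonal i z) - K * \<eta> \<partial>sigma_K \<delta> m)"
      using zonal_mean_node[OF ij(1), of P]
      by (simp add: integrable_polyfun[OF polyfun_zonal] prob_space)
    also have "\<dots> \<le> (\<integral>z. poly P (zonal i z) * poly Q (zonal i z) \<partial>sigma_K \<delta> m)"
    proof (rule integral_mono)
      show "integrable (sigma_K \<delta> m) (\<lambda>z. C * poly P (zonal i z) - K * \<eta>)"
        by (simp add: integrable_polyfun[OF polyfun_zonal])
      show "integrable (sigma_K \<delta> m) (\<lambda>z. poly P (zonal i z) * poly Q (zonal i z))"
        by (intro integrable_polyfun polyfun_intros polyfun_zonal)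
      fix z assume "z \<in> space (sigma_K \<delta> m)"
      then show "C * poly P (zonal i z) - K * \<eta> \<le> poly P (zonal i z) * poly Q (zonal i z)"
        using PQ[OF zonal_range[OF ij(1)], of z] by (simp add: space right_diff_distrib mult.commute abs_le_iff)
    qed
    finally show ?thesis using True by simp
  next
    case False
    have "- K' * \<eta> = (\<integral>z. - K' * \<eta> \<partial>sigma_K \<delta> m)" by (simp add: prob_space)
    also have "\<dots> \<le> (\<integral>z. poly P (zonal i z) * poly Q (zonal j z) \<partial>sigma_K \<delta> m)"
      by (intro integral_mono integrable_polyfun polyfun_intros polyfun_zonal prod_ge zonal_range ij)
         (auto simp: space)
    finally show ?thesis using False by simp
  qed
  define s where "s = (\<Sum>i<n. (\<rho> i)\<^sup>2)"
  have s1: "s \<le> 1"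
  proof -
    have "\<rho> i \<le> 1" if "i < n" for i
      using member_le_sum[of i "{..<n}" \<rho>] that weights sum_weights by (auto intro: less_imp_le)
    then have "s \<le> (\<Sum>i<n. \<rho> i)"
      unfolding s_def power2_eq_square using weights
      by (intro sum_mono mult_left_le) (auto intro: less_imp_le)
    then show ?thesis by (simp add: sum_weights)
  qed
  have "(\<Sum>i<n. \<Sum>j<n. \<rho> i * \<rho> j * ((if i = j then C * zonal_mean P - K * \<eta> else 0) - K' * \<eta>))
      \<le> averaged_form P Q"
    unfolding averaged_form_expand using weights entry
    by (intro sum_mono mult_left_mono mult_nonneg_nonneg) (auto intro: less_imp_le)
  also have "(\<Sum>i<n. \<Sum>j<n. \<rho> i * \<rho> j * ((if i = j then C * zonal_mean P - K * \<eta> else 0) - K' * \<eta>))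
     = (\<Sum>i<n. \<Sum>j<n. if i = j then \<rho> i * \<rho> j * (C * zonal_mean P - K * \<eta>) else 0)
       - (\<Sum>i<n. \<Sum>j<n. \<rho> i * \<rho> j) * (K' * \<eta>)"
    unfolding sum_distrib_right sum_subtractf[symmetric] by (intro sum.cong refl) (auto simp: algebra_simps)
  also have "(\<Sum>i<n. \<Sum>j<n. \<rho> i * \<rho> j) = 1"
    unfolding sum_product[symmetric] by (simp add: sum_weights)
  also have "(\<Sum>i<n. \<Sum>j<n. if i = j then \<rho> i * \<rho> j * (C * zonal_mean P - K * \<eta>) else 0)
      = s * (C * zonal_mean P - K * \<eta>)"
    by (simp add: s_def power2_eq_square sum_distrib_right)
  finally have "s * (C * zonal_mean P - K * \<eta>) - K' * \<eta> \<le> averaged_form P Q" by simp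
  moreover have "s * (K * \<eta>) \<le> 1 * (K * \<eta>)" using s1 K \<eta> by (intro mult_right_mono) auto
  ultimately show ?thesis
    unfolding s_def[symmetric] K'_def[symmetric] by (simp add: algebra_simps)
qed

text \<open>The sign of C is left open: with -Q, -C and a smaller cap the same estimate yields a
  lower bound for the mean.\<close>

lemma zonal_mean_le_cap:
  assumes \<tau>: "0 < \<tau>" "\<tau> < 1"
    and Q: "\<And>u. u \<in> {0..1} \<Longrightarrow> poly Q u \<le> (if \<tau> \<le> u then C else 0) + e"
    and X: "((\<lambda>u. u powr \<beta> * (1 - u) powr \<alpha>) has_integral X) {\<tau>..1}"
  shows "zonal_mean Q \<le> C * X / Beta (\<beta> + 1) (\<alpha> + 1) + e"
proof -
  define w where "w u = u powr \<beta> * (1 - u) powr \<alpha>" for u :: real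
  have "((\<lambda>u. if u \<in> {\<tau>..1} then C * w u else 0) has_integral (C * X)) {0..1}"
    using \<tau> X unfolding w_def by (subst has_integral_restrict) (auto intro!: has_integral_mult_right)
  moreover have "((\<lambda>u. e * w u) has_integral (e * Beta (\<beta> + 1) (\<alpha> + 1))) {0..1}"
    unfolding w_def by (intro has_integral_mult_right zonal_weight_has_integral)
  ultimately have "((\<lambda>u. (if u \<in> {\<tau>..1} then C * w u else 0) + e * w u) has_integral
      (C * X + e * Beta (\<beta> + 1) (\<alpha> + 1))) {0..1}"
    by (rule has_integral_add)
  then have "Beta (\<beta> + 1) (\<alpha> + 1) * zonal_mean Q \<le> C * X + e * Beta (\<beta> + 1) (\<alpha> + 1)"
  proof (rule has_integral_le[OF zonal_mean_has_integral])
    fix u :: real assume u: "u \<in> {0..1}"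
    have "poly Q u * w u \<le> ((if \<tau> \<le> u then C else 0) + e) * w u"
      using Q[OF u] by (intro mult_right_mono) (auto simp: w_def)
    then show "poly Q u * (u powr \<beta> * (1 - u) powr \<alpha>) \<le> (if u \<in> {\<tau>..1} then C * w u else 0) + e * w u"
      using u unfolding w_def[symmetric] by (auto simp: distrib_right split: if_splits)
  qed
  then show ?thesis using Beta_pos by (simp add: field_simps)
qed

text \<open>With s the sum of squared weights and A the mean of P, the two estimates of the form
  give C A s \<le> A (C X / Bt) + O(\<eta>), where \<open>Bt\<close> is the total Beta mass. A
  violation of the claim leaves a fixed gap, which contradicts this for small \<eta> as long as A
  stays away from 0.\<close>

lemma sum_weights_squared_le:
  assumes d: "d \<ge> 1" and \<xi>: "\<xi> = Max {t. jacobiP d (\<alpha> + 1) (\<beta> + 1) t = 0}"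
    and \<tau>: "\<tau> = (1 + \<xi>) / 2"
    and X: "((\<lambda>u. u powr \<beta> * (1 - u) powr \<alpha>) has_integral X) {\<tau>..1}"
  shows "(\<Sum>i<n. (\<rho> i)\<^sup>2) \<le> X / Beta (\<beta> + 1) (\<alpha> + 1)"
proof -
  define l where "l = eigenvalue (d + 1)"
  obtain Y where \<tau>01: "0 < \<tau>" "\<tau> < 1" and Y: "poly (pderiv Y) \<tau> = 0"
    "\<And>u. \<tau> < u \<Longrightarrow> poly (pderiv Y) u > 0" "Lop \<alpha> \<beta> Y = smult (- l) Y" "poly Y \<tau> < 0"
    using jacobi_largest_root[OF alpha_beta_gt[OF ctx] d \<xi> \<tau>] unfolding l_def eigenvalue_def by metis
  have l: "l > 0" using eigenvalue_strict_mono[of 0 "d + 1"] by (simp add: l_def eigenvalue_def)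
  define C where "C = - l * poly Y \<tau>"
  have C: "C > 0" using l Y(4) by (simp add: C_def mult_pos_neg)
  obtain K where K: "K > 0" and approx: "\<And>\<eta>. 0 < \<eta> \<Longrightarrow> \<eta> < 1 - \<tau> \<Longrightarrow>
    \<exists>P. \<forall>u\<in>{0..1}. - K * \<eta> \<le> poly P u \<and> \<bar>poly P u\<bar> \<le> K
       \<and> - K * \<eta> \<le> poly (Lop \<alpha> \<beta> P + smult l P) u
       \<and> poly (Lop \<alpha> \<beta> P + smult l P) u \<le> (if \<tau> \<le> u then C else 0) + K * \<eta>
       \<and> \<bar>poly P u * (poly (Lop \<alpha> \<beta> P + smult l P) u - C)\<bar> \<le> K * \<eta>
       \<and> (\<tau> + \<eta> \<le> u \<longrightarrow> C - K * \<eta> \<le> poly (Lop \<alpha> \<beta> P + smult l P) u)"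
    using smooth_cap_approximation[OF \<tau>01 Y(1,2,3) C_def C l] by metis
  define Bt where "Bt = Beta (\<beta> + 1) (\<alpha> + 1)"
  have Bt: "Bt > 0" unfolding Bt_def by (rule Beta_pos)
  \<comment> \<open>A smaller cap that stays beyond \<tau> + \<eta> for all admissible \<eta>. There
    (L + l) P is nearly C, and its positive mass X' bounds A below independently of \<eta>.\<close>
  define \<tau>' where "\<tau>' = (1 + \<tau>) / 2"
  have \<tau>': "0 < \<tau>'" "\<tau>' < 1" using \<tau>01 by (auto simp: \<tau>'_def)
  define X' where "X' = (1 - \<tau>') powr (\<alpha> + 1) / (\<alpha> + 1) * hyp2F1 (- \<beta>) (\<alpha> + 1) (\<alpha> + 2) (1 - \<tau>')"
  have X': "((\<lambda>u. u powr \<beta> * (1 - u) powr \<alpha>) has_integral X') {\<tau>'..1}" "X' > 0"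
    unfolding X'_def using incomplete_beta_has_integral[OF alpha_beta_gt(1)[OF ctx] \<tau>'] by auto
  define s where "s = (\<Sum>i<n. (\<rho> i)\<^sup>2)"
  have "s \<le> X / Bt"
  proof (rule ccontr)
    assume "\<not> s \<le> X / Bt"
    then have gap: "s - X / Bt > 0" by simp
    define A0 where "A0 = C * X' / (2 * Bt) / l"
    have A0: "A0 > 0" using C X' Bt l by (simp add: A0_def)
    \<comment> \<open>Collects the error of the lower estimate and, through A \<le> K, the term A K
      \<eta> of the upper one.\<close>
    define K3 where "K3 = K + (3 * K\<^sup>2 + K * C) + K * K"
    have K3: "K3 > 0" using K C by (simp add: K3_def add_pos_nonneg)
    define g where "g = A0 * C * (s - X / Bt)"
    have g: "g > 0" using A0 C gap by (simp add: g_def)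
    \<comment> \<open>The three bounds give \<tau> + \<eta> \<le> \<tau>', leave half of C X' / Bt
      in the lower bound for l A, and push the total error K3 \<eta> strictly below g.\<close>
    define \<eta> where "\<eta> = min ((1 - \<tau>) / 2) (min (C * X' / (2 * Bt) / K) (g / (2 * K3)))"
    have "\<eta> \<le> (1 - \<tau>) / 2" unfolding \<eta>_def by (rule min.cobounded1)
    moreover have "\<eta> > 0" using \<tau>01 C X'(2) Bt K g K3 by (simp add: \<eta>_def)
    ultimately have \<eta>: "0 < \<eta>" "\<eta> < 1 - \<tau>" "\<eta> \<le> 1" "\<tau> + \<eta> \<le> \<tau>'"
      using \<tau>01 by (auto simp: \<tau>'_def field_simps)
    have "\<eta> \<le> C * X' / (2 * Bt) / K" "\<eta> \<le> g / (2 * K3)"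
      unfolding \<eta>_def by (rule min.coboundedI2, rule min.cobounded1, rule min.coboundedI2, rule min.cobounded2)
    then have "\<eta> * K \<le> C * X' / (2 * Bt)" "\<eta> * (2 * K3) \<le> g"
      using K K3 by (simp_all only: pos_le_divide_eq mult_pos_pos zero_less_numeral)
    then have K\<eta>: "K * \<eta> \<le> C * X' / (2 * Bt)" and K3\<eta>: "K3 * \<eta> < g"
      using g mult.left_commute[of \<eta> 2 K3] by (simp_all only: mult.commute[of \<eta>])
    obtain P where P: "\<And>u. u \<in> {0..1} \<Longrightarrow> - K * \<eta> \<le> poly P u \<and> \<bar>poly P u\<bar> \<le> K
       \<and> - K * \<eta> \<le> poly (Lop \<alpha> \<beta> P + smult l P) u
       \<and> poly (Lop \<alpha> \<beta> P + smult l P) u \<le> (if \<tau> \<le> u then C else 0) + K * \<eta>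
       \<and> \<bar>poly P u * (poly (Lop \<alpha> \<beta> P + smult l P) u - C)\<bar> \<le> K * \<eta>
       \<and> (\<tau> + \<eta> \<le> u \<longrightarrow> C - K * \<eta> \<le> poly (Lop \<alpha> \<beta> P + smult l P) u)"
      using approx[OF \<eta>(1,2)] by blast
    define Q where "Q = Lop \<alpha> \<beta> P + smult l P"
    note PQ = P[folded Q_def]
    define A where "A = zonal_mean P"
    \<comment> \<open>L P has mean zero, so only the term l P contributes.\<close>
    have lA: "zonal_mean Q = l * A"
      by (simp add: Q_def A_def zonal_mean_add zonal_mean_Lop zonal_mean_smult)
    have upper: "l * A \<le> C * X / Bt + K * \<eta>"
      unfolding lA[symmetric] Bt_def using PQ by (intro zonal_mean_le_cap[OF \<tau>01 _ X]) blast
    have lower: "C * X' / Bt - K * \<eta> \<le> l * A"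
    proof -
      have "zonal_mean (- Q) \<le> (- C) * X' / Bt + K * \<eta>"
        unfolding Bt_def
      proof (rule zonal_mean_le_cap[OF \<tau>' _ X'(1)])
        show "poly (- Q) u \<le> (if \<tau>' \<le> u then - C else 0) + K * \<eta>" if "u \<in> {0..1}" for u
          using PQ[OF that] \<eta>(4) by auto
      qed
      then show ?thesis using zonal_mean_smult[of "-1" Q] lA by simp
    qed
    have "C * X' / (2 * Bt) \<le> l * A" using lower K\<eta> by (simp add: field_simps)
    then have AA0: "A0 \<le> A" using l unfolding A0_def by (simp only: pos_divide_le_eq[OF l] mult.commute[of A l])
    have "A \<le> K"
    proof -
      interpret prob_space "sigma_K \<delta> m" by (rule prob_space_sigma_K) (use \<delta> m in auto)
      have "A = (\<integral>z. poly P (zonal 0 z) \<partial>sigma_K \<delta> m)" by (simp add: A_def zonal_mean_node[OF n_pos])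
      also have "\<dots> \<le> (\<integral>z. K \<partial>sigma_K \<delta> m)"
      proof (rule integral_mono)
        fix z assume "z \<in> space (sigma_K \<delta> m)"
        then have "z \<in> sphere_K \<delta> m" using space_sigma_K[of \<delta> m] \<delta> m by auto
        then show "poly P (zonal 0 z) \<le> K" using PQ[OF zonal_range[OF n_pos]] by (auto simp: abs_le_iff)
      qed (auto intro: integrable_polyfun polyfun_zonal)
      finally show ?thesis by (simp add: prob_space)
    qed
    have "C * A * s - (K + (3 * K\<^sup>2 + K * C)) * \<eta> \<le> averaged_form P Q"
      unfolding A_def s_def
    proof (rule averaged_form_lower[OF K C \<eta>(1,3)])
      show "- K * \<eta> \<le> poly Q u \<and> poly Q u \<le> C + K * \<eta>" if "u \<in> {0..1}" for u
        using PQ[OF that] C by (auto split: if_splits)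
    qed (use PQ in blast)+
    also have "\<dots> \<le> A * (l * A)"
      using averaged_form_upper[of P] by (simp add: Q_def l_def A_def power2_eq_square mult_ac)
    also have "\<dots> \<le> A * (C * X / Bt + K * \<eta>)"
      using upper A0 AA0 by (intro mult_left_mono) auto
    finally have "A * (C * (s - X / Bt)) \<le> (K + (3 * K\<^sup>2 + K * C)) * \<eta> + A * (K * \<eta>)"
      by (simp add: algebra_simps)
    also have "\<dots> \<le> K3 * \<eta>"
      using \<open>A \<le> K\<close> mult_right_mono[of A K "K * \<eta>"] K \<eta> by (simp add: K3_def algebra_simps)
    finally have "A * (C * (s - X / Bt)) \<le> K3 * \<eta>" .
    moreover have "g \<le> A * (C * (s - X / Bt))"
      unfolding g_def mult.assoc using AA0 C gap by (intro mult_right_mono) auto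
    ultimately show False using K3\<eta> by simp
  qed
  then show ?thesis by (simp add: s_def Bt_def)
qed

end

theorem theorem4p1:
  fixes \<delta> m p n :: nat and x :: "nat \<Rightarrow> nat \<times> nat \<Rightarrow> real" and \<rho> :: "nat \<Rightarrow> real"
    and \<alpha> \<beta> \<xi> \<epsilon> :: real
  assumes "\<delta> \<in> {1, 2, 4}"
    and "m \<ge> 2"
    and "even p" and "p > 0"
    and "\<alpha> = (real (\<delta> * (m - 1)) - 2) / 2"
    and "\<beta> = (real \<delta> - 2) / 2"
    and "\<xi> = Max {t. jacobiP (p div 2) (\<alpha> + 1) (\<beta> + 1) t = 0}"
    and "\<epsilon> = (1 - \<xi>) / 2"
    and "proj_cubature \<delta> m p n x \<rho>"
  shows "real n \<ge> Gamma (\<alpha> + 2) * Gamma (\<beta> + 1)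
                  / (Gamma (\<alpha> + \<beta> + 2) * hyp2F1 (- \<beta>) (\<alpha> + 1) (\<alpha> + 2) \<epsilon>)
                  * (1 / \<epsilon>) powr (real (\<delta> * (m - 1)) / 2)"
proof -
  define \<tau> where "\<tau> = (1 + \<xi>) / 2"
  define d where "d = p div 2"
  have d: "d \<ge> 1" "p = 2 * d" using assms(3,4) by (auto simp: d_def)
  note ctx = assms(1,2,5,6) refl[of "idx \<delta> m"] assms(9)[unfolded d(2)]
  note gt = alpha_beta_gt[OF ctx(1-5)]
  have \<tau>: "0 < \<tau>" "\<tau> < 1"
    using jacobi_largest_root[OF gt d(1) assms(7)[folded d_def] \<tau>_def] by metis+
  have \<epsilon>: "\<epsilon> = 1 - \<tau>" "\<epsilon> > 0" using \<tau> by (auto simp: assms(8) \<tau>_def field_simps)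
  define F where "F = hyp2F1 (- \<beta>) (\<alpha> + 1) (\<alpha> + 2) \<epsilon>"
  define X where "X = \<epsilon> powr (\<alpha> + 1) / (\<alpha> + 1) * F"
  define Bt where "Bt = Beta (\<beta> + 1) (\<alpha> + 1)"
  have X: "((\<lambda>u. u powr \<beta> * (1 - u) powr \<alpha>) has_integral X) {\<tau>..1}" "X > 0"
    using incomplete_beta_has_integral[OF gt(1) \<tau>, of \<beta>] by (simp_all add: X_def F_def \<epsilon>)
  have Bt: "Bt > 0" unfolding Bt_def by (rule Beta_pos[OF ctx])
  have le: "(\<Sum>i<n. (\<rho> i)\<^sup>2) \<le> X / Bt"
    using sum_weights_squared_le[OF ctx d(1) assms(7)[folded d_def] \<tau>_def X(1)] by (simp add: Bt_def)
  \<comment> \<open>Cauchy-Schwarz against the constant 1 turns the bound on the squared weights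
    into one on their number.\<close>
  have "1 = (\<Sum>i<n. \<rho> i * 1)\<^sup>2" using sum_weights[OF ctx] by simp
  also have "\<dots> \<le> (\<Sum>i<n. (\<rho> i)\<^sup>2) * (\<Sum>i<n. 1\<^sup>2)" by (rule Cauchy_Schwarz_ineq_sum)
  also have "\<dots> = real n * (\<Sum>i<n. (\<rho> i)\<^sup>2)" by simp
  also have "\<dots> \<le> real n * (X / Bt)" using le by (intro mult_left_mono) auto
  finally have "Bt / X \<le> real n" using X(2) Bt by (simp add: field_simps)
  \<comment> \<open>The factor \<alpha> + 1 from X raises the Gamma argument \<alpha> + 1 to
    \<alpha> + 2, and the exponent \<delta> (m - 1) / 2 is \<alpha> + 1.\<close>
  moreover have "Bt / X = Gamma (\<alpha> + 2) * Gamma (\<beta> + 1) / (Gamma (\<alpha> + \<beta> + 2) * F)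
      * (1 / \<epsilon>) powr (real (\<delta> * (m - 1)) / 2)"
  proof -
    have e: "real (\<delta> * (m - 1)) / 2 = \<alpha> + 1" by (simp add: assms(5) field_simps)
    have G: "Gamma (\<alpha> + 2) = (\<alpha> + 1) * Gamma (\<alpha> + 1)"
      using Gamma_plus1[of "\<alpha> + 1"] gt by (auto simp: add.assoc nonpos_Ints_def dest!: Ints_cases)
    have "Bt = Gamma (\<beta> + 1) * Gamma (\<alpha> + 1) / Gamma (\<alpha> + \<beta> + 2)"
      by (simp add: Bt_def Beta_def add_ac)
    then show ?thesis
      unfolding e G X_def using gt \<epsilon>(2) by (simp add: powr_divide divide_simps)
  qed
  ultimately show ?thesis by (simp add: F_def)
qed

end
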